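(* The functions $\Sigma$ and $C$ are not monotone under sequential composition of unitary channels, in the following sense. (i) Let $\mathcal U,\mathcal V\in\mathfrak U(AB,AB)$ be bipartite unitary channels and let $\mathcal I$ be the identity channel on $AB$, and regard $\mathcal U\otimes\mathcal I$, $\mathcal I\otimes\mathcal V$ and $\mathcal U\otimes\mathcal V$ as bipartite channels in which Alice holds both copies of $A$ and Bob both copies of $B$. Then $$\Sigma[(\mathcal U\otimes\mathcal I)\circ(\mathcal I\otimes\mathcal V)]=\Sigma(\mathcal U\otimes\mathcal V)\ge\max\{\Sigma(\mathcal U),\Sigma(\mathcal V)\}=\max\{\Sigma(\mathcal U\otimes\mathcal I),\Sigma(\mathcal I\otimes\mathcal V)\},$$ and the same holds with $\Sigma$ replaced by $C$. For $\mathcal U=\mathcal V=\mathcal C_X$ (the two-qubit CNOT channel, Alice holding the target and Bob the control), the inequality for $\Sigma$ is strict: $\max\{\Sigma(\mathcal C_X\otimes\mathcal I),\Sigma(\mathcal I\otimes\mathcal C_X)\}=1$ while $\Sigma[(\mathcal C_X\otimes\mathcal I)\circ(\mathcal I\otimes\mathcal C_X)]\ge\frac32$. (ii) Let $\mathcal S$ be the SWAP channel of two qubits. Then $\mathcal S\circ\mathcal S=\mathcal I$ satisfies $$\Sigma(\mathcal S\circ\mathcal S)=0<\tfrac32=\Sigma(\mathcal S),\qquad C(\mathcal S\circ\mathcal S)=0<2=C(\mathcal S),$$ so that a composition $\mathcal U\circ\mathcal V$ can satisfy $\Sigma(\mathcal U\circ\mathcal V)<\min\{\Sigma(\mathcal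 U),\Sigma(\mathcal V)\}$ and $C(\mathcal U\circ\mathcal V)<\min\{C(\mathcal U),C(\mathcal V)\}$.
   Context: All systems are finite-dimensional quantum systems; system $X$ has complex Hilbert space $\mathcal H_X$ of dimension $d_X$, and the composite system $XY$ has Hilbert space $\mathcal H_X\otimes\mathcal H_Y$. $\mathsf{St}(X)$ is the set of density operators on $\mathcal H_X$. $\mathfrak C(X,Y)$ is the set of quantum channels (completely positive trace-preserving linear maps) from operators on $\mathcal H_X$ to operators on $\mathcal H_Y$, and $\mathfrak C(X)=\mathfrak C(X,X)$. $\mathcal I_X$ is the identity channel on $X$. $\mathfrak U(AB,A'B')$ is the set of unitary channels $\rho\mapsto U\rho U^\dagger$ with $U:\mathcal H_A\otimes\mathcal H_B\to\mathcal H_{A'}\otimes\mathcal H_{B'}$ unitary, where $A,A'$ are Alice's input and output and $B,B'$ are Bob's. $\|X\|_1=\mathrm{Tr}\sqrt{X^\dagger X}$. For a Hermitian-preserving linear map $\mathcal L$ with input system $X$, the diamond norm is $\|\mathcal L\|_\diamond=\sup_{\rho\in\mathsf{St}(EX)}\|(\mathcal I_E\otimes\mathcal L)(\rho)\|_1$ with $E\cong X$. For $\mathcal U\in\mathfrak U(AB,A'B')$, let $\mathcal T(\mathcal U)=(\mathcal I_A\otimes\mathcal U)\circ(\mathcal S_{AA}\otimes\mathcal I_B)\circ(\mathcal I_A\otimes\mathcal U^{-1})\in\mathfrak C(AA'B')$, where $\mathcal S_{AA}$ is the swap of two copies of $A$. The signalling and the causal influence of $\mathcal U$ (from $A$ to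 $B'$) are $$\Sigma(\mathcal U)=\inf_{\mathcal C\in\mathfrak C(B,B')}\|(\mathrm{Tr}_{A'}\otimes\mathcal I_{B'})\circ\mathcal U-\mathrm{Tr}_A\otimes\mathcal C\|_\diamond,\qquad C(\mathcal U)=\inf_{\mathcal C\in\mathfrak C(AA')}\|\mathcal T(\mathcal U)-\mathcal C\otimes\mathcal I_{B'}\|_\diamond .$$ The CNOT gate is the unitary on $\mathbb C^2\otimes\mathbb C^2$ with $\mathrm{CNOT}(|a\rangle\otimes|b\rangle)=|a\oplus b\rangle\otimes|b\rangle$ for $a,b\in\{0,1\}$, and $\mathcal C_X:\rho\mapsto\mathrm{CNOT}\,\rho\,\mathrm{CNOT}$; Alice's input and output are the first (target) qubit, Bob's the second (control) qubit. The two-qubit SWAP gate is $S(|\psi\rangle\otimes|\varphi\rangle)=|\varphi\rangle\otimes|\psi\rangle$ on $\mathbb C^2\otimes\mathbb C^2$ and $\mathcal S:\rho\mapsto S\rho S$; Alice's input and output are the first tensor factor, Bob's the second. *)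

theory Defs
  imports "HOL-Analysis.Analysis"
begin

text \<open>
  A system of dimension \<open>d\<close> is a finite index type of cardinality \<open>d\<close> (an orthonormal basis of its
  Hilbert space \<^typ>\<open>complex^'x\<close>); the composite of \<open>'x\<close> and \<open>'y\<close> is \<^typ>\<open>'x \<times> 'y\<close>.
\<close>

type_synonym 'x op = "complex^'x^'x"

section \<open>Operators and states\<close>

definition cinner :: "complex^'x::finite \<Rightarrow> complex^'x \<Rightarrow> complex" where
  "cinner v w = (\<Sum>i\<in>UNIV. cnj (v $ i) * w $ i)"

definition dagger :: "complex^'x::finite^'y::finite \<Rightarrow> complex^'y^'x" where
  "dagger A = (\<chi> i j. cnj (A $ j $ i))"

definition cscale :: "complex \<Rightarrow> 'x::finite op \<Rightarrow> 'x op" where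
  "cscale c A = (\<chi> i j. c * A $ i $ j)"

definition psd :: "'x::finite op \<Rightarrow> bool" where
  "psd A \<longleftrightarrow> (\<forall>v. cinner v (A *v v) \<in> \<real>\<^sub>\<ge>\<^sub>0)"

definition density_ops :: "'x::finite op set" where
  "density_ops = {\<rho>. psd \<rho> \<and> trace \<rho> = 1}"

text \<open>The positive square root; meaningful for positive semidefinite arguments, where it exists
  and is unique.\<close>

definition psd_sqrt :: "'x::finite op \<Rightarrow> 'x op" where
  "psd_sqrt A = (THE R. psd R \<and> R ** R = A)"

definition trace_norm :: "'x::finite op \<Rightarrow> real" where
  "trace_norm X = Re (trace (psd_sqrt (dagger X ** X)))"

section \<open>Linear maps on operators and channels\<close>

definition clinear_map :: "('x::finite op \<Rightarrow> 'y::finite op) \<Rightarrow> bool" where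
  "clinear_map L \<longleftrightarrow>
     (\<forall>A B. L (A + B) = L A + L B) \<and> (\<forall>c A. L (cscale c A) = cscale c (L A))"

text \<open>
  Complete positivity demands positivity of \<open>id \<otimes> L\<close> for ancillas of every dimension \<open>n\<close>.
  Since \<open>n\<close> has to be quantified inside the definition, an operator on \<open>\<complex>\<^sup>n \<otimes> H\<close> is given here as
  an \<open>n \<times> n\<close> block matrix \<open>M i j\<close> (\<open>i, j < n\<close>) of operators on \<open>H\<close>.
\<close>

definition block_psd :: "nat \<Rightarrow> (nat \<Rightarrow> nat \<Rightarrow> 'x::finite op) \<Rightarrow> bool" where
  "block_psd n M \<longleftrightarrow>
     (\<forall>v :: nat \<Rightarrow> complex^'x. (\<Sum>i<n. \<Sum>j<n. cinner (v i) (M i j *v v j)) \<in> \<real>\<^sub>\<ge>\<^sub>0)"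

definition completely_positive :: "('x::finite op \<Rightarrow> 'y::finite op) \<Rightarrow> bool" where
  "completely_positive L \<longleftrightarrow> (\<forall>n M. block_psd n M \<longrightarrow> block_psd n (\<lambda>i j. L (M i j)))"

definition channels :: "('x::finite op \<Rightarrow> 'y::finite op) set" where
  "channels = {L. clinear_map L \<and> completely_positive L \<and> (\<forall>A. trace (L A) = trace A)}"

definition unitary_op :: "complex^'x::finite^'y::finite \<Rightarrow> bool" where
  "unitary_op U \<longleftrightarrow> dagger U ** U = mat 1 \<and> U ** dagger U = mat 1"

definition conj_channel :: "complex^'x::finite^'y::finite \<Rightarrow> 'x op \<Rightarrow> 'y op" where
  "conj_channel U \<rho> = U ** \<rho> ** dagger U"

definition unitary_channels :: "('x::finite op \<Rightarrow> 'y::finite op) set" where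
  "unitary_channels = {conj_channel U | U. unitary_op U}"

definition matrix_unit :: "'x::finite \<Rightarrow> 'x \<Rightarrow> 'x op" where
  "matrix_unit i j = (\<chi> k l. if k = i \<and> l = j then 1 else 0)"

text \<open>The tensor product of two linear maps, determined by
  \<open>(L \<otimes> M) (E\<^sub>i\<^sub>j \<otimes> E\<^sub>k\<^sub>l) = L E\<^sub>i\<^sub>j \<otimes> M E\<^sub>k\<^sub>l\<close> on matrix units.\<close>

definition tensor_map ::
  "('x::finite op \<Rightarrow> 'u::finite op) \<Rightarrow> ('y::finite op \<Rightarrow> 'v::finite op)
   \<Rightarrow> ('x \<times> 'y) op \<Rightarrow> ('u \<times> 'v) op"
  (infixr "\<otimes>\<^sub>L" 75) where
  "(L \<otimes>\<^sub>L M) \<rho> = (\<chi> p q. \<Sum>i\<in>UNIV. \<Sum>j\<in>UNIV. \<Sum>k\<in>UNIV. \<Sum>l\<in>UNIV.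
      \<rho> $ (i, k) $ (j, l) *
      (L (matrix_unit i j) $ fst p $ fst q * M (matrix_unit k l) $ snd p $ snd q))"

text \<open>The trace as a map to operators on the trivial one-dimensional system.\<close>

definition trace_channel :: "'x::finite op \<Rightarrow> unit op" where
  "trace_channel \<rho> = (\<chi> i j. trace \<rho>)"

definition diamond_norm :: "('x::finite op \<Rightarrow> 'y::finite op) \<Rightarrow> real" where
  "diamond_norm L =
     (SUP \<rho> \<in> (density_ops :: ('x \<times> 'x) op set). trace_norm ((id \<otimes>\<^sub>L L) \<rho>))"

section \<open>Basis permutations\<close>

text \<open>The operator with \<open>|j\<rangle> \<mapsto> |f j\<rangle>\<close> on basis vectors.\<close>

definition basis_op :: "('x::finite \<Rightarrow> 'y::finite) \<Rightarrow> complex^'x^'y" where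
  "basis_op f = (\<chi> i j. if i = f j then 1 else 0)"

definition swap_channel :: "('x::finite \<times> 'y::finite) op \<Rightarrow> ('y \<times> 'x) op" where
  "swap_channel = conj_channel (basis_op (\<lambda>(x, y). (y, x)))"

definition assoc_left :: "('x::finite \<times> 'y::finite \<times> 'z::finite) op \<Rightarrow> (('x \<times> 'y) \<times> 'z) op" where
  "assoc_left = conj_channel (basis_op (\<lambda>(x, y, z). ((x, y), z)))"

definition assoc_right :: "(('x::finite \<times> 'y::finite) \<times> 'z::finite) op \<Rightarrow> ('x \<times> 'y \<times> 'z) op" where
  "assoc_right = conj_channel (basis_op (\<lambda>((x, y), z). (x, y, z)))"

definition middle_swap ::
  "(('x::finite \<times> 'y::finite) \<times> ('u::finite \<times> 'v::finite)) op
   \<Rightarrow> (('x \<times> 'u) \<times> ('y \<times> 'v)) op" where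
  "middle_swap = conj_channel (basis_op (\<lambda>((x, y), (u, v)). ((x, u), (y, v))))"

text \<open>\<open>L \<otimes> M\<close> as a bipartite map: Alice holds the first factor of each of \<open>L\<close> and \<open>M\<close>, Bob the
  second.\<close>

definition bipartite_tensor ::
  "(('a::finite \<times> 'b::finite) op \<Rightarrow> ('c::finite \<times> 'd::finite) op)
   \<Rightarrow> (('e::finite \<times> 'f::finite) op \<Rightarrow> ('g::finite \<times> 'h::finite) op)
   \<Rightarrow> (('a \<times> 'e) \<times> ('b \<times> 'f)) op \<Rightarrow> (('c \<times> 'g) \<times> ('d \<times> 'h)) op"
  (infixr "\<otimes>\<^sub>A\<^sub>B" 75) where
  "L \<otimes>\<^sub>A\<^sub>B M = middle_swap \<circ> (L \<otimes>\<^sub>L M) \<circ> middle_swap"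

section \<open>Signalling and causal influence\<close>

definition signalling ::
  "(('a::finite \<times> 'b::finite) op \<Rightarrow> ('c::finite \<times> 'd::finite) op) \<Rightarrow> real" where
  "signalling U =
     (INF C \<in> (channels :: ('b op \<Rightarrow> 'd op) set).
        diamond_norm (\<lambda>\<rho>. ((trace_channel \<otimes>\<^sub>L id) \<circ> U) \<rho> - (trace_channel \<otimes>\<^sub>L C) \<rho>))"

definition T_map ::
  "(('a::finite \<times> 'b::finite) op \<Rightarrow> ('c::finite \<times> 'd::finite) op)
   \<Rightarrow> ('a \<times> 'c \<times> 'd) op \<Rightarrow> ('a \<times> 'c \<times> 'd) op" where
  "T_map U =
     (id \<otimes>\<^sub>L U) \<circ> (assoc_right \<circ> (swap_channel \<otimes>\<^sub>L id) \<circ> assoc_left) \<circ> (id \<otimes>\<^sub>L inv U)"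

definition causal_influence ::
  "(('a::finite \<times> 'b::finite) op \<Rightarrow> ('c::finite \<times> 'd::finite) op) \<Rightarrow> real" where
  "causal_influence U =
     (INF C \<in> (channels :: (('a \<times> 'c) op \<Rightarrow> ('a \<times> 'c) op) set).
        diamond_norm (\<lambda>\<rho>. T_map U \<rho> - (assoc_right \<circ> (C \<otimes>\<^sub>L id) \<circ> assoc_left) \<rho>))"

section \<open>Two-qubit gates\<close>

text \<open>The basis of a qubit is indexed by the two-element ring \<^typ>\<open>2\<close>, in which addition is \<open>\<oplus>\<close>.
  CNOT and SWAP are self-adjoint, so conjugation is \<open>\<rho> \<mapsto> CNOT \<rho> CNOT\<close>, respectively \<open>\<rho> \<mapsto> S \<rho> S\<close>.\<close>

definition CNOT :: "complex^(2 \<times> 2)^(2 \<times> 2)" where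
  "CNOT = basis_op (\<lambda>(a, b). (a + b, b))"

definition cnot_channel :: "(2 \<times> 2) op \<Rightarrow> (2 \<times> 2) op" where
  "cnot_channel = conj_channel CNOT"

abbreviation qubit_swap :: "(2 \<times> 2) op \<Rightarrow> (2 \<times> 2) op" where
  "qubit_swap \<equiv> swap_channel"

end

theory Submission
  imports Defs
begin

text \<open>
  By polar decomposition, the trace norm is the maximum of \<open>Re tr (H Y)\<close> over contractions \<open>H\<close>;
  hence channels contract it. Polar decomposition of the coefficient matrix of a pure state shows
  that larger ancillas do not increase the diamond norm, which is therefore monotone under
  composition with channels on either side and under tensoring with a channel.

  Consequently \<open>\<Sigma>\<close> is monotone under local pre- and post-processing, and so is \<open>C\<close> when that on \<open>B'\<close>
  cancels. The gate \<open>U\<close> arises from \<open>U \<otimes> V\<close> by appending and discarding local systems, and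
  \<open>T(U \<otimes> V)\<close> is \<open>T(U) \<otimes> T(V)\<close> up to relabelling. Conversely, a witness channel for \<open>U\<close> extends to
  one for \<open>U \<otimes> I\<close> with the same defect up to tensoring with a channel.

  For CNOT, phase kickback lets Alice steer Bob's \<open>|+>\<close> into two orthogonal states (four for two
  copies). No fixed guess is closer than \<open>2 - 2/n\<close> to all of \<open>n\<close> orthogonal pure states, and for
  one CNOT the dephasing channel attains this bound. For SWAP, a maximally entangled input gives
  \<open>\<Sigma> \<ge> 3/2\<close>, attained by the completely depolarizing channel; \<open>C = 2\<close> because Bob's output shows
  whether it comes from \<open>A\<close> or from \<open>B'\<close>.
\<close>

section \<open>Hermitian operators\<close>

text \<open>The definition ties the ancilla of the diamond norm to the input system, while most
  comparisons here append, remove or regroup input factors. They all depend on a bound valid for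
  ancillas of every dimension, and this is why polar decomposition is developed for rectangular
  matrices.

  Neither infimum is computed by optimising over witnesses: to compare two gates, an arbitrary
  witness for one is turned into a witness for the other, whose defect is the old one up to
  composition and tensoring with channels.

  The values of \<Sigma> for the two gates follow one pattern. For the upper bound, the witness term
  is p F + (1 - p) G, where F is the true reduced map and G another channel; the defect is then (1 -
  p)(F - G), of norm at most 2(1 - p). For the lower bound, the test operator is the reflection 2Q -
  1 in a pure output state Q; a guess with overlap q is at trace distance at least 2 - 2q. The
  bounds meet at p = q, which is 1/2 for one CNOT and 1/4 for SWAP.\<close>

lemma cinner_add_left: "cinner (u + v) w = cinner u w + cinner v w"
  and cinner_add_right: "cinner w (u + v) = cinner w u + cinner w v"
  and cinner_diff_right: "cinner w (u - v) = cinner w u - cinner w v"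
  by (simp_all add: cinner_def sum.distrib sum_subtractf algebra_simps)

lemma cinner_scale_left: "cinner (c *s v) w = cnj c * cinner v w"
  and cinner_scale_right: "cinner v (c *s w) = c * cinner v w"
  by (simp_all add: cinner_def sum_distrib_left algebra_simps)

lemma cinner_zero [simp]: "cinner 0 w = 0" "cinner w 0 = 0"
  by (simp_all add: cinner_def)

lemma cinner_sum_right: "cinner w (sum f B) = (\<Sum>b\<in>B. cinner w (f b))"
  by (induction B rule: infinite_finite_induct) (simp_all add: cinner_add_right)

lemma cinner_sum_left: "cinner (sum f B) w = (\<Sum>b\<in>B. cinner (f b) w)"
  by (induction B rule: infinite_finite_induct) (simp_all add: cinner_add_left)

lemma cnj_cinner: "cnj (cinner v w) = cinner w v"
  by (simp add: cinner_def mult.commute)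

lemma Re_cinner: "Re (cinner v w) = v \<bullet> w"
  by (simp add: cinner_def inner_vec_def inner_complex_def)

lemma cinner_self: "cinner v v = of_real ((norm v)\<^sup>2)"
proof (rule complex_eqI)
  show "Re (cinner v v) = Re (of_real ((norm v)\<^sup>2))"
    by (simp add: Re_cinner power2_norm_eq_inner)
  have "cnj (cinner v v) = cinner v v" by (rule cnj_cinner)
  then show "Im (cinner v v) = Im (of_real ((norm v)\<^sup>2))"
    by (metis Im_complex_of_real complex_In_mult_cnj_zero Reals_cnj_iff complex_is_Real_iff)
qed

lemma cinner_matrix_right: "cinner v (A *v w) = cinner (dagger A *v v) w"
proof -
  have "cinner v (A *v w) = (\<Sum>i\<in>UNIV. \<Sum>j\<in>UNIV. cnj (v $ i) * (A $ i $ j * w $ j))"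
    by (simp add: cinner_def matrix_vector_mult_def sum_distrib_left)
  also have "\<dots> = (\<Sum>j\<in>UNIV. \<Sum>i\<in>UNIV. cnj (v $ i) * (A $ i $ j * w $ j))"
    by (rule sum.swap)
  also have "\<dots> = cinner (dagger A *v v) w"
    by (simp add: cinner_def matrix_vector_mult_def dagger_def sum_distrib_right sum_distrib_left
        mult_ac)
  finally show ?thesis .
qed

lemma dagger_dagger [simp]: "dagger (dagger A) = A"
  by (simp add: dagger_def vec_eq_iff)

lemma cinner_matrix_left: "cinner (A *v v) w = cinner v (dagger A *v w)"
  by (simp add: cinner_matrix_right)

lemma dagger_mult: "dagger (A ** B) = dagger B ** dagger A"
  by (simp add: dagger_def vec_eq_iff matrix_matrix_mult_def mult.commute)

lemma norm_cscale: "norm (c *s v) = norm c * norm (v :: complex^'n::finite)"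
  by (simp add: norm_vec_def L2_set_def norm_mult power_mult_distrib
      real_sqrt_mult flip: sum_distrib_left)

lemma matrix_vector_axis: "(A *v axis j 1) $ i = (A $ i $ j :: complex)"
  by (simp add: matrix_vector_mult_def axis_def mult_delta_right)

lemma cnj_delta: "cnj (if P then 1 else 0) = (if P then 1 else 0)"
  by simp

lemma cinner_axis: "cinner (axis i 1) v = v $ i" "cinner v (axis i 1) = cnj (v $ i)"
  by (simp_all add: cinner_def axis_def mult_delta_right mult_delta_left cnj_delta)

lemma cinner_Cauchy_Schwarz: "norm (cinner v w) \<le> norm v * norm w"
proof (cases "cinner v w = 0")
  case False
  \<comment> \<open>Rotating v by this phase makes the inner product real and nonnegative, so the
    real Cauchy-Schwarz inequality applies.\<close>
  define z where "z = cinner v w / of_real (norm (cinner v w))"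
  have z: "norm z = 1" using False by (simp add: z_def norm_divide)
  have "cinner (z *s v) w = of_real (norm (cinner v w))"
    using False
    by (simp add: cinner_scale_left z_def complex_norm_square[symmetric] power2_eq_square
        mult.commute[of "cnj _"])
  then have "norm (cinner v w) = (z *s v) \<bullet> w"
    by (metis Re_cinner Re_complex_of_real)
  also have "\<dots> \<le> norm (z *s v) * norm w" by (rule norm_cauchy_schwarz)
  finally show ?thesis using z by (simp add: norm_cscale)
qed simp

lemma matrix_vector_scale: "A *v (c *s v) = c *s (A *v (v :: complex^'n::finite))"
  by (simp add: vec_eq_iff matrix_vector_mult_def sum_distrib_left algebra_simps)

lemma matrix_vector_sum: "A *v (sum f B) = (\<Sum>b\<in>B. A *v (f b :: complex^'n::finite))"
  by (induction B rule: infinite_finite_induct) (simp_all add: matrix_vector_right_distrib)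

lemma scaleR_cscale: "r *\<^sub>R v = complex_of_real r *s v"
  unfolding vec_eq_iff vector_scaleR_component vector_smult_component by (simp add: scaleR_conv_of_real)

lemma matrix_vector_scaleR: "A *v (r *\<^sub>R v) = r *\<^sub>R (A *v (v :: complex^'n::finite))"
  by (simp add: scaleR_cscale matrix_vector_scale)

section \<open>Eigenbases of Hermitian operators\<close>

definition orthonormal :: "(complex^'n::finite) set \<Rightarrow> bool" where
  "orthonormal B \<longleftrightarrow> finite B \<and> (\<forall>b\<in>B. \<forall>c\<in>B. cinner b c = (if b = c then 1 else 0))"

text \<open>The Rayleigh quotient attains its maximum on the compact unit sphere of S, and its first
  variation at a maximiser v vanishes. Since S is a subspace over the reals, only real multiples of
  a direction are used; the direction is the residual \<open>r *\<^sub>R v - A *v v\<close>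
  itself.\<close>

lemma hermitian_maximal_eigenvector:
  fixes A :: "'n::finite op"
  assumes herm: "dagger A = A" and S: "subspace S" and inv: "\<And>v. v \<in> S \<Longrightarrow> A *v v \<in> S"
    and ne: "S \<noteq> {0}"
  obtains v r where "v \<in> S" "norm v = 1" "A *v v = complex_of_real r *s v"
proof -
  obtain u where u: "u \<in> S" "u \<noteq> 0" using ne S subspace_0 by blast
  define K where "K = S \<inter> sphere 0 1"
  have "compact K" unfolding K_def
    by (intro closed_Int_compact closed_subspace S compact_sphere)
  moreover have "(1 / norm u) *\<^sub>R u \<in> K"
    using u S by (simp add: K_def subspace_scale)
  moreover have "continuous_on K (\<lambda>v. v \<bullet> (A *v v))"
    by (intro continuous_intros matrix_vector_mult_linear_continuous_on)
  ultimately obtain v where v: "v \<in> K" and max: "\<And>w. w \<in> K \<Longrightarrow> w \<bullet> (A *v w) \<le> v \<bullet> (A *v v)"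
    using continuous_attains_sup[of K] by blast
  define r where "r = v \<bullet> (A *v v)"
  have vS: "v \<in> S" and nv: "norm v = 1" using v by (auto simp: K_def)
  \<comment> \<open>As r is the maximal Rayleigh quotient, q is a quadratic form that is nonnegative
    on S and vanishes at v.\<close>
  define q where "q = (\<lambda>w. r * (w \<bullet> w) - w \<bullet> (A *v w))"
  have q_nonneg: "q w \<ge> 0" if "w \<in> S" for w
  proof (cases "w = 0")
    case False
    have "(1 / norm w) *\<^sub>R w \<in> K" using that False S by (simp add: K_def subspace_scale)
    from max[OF this] have "(w \<bullet> (A *v w)) / (norm w)\<^sup>2 \<le> r"
      by (simp add: r_def matrix_vector_scaleR power2_eq_square)
    then show ?thesis using False
      by (simp add: q_def field_simps power2_norm_eq_inner)
  qed (simp add: q_def)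
  have sym: "x \<bullet> (A *v y) = y \<bullet> (A *v x)" for x y
  proof -
    have "cinner x (A *v y) = cnj (cinner y (A *v x))"
      by (simp add: cnj_cinner cinner_matrix_right herm)
    then show ?thesis by (metis Re_cinner cnj.simps(1))
  qed
  define w where "w = r *\<^sub>R v - A *v v"
  have wS: "w \<in> S" unfolding w_def using vS S inv by (intro subspace_diff subspace_scale) auto
  have qv: "q v = 0" using nv by (simp add: q_def r_def power2_norm_eq_inner[symmetric])
  have expand: "q (v + t *\<^sub>R w) = 2 * t * (w \<bullet> w) + t\<^sup>2 * q w" for t
  proof -
    have "(v + t *\<^sub>R w) \<bullet> (v + t *\<^sub>R w) = v \<bullet> v + 2 * t * (v \<bullet> w) + t\<^sup>2 * (w \<bullet> w)"
      by (simp add: inner_add_left inner_add_right inner_commute[of w v] power2_eq_square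
          algebra_simps)
    moreover have "(v + t *\<^sub>R w) \<bullet> (A *v (v + t *\<^sub>R w)) =
        v \<bullet> (A *v v) + 2 * t * (w \<bullet> (A *v v)) + t\<^sup>2 * (w \<bullet> (A *v w))"
      by (simp add: matrix_vector_right_distrib matrix_vector_scaleR inner_add_left
          inner_add_right sym[of v w] power2_eq_square algebra_simps)
    ultimately have "q (v + t *\<^sub>R w) =
        q v + 2 * t * (r * (v \<bullet> w) - w \<bullet> (A *v v)) + t\<^sup>2 * q w"
      unfolding q_def by (simp only:) (simp add: algebra_simps)
    moreover have "r * (v \<bullet> w) - w \<bullet> (A *v v) = w \<bullet> w"
    proof -
      have "w \<bullet> w = (r *\<^sub>R v - A *v v) \<bullet> w" by (simp only: w_def)
      then show ?thesis by (simp add: inner_diff_left inner_commute[of "A *v v" w])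
    qed
    ultimately show ?thesis using qv by simp
  qed
  have "w \<bullet> w = 0"
  proof (rule ccontr)
    assume a: "w \<bullet> w \<noteq> 0"
    define a where "a = w \<bullet> w"
    have a0: "a > 0" using a by (simp add: a_def)
    define c where "c = q w"
    have c0: "c \<ge> 0" using q_nonneg wS by (simp add: c_def)
    \<comment> \<open>For a small negative t the linear term 2 t a outweighs the quadratic one; the
      summand 1 keeps the denominator positive when c = 0.\<close>
    define t where "t = - a / (c + 1)"
    have "q (v + t *\<^sub>R w) \<ge> 0"
      by (intro q_nonneg subspace_add subspace_scale S vS wS)
    then have "0 \<le> 2 * t * a + t\<^sup>2 * c" by (simp add: expand a_def c_def)
    also have "\<dots> \<le> 2 * t * a + t * (t * (c + 1))"
      by (simp add: power2_eq_square algebra_simps)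
    also have "t * (c + 1) = - a" using c0 by (simp add: t_def)
    also have "2 * t * a + t * - a = t * a" by simp
    also have "\<dots> < 0" using a0 c0 by (simp add: t_def mult_neg_pos divide_neg_pos)
    finally show False by simp
  qed
  then have "A *v v = complex_of_real r *s v" by (simp add: w_def scaleR_cscale)
  then show ?thesis using that vS nv by blast
qed

text \<open>Split off one eigenvector and continue in its complex orthogonal complement, which A
  preserves because it is Hermitian. Closure under complex scalars is a separate hypothesis because
  \<open>subspace\<close> and \<open>dim\<close> are real notions; the real dimension still drops
  strictly.\<close>

lemma hermitian_eigenbasis_subspace:
  fixes A :: "'n::finite op"
  assumes herm: "dagger A = A" and "subspace S" and "\<And>c v. v \<in> S \<Longrightarrow> c *s v \<in> S"
    and "\<And>v. v \<in> S \<Longrightarrow> A *v v \<in> S"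
  shows "\<exists>B f. B \<subseteq> S \<and> orthonormal B \<and> (\<forall>b\<in>B. A *v b = complex_of_real (f b) *s b) \<and>
           (\<forall>v\<in>S. v = (\<Sum>b\<in>B. cinner b v *s b))"
  using assms(2-4)
proof (induction "dim S" arbitrary: S rule: less_induct)
  case less
  note S = less.prems
  show ?case
  proof (cases "S = {0}")
    case True
    then show ?thesis by (intro exI[of _ "{}"]) (simp add: orthonormal_def)
  next
    case False
    obtain v r where v: "v \<in> S" "norm v = 1" "A *v v = complex_of_real r *s v"
      using hermitian_maximal_eigenvector[OF herm S(1,3) False] by blast
    have vv: "cinner v v = 1" using v by (simp add: cinner_self)
    define S' where "S' = {w \<in> S. cinner v w = 0}"
    have S'S: "S' \<subseteq> S" by (auto simp: S'_def)
    have sub: "subspace S'"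
      using S(1) by (auto simp: subspace_def S'_def cinner_add_right scaleR_cscale
          cinner_scale_right)
    have "v \<notin> S'" using vv by (simp add: S'_def)
    then have "span S' \<subset> span S"
      using S'S v(1) sub S(1) by (metis psubsetI span_eq_iff)
    then have "dim S' < dim S" by (rule dim_psubset)
    moreover have "c *s w \<in> S'" if "w \<in> S'" for c w
      using that S(2) by (simp add: S'_def cinner_scale_right)
    moreover have "A *v w \<in> S'" if "w \<in> S'" for w
      using that S(3) by (simp add: S'_def cinner_matrix_right herm v(3) cinner_scale_left)
    ultimately have "\<exists>B f. B \<subseteq> S' \<and> orthonormal B \<and>
        (\<forall>b\<in>B. A *v b = complex_of_real (f b) *s b) \<and> (\<forall>w\<in>S'. w = (\<Sum>b\<in>B. cinner b w *s b))"
      by (rule less.hyps[OF _ sub])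
    then obtain B f where B: "B \<subseteq> S'" "orthonormal B"
      "\<forall>b\<in>B. A *v b = complex_of_real (f b) *s b" "\<forall>w\<in>S'. w = (\<Sum>b\<in>B. cinner b w *s b)"
      by blast
    have vB: "v \<notin> B" using B(1) \<open>v \<notin> S'\<close> by blast
    have orth: "cinner v b = 0" "cinner b v = 0" if "b \<in> B" for b
    proof -
      show "cinner v b = 0" using that B(1) by (auto simp: S'_def)
      then show "cinner b v = 0" by (metis cnj_cinner complex_cnj_zero)
    qed
    have fin: "finite B" using B(2) by (simp add: orthonormal_def)
    have "w = (\<Sum>b\<in>insert v B. cinner b w *s b)" if w: "w \<in> S" for w
    proof -
      have "w - cinner v w *s v \<in> S'"
        using w S v(1) vv
        by (auto simp: S'_def cinner_diff_right cinner_scale_right intro!: subspace_diff)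
      then have "w - cinner v w *s v = (\<Sum>b\<in>B. cinner b (w - cinner v w *s v) *s b)"
        using B(4) by blast
      also have "\<dots> = (\<Sum>b\<in>B. cinner b w *s b)"
        using orth by (intro sum.cong) (simp_all add: cinner_diff_right cinner_scale_right)
      finally show ?thesis using vB fin by (simp add: algebra_simps)
    qed
    moreover have "orthonormal (insert v B)"
      using B(2) orth vv vB by (auto simp: orthonormal_def)
    moreover have "\<forall>b\<in>insert v B. A *v b = complex_of_real ((f(v := r)) b) *s b"
      using B(3) v(3) vB by auto
    moreover have "insert v B \<subseteq> S" using B(1) S'S v(1) by auto
    ultimately show ?thesis by blast
  qed
qed

definition onb :: "(complex^'n::finite) set \<Rightarrow> bool" where
  "onb B \<longleftrightarrow> orthonormal B \<and> (\<forall>v. v = (\<Sum>b\<in>B. cinner b v *s b))"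

lemma onb_finite: "onb B \<Longrightarrow> finite B"
  by (simp add: onb_def orthonormal_def)

lemma onb_norm:
  assumes "onb B" "b \<in> B"
  shows "norm b = 1"
proof -
  have "(norm b)\<^sup>2 = 1"
    using assms cinner_self[of b] by (simp add: onb_def orthonormal_def flip: of_real_power)
  then show ?thesis by (simp add: power2_eq_1_iff) (smt (verit) norm_ge_zero)
qed

lemma hermitian_eigenbasis:
  fixes A :: "'n::finite op"
  assumes "dagger A = A"
  obtains B f where "onb B" "\<And>b. b \<in> B \<Longrightarrow> A *v b = complex_of_real (f b) *s b"
  using hermitian_eigenbasis_subspace[OF assms, of UNIV] by (auto simp: onb_def)

lemma matrix_eq_on_onb:
  assumes "onb B" "\<And>b. b \<in> B \<Longrightarrow> A *v b = A' *v (b :: complex^'n::finite)"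
  shows "A = A'"
proof -
  have "A *v v = A' *v v" for v
  proof -
    have v: "v = (\<Sum>b\<in>B. cinner b v *s b)" using assms by (simp add: onb_def)
    show ?thesis
      using assms(2) by (subst (1 2) v) (simp add: matrix_vector_sum matrix_vector_scale)
  qed
  then show ?thesis by (simp add: matrix_eq)
qed

definition outer :: "complex^'y::finite \<Rightarrow> complex^'x::finite \<Rightarrow> complex^'x^'y" where
  "outer v w = (\<chi> i j. v $ i * cnj (w $ j))"

lemma outer_mult_vec: "outer v w *v x = cinner w x *s v"
  by (simp add: outer_def vec_eq_iff matrix_vector_mult_def cinner_def sum_distrib_right
      sum_distrib_left algebra_simps)

lemma matrix_sum_vec: "sum A S *v x = (\<Sum>s\<in>S. A s *v (x :: complex^'n::finite))"
  by (induction S rule: infinite_finite_induct)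
    (simp_all add: matrix_vector_mult_add_rdistrib)

lemma scaleR_matrix_vec: "(r *\<^sub>R A) *v x = complex_of_real r *s (A *v (x :: complex^'n::finite))"
  unfolding vec_eq_iff matrix_vector_mult_def vector_smult_component vec_lambda_beta
    vector_scaleR_component
  by (simp add: sum_distrib_left scaleR_conv_of_real mult_ac)

text \<open>\<open>v = id\<close> gives the functional calculus of a Hermitian operator with eigenbasis \<open>B\<close>; other \<open>v\<close>
  give the partial isometry of a polar decomposition.\<close>

definition spectral ::
  "(complex^'n) set \<Rightarrow> (complex^'n \<Rightarrow> real) \<Rightarrow> (complex^'n \<Rightarrow> complex^'m) \<Rightarrow> complex^'n::finite^'m::finite"
  where "spectral B f v = (\<Sum>b\<in>B. f b *\<^sub>R outer (v b) b)"

lemma spectral_mult_vec: "spectral B f v *v x = (\<Sum>b\<in>B. (of_real (f b) * cinner b x) *s v b)"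
  by (simp add: spectral_def matrix_sum_vec scaleR_matrix_vec outer_mult_vec)

lemma spectral_on_basis:
  assumes "onb B" "b \<in> B"
  shows "spectral B f v *v b = of_real (f b) *s v b"
proof -
  have "spectral B f v *v b = (\<Sum>c\<in>B. if c = b then of_real (f b) *s v b else 0)"
    unfolding spectral_mult_vec
    using assms by (intro sum.cong) (auto simp: onb_def orthonormal_def)
  then show ?thesis using assms by (simp add: onb_finite)
qed

lemma Parseval:
  assumes "onb B"
  shows "(norm v)\<^sup>2 = (\<Sum>b\<in>B. (norm (cinner b v))\<^sup>2)"
proof -
  have v: "v = (\<Sum>b\<in>B. cinner b v *s b)" using assms by (simp add: onb_def)
  have "cinner v v = cinner v (\<Sum>b\<in>B. cinner b v *s b)" using v by simp
  also have "\<dots> = (\<Sum>b\<in>B. cinner b v * cnj (cinner b v))"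
    by (simp add: cinner_sum_right cinner_scale_right cnj_cinner)
  also have "\<dots> = of_real (\<Sum>b\<in>B. (norm (cinner b v))\<^sup>2)"
    by (simp add: complex_norm_square[symmetric])
  finally show ?thesis unfolding cinner_self of_real_eq_iff .
qed

lemma eq_spectral:
  assumes "onb B" "\<And>b. b \<in> B \<Longrightarrow> A *v b = of_real (f b) *s b"
  shows "A = spectral B f id"
  using assms by (intro matrix_eq_on_onb[of B]) (simp_all add: spectral_on_basis)

section \<open>Positive operators and polar decomposition\<close>

text \<open>A complex quadratic form with real values determines the adjoint: polarisation with the
  coefficients 1 and i yields the imaginary and real part of each entry equation.\<close>

lemma psd_hermitian:
  fixes A :: "'n::finite op"
  assumes "psd A"
  shows "dagger A = A"
proof -
  have im: "Im (cinner v (A *v v)) = 0" for v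
    using assms by (simp add: psd_def complex_nonneg_Reals_iff)
  have polar: "cinner (x + c *s y) (A *v (x + c *s y)) =
      cinner x (A *v x) + c * cinner x (A *v y) + cnj c * cinner y (A *v x)
      + cnj c * c * cinner y (A *v y)" for x y c
    by (simp add: matrix_vector_right_distrib matrix_vector_scale cinner_add_left cinner_add_right
        cinner_scale_left cinner_scale_right algebra_simps)
  have "cnj (A $ j $ i) = A $ i $ j" for i j
  proof -
    let ?x = "axis i 1 :: complex^'n" and ?y = "axis j 1 :: complex^'n"
    have "Im (A $ i $ j + A $ j $ i) = 0"
      using im[of "?x + 1 *s ?y"] im[of ?x] im[of ?y] by (simp only: polar) (simp add: cinner_axis matrix_vector_axis)
    moreover have "Im (\<i> * A $ i $ j - \<i> * A $ j $ i) = 0"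
      using im[of "?x + \<i> *s ?y"] im[of ?x] im[of ?y] by (simp only: polar) (simp add: cinner_axis matrix_vector_axis)
    ultimately show ?thesis by (simp add: complex_eq_iff)
  qed
  then show ?thesis by (simp add: dagger_def vec_eq_iff)
qed

lemma psd_eigenbasis:
  fixes A :: "'n::finite op"
  assumes "psd A"
  obtains B f where "onb B" "\<And>b. b \<in> B \<Longrightarrow> A *v b = complex_of_real (f b) *s b"
    "\<And>b. b \<in> B \<Longrightarrow> f b \<ge> 0"
proof -
  obtain B f where B: "onb B" "\<And>b. b \<in> B \<Longrightarrow> A *v b = complex_of_real (f b) *s b"
    using hermitian_eigenbasis[OF psd_hermitian[OF assms]] by blast
  have "f b \<ge> 0" if b: "b \<in> B" for b
  proof -
    have "cinner b (A *v b) = of_real (f b)"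
      using B b by (simp add: cinner_scale_right onb_def orthonormal_def)
    then show ?thesis using assms by (metis psd_def Re_complex_of_real complex_nonneg_Reals_iff)
  qed
  then show ?thesis using that B by blast
qed

lemma psd_spectral:
  assumes "\<And>b. b \<in> B \<Longrightarrow> f b \<ge> 0"
  shows "psd (spectral B f id)"
proof -
  have "cinner v (spectral B f id *v v) = of_real (\<Sum>b\<in>B. f b * (norm (cinner b v))\<^sup>2)" for v
  proof -
    have "cinner v (spectral B f id *v v) = (\<Sum>b\<in>B. of_real (f b) * (cinner b v * cnj (cinner b v)))"
      by (simp add: spectral_mult_vec cinner_sum_right cinner_scale_right cnj_cinner mult.assoc)
    then show ?thesis by (simp add: complex_norm_square[symmetric])
  qed
  then show ?thesis using assms
    by (auto simp: psd_def complex_nonneg_Reals_iff intro!: sum_nonneg)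
qed

text \<open>From (R + s)(R - s) v = 0, the vector w = (R - s) v satisfies R w = - s w. If s > 0,
  positivity of R forces w = 0; if s = 0, the norm of R v is read off from R R v = 0. This is what
  makes the square root unique.\<close>

lemma psd_sqrt_eigenvector:
  assumes R: "psd R" and s: "s \<ge> 0" and v: "(R ** R) *v v = of_real (s\<^sup>2) *s v"
  shows "R *v v = of_real s *s v"
proof -
  have herm: "dagger R = R" using R by (rule psd_hermitian)
  define w where "w = R *v v - of_real s *s v"
  have RRv: "R *v (R *v v) = of_real (s\<^sup>2) *s v" using v by (simp add: matrix_vector_mul_assoc)
  have Rw: "R *v w = (- of_real s) *s w"
    unfolding w_def matrix_vector_mult_diff_distrib matrix_vector_scale RRv
    by (simp add: vec_eq_iff power2_eq_square algebra_simps)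
  have "w = 0"
  proof (cases "s = 0")
    case True
    then have "cinner (R *v v) (R *v v) = 0"
      using RRv by (simp add: cinner_matrix_left herm)
    then show ?thesis using True by (simp add: w_def cinner_self)
  next
    case False
    have "cinner w (R *v w) = - of_real (s * (norm w)\<^sup>2)"
      unfolding Rw cinner_scale_right cinner_self by simp
    then have "- (s * (norm w)\<^sup>2) \<ge> 0"
      using R by (metis psd_def Re_complex_of_real complex_nonneg_Reals_iff of_real_minus)
    then show ?thesis using s False by (simp add: mult_le_0_iff)
  qed
  then show ?thesis by (simp add: w_def)
qed

lemma psd_sqrt_unique:
  fixes R S :: "'n::finite op"
  assumes "psd R" "psd S" "R ** R = S ** S"
  shows "R = S"
proof -
  obtain B f where B: "onb B" "\<And>b. b \<in> B \<Longrightarrow> S *v b = complex_of_real (f b) *s b"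
    "\<And>b. b \<in> B \<Longrightarrow> f b \<ge> 0"
    using psd_eigenbasis[OF assms(2)] by blast
  have "R *v b = S *v b" if b: "b \<in> B" for b
  proof -
    have "(R ** R) *v b = of_real ((f b)\<^sup>2) *s b"
      using B(2)[OF b]
      by (simp add: assms(3) matrix_vector_mul_assoc[symmetric] matrix_vector_scale
          power2_eq_square)
    then show ?thesis using psd_sqrt_eigenvector[OF assms(1)] B b by simp
  qed
  then show ?thesis using matrix_eq_on_onb B(1) by blast
qed

lemma psd_sqrt:
  fixes A :: "'n::finite op"
  assumes "psd A"
  shows "psd (psd_sqrt A)" "psd_sqrt A ** psd_sqrt A = A"
proof -
  obtain B f where B: "onb B" "\<And>b. b \<in> B \<Longrightarrow> A *v b = complex_of_real (f b) *s b"
    "\<And>b. b \<in> B \<Longrightarrow> f b \<ge> 0"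
    using psd_eigenbasis[OF assms] by blast
  let ?R = "spectral B (\<lambda>b. sqrt (f b)) id"
  have "psd ?R" using B(3) by (intro psd_spectral) simp
  moreover have "?R ** ?R = A"
  proof (rule matrix_eq_on_onb[OF B(1)])
    fix b assume b: "b \<in> B"
    have "complex_of_real (sqrt (f b)) * of_real (sqrt (f b)) = of_real (f b)"
      using B(3)[OF b] by (metis of_real_mult real_sqrt_mult_self abs_of_nonneg)
    then show "(?R ** ?R) *v b = A *v b"
      using B(1) b by (simp add: matrix_vector_mul_assoc[symmetric] spectral_on_basis
          matrix_vector_scale B(2))
  qed
  ultimately have ex: "\<exists>!R. psd R \<and> R ** R = A"
    by (intro ex1I[of _ ?R]) (auto intro: psd_sqrt_unique)
  show "psd (psd_sqrt A)" "psd_sqrt A ** psd_sqrt A = A"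
    unfolding psd_sqrt_def using theI'[OF ex] by auto
qed

lemma psd_dagger_mult: "psd (dagger M ** M)"
  by (simp add: psd_def matrix_vector_mul_assoc[symmetric] cinner_matrix_right cinner_self
      complex_nonneg_Reals_iff)

text \<open>Contractions are the unit ball dual to the trace norm. They exist between spaces of
  different dimension and are stable under products, adjoints and the duals of channels.\<close>

definition contraction :: "complex^'x::finite^'y::finite \<Rightarrow> bool" where
  "contraction H \<longleftrightarrow> (\<forall>v. norm (H *v v) \<le> norm v)"

lemma contraction_dagger: "contraction H \<Longrightarrow> contraction (dagger H)"
  unfolding contraction_def
proof
  fix v assume H: "\<forall>v. norm (H *v v) \<le> norm v"
  let ?w = "dagger H *v v"
  have "(norm ?w)\<^sup>2 = norm (cinner v (H *v ?w))"
    by (simp add: cinner_matrix_right cinner_self norm_power)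
  also have "\<dots> \<le> norm v * norm (H *v ?w)" by (rule cinner_Cauchy_Schwarz)
  also have "\<dots> \<le> norm v * norm ?w" using H by (simp add: mult_left_mono)
  finally show "norm ?w \<le> norm v"
    by (cases "norm ?w = 0") (simp_all add: power2_eq_square)
qed

lemma contraction_mult: "contraction H \<Longrightarrow> contraction K \<Longrightarrow> contraction (H ** K)"
  unfolding contraction_def by (metis matrix_vector_mul_assoc order_trans)

lemma contraction_mat_1 [simp]: "contraction (mat 1)"
  by (simp add: contraction_def)

lemma contraction_isometry: "dagger H ** H = mat 1 \<Longrightarrow> contraction H"
proof -
  assume H: "dagger H ** H = mat 1"
  have "cinner (H *v v) (H *v v) = cinner v v" for v
    by (simp add: cinner_matrix_left matrix_vector_mul_assoc H)
  then have "(norm (H *v v))\<^sup>2 = (norm v)\<^sup>2" for v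
    by (metis cinner_self of_real_eq_iff)
  then show ?thesis by (simp add: contraction_def)
qed

text \<open>On an eigenbasis of P the vectors M b are orthogonal of length f b, so W sends b to the
  normalised M b. It annihilates the kernel of P, hence is a contraction but in general no isometry.
  M may be rectangular, like the coefficient matrix of a state of two different systems.\<close>

lemma polar_decomposition:
  fixes M :: "complex^'x::finite^'y::finite"
  defines "P \<equiv> psd_sqrt (dagger M ** M)"
  obtains W where "contraction W" "W ** P = M" "dagger W ** M = P"
proof -
  have P: "psd P" "P ** P = dagger M ** M"
    unfolding P_def using psd_sqrt[OF psd_dagger_mult] by auto
  obtain B f where B: "onb B" "\<And>b. b \<in> B \<Longrightarrow> P *v b = complex_of_real (f b) *s b"
    "\<And>b. b \<in> B \<Longrightarrow> f b \<ge> 0"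
    using psd_eigenbasis[OF P(1)] by blast
  have MM: "cinner (M *v b) (M *v c) = (if b = c then of_real ((f b)\<^sup>2) else 0)"
    if "b \<in> B" "c \<in> B" for b c
  proof -
    have "cinner (M *v b) (M *v c) = cinner b (P *v (P *v c))"
      by (simp add: cinner_matrix_left matrix_vector_mul_assoc P(2))
    also have "\<dots> = of_real ((f c)\<^sup>2) * cinner b c"
      using that B(2) by (simp add: matrix_vector_scale cinner_scale_right power2_eq_square)
    finally show ?thesis using that B(1) by (auto simp: onb_def orthonormal_def)
  qed
  define W where "W = spectral B (\<lambda>b. 1 / f b) (\<lambda>b. M *v b)"
  text \<open>Where \<open>f b = 0\<close> the coefficient \<open>1 / f b\<close> is \<open>0\<close>, so \<open>W\<close> vanishes on the kernel of \<open>M\<close>.\<close>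
  have Wb: "W *v b = of_real (1 / f b) *s (M *v b)" if "b \<in> B" for b
    by (simp add: W_def spectral_on_basis[OF B(1) that])
  have kernel: "M *v b = 0" if "b \<in> B" "f b = 0" for b
    using MM[OF that(1,1)] that(2) by (simp add: cinner_self)
  have "W ** P = M"
  proof (rule matrix_eq_on_onb[OF B(1)])
    fix b assume b: "b \<in> B"
    show "(W ** P) *v b = M *v b"
      using b kernel
      by (cases "f b = 0")
        (simp_all add: matrix_vector_mul_assoc[symmetric] B(2) matrix_vector_scale Wb)
  qed
  moreover have "contraction W"
    unfolding contraction_def
  proof
    fix v
    have Wv: "W *v v = (\<Sum>b\<in>B. (of_real (1 / f b) * cinner b v) *s (M *v b))"
      by (simp add: W_def spectral_mult_vec)
    have fin: "finite B" using B(1) by (rule onb_finite)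
    have "cinner (W *v v) (W *v v) = (\<Sum>b\<in>B. \<Sum>c\<in>B.
        cnj (of_real (1 / f c) * cinner c v) * (of_real (1 / f b) * cinner b v) *
        cinner (M *v c) (M *v b))"
      unfolding Wv
      by (simp add: cinner_sum_left cinner_sum_right cinner_scale_left cinner_scale_right
          sum_distrib_left mult_ac)
    also have "\<dots> = (\<Sum>b\<in>B. \<Sum>c\<in>B. if c = b then
        (cnj (of_real (1 / f b) * cinner b v) * (of_real (1 / f b) * cinner b v) *
        of_real ((f b)\<^sup>2)) else 0)"
      using MM by (intro sum.cong refl) auto
    also have "\<dots> = (\<Sum>b\<in>B. of_real ((f b)\<^sup>2 / (f b)\<^sup>2) * (cinner b v * cnj (cinner b v)))"
      using fin by (intro sum.cong refl) (simp add: power2_eq_square)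
    also have "\<dots> = of_real (\<Sum>b\<in>B. (f b)\<^sup>2 / (f b)\<^sup>2 * (norm (cinner b v))\<^sup>2)"
      by (simp add: complex_norm_square[symmetric])
    finally have "(norm (W *v v))\<^sup>2 = (\<Sum>b\<in>B. (f b)\<^sup>2 / (f b)\<^sup>2 * (norm (cinner b v))\<^sup>2)"
      unfolding cinner_self of_real_eq_iff .
    \<comment> \<open>The quotient is 1 off the kernel and 0 on it.\<close>
    also have "\<dots> \<le> (\<Sum>b\<in>B. (norm (cinner b v))\<^sup>2)"
      by (intro sum_mono) auto
    also have "\<dots> = (norm v)\<^sup>2" using Parseval[OF B(1)] by simp
    finally show "norm (W *v v) \<le> norm v" by simp
  qed
  moreover have "dagger W ** M = P"
  proof (rule matrix_eq_on_onb[OF B(1)])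
    fix b assume b: "b \<in> B"
    have "cinner c ((dagger W ** M) *v b) = cinner c (P *v b)" if c: "c \<in> B" for c
    proof -
      have "cinner c ((dagger W ** M) *v b) = cinner (W *v c) (M *v b)"
        by (simp add: matrix_vector_mul_assoc[symmetric] cinner_matrix_left)
      also have "\<dots> = (if c = b then of_real (f b) else 0)"
        using MM[OF c b] by (simp add: Wb[OF c] cinner_scale_left power2_eq_square)
      also have "\<dots> = cinner c (P *v b)"
        using B(1) b c by (simp add: B(2) cinner_scale_right onb_def orthonormal_def)
      finally show ?thesis .
    qed
    then show "(dagger W ** M) *v b = P *v b"
      using B(1) unfolding onb_def by (metis (no_types, lifting) sum.cong)
  qed
  ultimately show ?thesis using that by blast
qed

section \<open>The trace norm\<close>

lemma matrix_mult_sum_right: "A ** sum f S = (\<Sum>s\<in>S. A ** (f s :: complex^'n::finite^'m::finite))"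
  by (induction S rule: infinite_finite_induct) (simp_all add: matrix_add_ldistrib)

lemma matrix_mult_sum_left: "sum f S ** A = (\<Sum>s\<in>S. (f s :: complex^'n::finite^'m::finite) ** A)"
  by (induction S rule: infinite_finite_induct) (simp_all add: vec_eq_iff matrix_matrix_mult_def sum.distrib algebra_simps)

lemma matrix_mult_scaleR_right: "A ** (r *\<^sub>R B) = r *\<^sub>R (A ** (B :: complex^'n::finite^'m::finite))"
  by (simp add: vec_eq_iff matrix_matrix_mult_def scaleR_sum_right)

lemma matrix_mult_scaleR_left: "(r *\<^sub>R A) ** B = r *\<^sub>R (A ** (B :: complex^'n::finite^'m::finite))"
  by (simp add: vec_eq_iff matrix_matrix_mult_def scaleR_sum_right)

lemma matrix_mult_diff_right: "A ** (B - C) = A ** B - A ** (C :: complex^'n::finite^'m::finite)"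
  by (simp add: vec_eq_iff matrix_matrix_mult_def sum_subtractf algebra_simps)

lemma matrix_mult_diff_left: "(B - C) ** A = B ** A - (C :: complex^'n::finite^'m::finite) ** A"
  by (simp add: vec_eq_iff matrix_matrix_mult_def sum_subtractf algebra_simps)

lemma trace_sum: "trace (sum f S) = (\<Sum>s\<in>S. trace (f s :: 'n::finite op))"
  by (induction S rule: infinite_finite_induct) (simp_all add: trace_add, simp_all add: trace_def)

lemma trace_scaleR: "trace (r *\<^sub>R A) = of_real r * trace (A :: 'n::finite op)"
  by (simp add: trace_def scaleR_sum_right[symmetric] scaleR_conv_of_real[symmetric])

lemma trace_outer: "trace (A ** outer v w) = cinner w (A *v v)"
proof -
  have "A ** outer v w = outer (A *v v) w"
    by (simp add: outer_def vec_eq_iff matrix_matrix_mult_def matrix_vector_mult_def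
        sum_distrib_right mult.assoc)
  then show ?thesis by (simp add: trace_def outer_def cinner_def mult.commute)
qed

lemma outer_conj: "A ** outer v w ** B = outer (A *v v) (dagger B *v w)"
proof -
  have "(A ** outer v w ** B) *v x = outer (A *v v) (dagger B *v w) *v x" for x
    by (simp add: matrix_vector_mul_assoc[symmetric] outer_mult_vec matrix_vector_scale
        cinner_matrix_right)
  then show ?thesis by (simp add: matrix_eq)
qed

lemma psd_add: "psd A \<Longrightarrow> psd B \<Longrightarrow> psd (A + B)"
  by (simp add: psd_def complex_nonneg_Reals_iff matrix_vector_mult_add_rdistrib
      cinner_add_right)

lemma psd_zero [simp]: "psd 0"
  by (simp add: psd_def)

lemma psd_sum: "(\<And>s. s \<in> S \<Longrightarrow> psd (f s)) \<Longrightarrow> psd (sum f S)"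
  by (induction S rule: infinite_finite_induct) (simp_all add: psd_add)

lemma psd_conj: "psd A \<Longrightarrow> psd (K ** A ** dagger K)"
  by (simp add: psd_def matrix_vector_mul_assoc[symmetric] cinner_matrix_right[of _ K])

lemma psd_outer: "psd (outer v v)"
proof -
  have "cinner x (outer v v *v x) = of_real ((norm (cinner v x))\<^sup>2)" for x
    by (simp only: outer_mult_vec cinner_scale_right complex_norm_square cnj_cinner)
  then show ?thesis by (simp add: psd_def)
qed

lemma psd_decomposition:
  fixes A :: "'n::finite op"
  assumes "psd A"
  obtains B f where "onb B" "\<And>b. b \<in> B \<Longrightarrow> f b \<ge> 0" "A = (\<Sum>b\<in>B. f b *\<^sub>R outer b b)"
    "Re (trace A) = (\<Sum>b\<in>B. f b)"
proof -
  obtain B f where B: "onb B" "\<And>b. b \<in> B \<Longrightarrow> A *v b = complex_of_real (f b) *s b"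
    "\<And>b. b \<in> B \<Longrightarrow> f b \<ge> 0"
    using psd_eigenbasis[OF assms] by blast
  have A: "A = (\<Sum>b\<in>B. f b *\<^sub>R outer b b)"
    using eq_spectral[OF B(1,2)] by (simp add: spectral_def)
  have "trace (outer b b) = 1" if "b \<in> B" for b
    using trace_outer[of "mat 1" b b] that B(1) by (simp add: onb_def orthonormal_def)
  then have "trace A = of_real (\<Sum>b\<in>B. f b)"
    by (simp add: A trace_sum trace_scaleR)
  then have "Re (trace A) = (\<Sum>b\<in>B. f b)" by simp
  then show ?thesis using that[OF B(1) B(3) A] by blast
qed

text \<open>In an eigenbasis of P the trace of K P is the sum of the eigenvalues weighted by
  diagonal entries of K, which have modulus at most 1. This is the Hoelder inequality behind the
  dual formula for the trace norm.\<close>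

lemma psd_trace_bound:
  assumes "psd P" "contraction K"
  shows "norm (trace (K ** P)) \<le> Re (trace P)"
proof -
  obtain B f where B: "onb B" "\<And>b. b \<in> B \<Longrightarrow> f b \<ge> 0" "P = (\<Sum>b\<in>B. f b *\<^sub>R outer b b)"
    "Re (trace P) = (\<Sum>b\<in>B. f b)"
    using psd_decomposition[OF assms(1)] by blast
  have "norm (cinner b (K *v b)) \<le> 1" if "b \<in> B" for b
  proof -
    show ?thesis
      using onb_norm[OF B(1) that] cinner_Cauchy_Schwarz[of b "K *v b"] assms(2)[unfolded contraction_def, rule_format, of b]
      by simp
  qed
  then have "norm (of_real (f b) * cinner b (K *v b)) \<le> f b" if "b \<in> B" for b
    using that B(2)[OF that] by (simp add: norm_mult mult_left_le)
  moreover have "trace (K ** P) = (\<Sum>b\<in>B. of_real (f b) * cinner b (K *v b))"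
    by (simp add: B(3) matrix_mult_sum_right matrix_mult_scaleR_right trace_sum trace_scaleR
        trace_outer)
  ultimately show ?thesis unfolding B(4) by (simp only:) (rule sum_norm_le)
qed

lemma psd_trace_nonneg: "psd P \<Longrightarrow> Re (trace P) \<ge> 0"
  by (rule order_trans[OF norm_ge_zero psd_trace_bound[OF _ contraction_mat_1]])

section \<open>Duality between the trace norm and contractions\<close>

lemma trace_norm_nonneg: "trace_norm Y \<ge> 0"
  unfolding trace_norm_def by (intro psd_trace_nonneg psd_sqrt psd_dagger_mult)

text \<open>The adjoint of the polar factor turns Y into its absolute value. Together with
  \<open>trace_norm_ge\<close> this exhibits the trace norm as a maximum of real-linear functionals,
  so that later estimates need not touch the square root.\<close>

lemma trace_norm_attained:
  obtains H where "contraction H" "trace_norm Y = Re (trace (H ** Y))"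
proof -
  obtain W where "contraction W" "dagger W ** Y = psd_sqrt (dagger Y ** Y)"
    using polar_decomposition[of Y] by blast
  then show ?thesis using that[of "dagger W"] by (simp add: contraction_dagger trace_norm_def)
qed

lemma trace_norm_ge:
  assumes "contraction H"
  shows "Re (trace (H ** Y)) \<le> trace_norm Y"
proof -
  obtain W where W: "contraction W" "W ** psd_sqrt (dagger Y ** Y) = Y"
    using polar_decomposition[of Y] by blast
  have "Re (trace (H ** Y)) \<le> norm (trace ((H ** W) ** psd_sqrt (dagger Y ** Y)))"
    using W(2) by (metis complex_Re_le_cmod matrix_mul_assoc)
  also have "\<dots> \<le> trace_norm Y"
    unfolding trace_norm_def
    by (intro psd_trace_bound psd_sqrt psd_dagger_mult contraction_mult assms W)
  finally show ?thesis .
qed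

lemma trace_norm_leI:
  assumes "\<And>H. contraction H \<Longrightarrow> Re (trace (H ** Y)) \<le> c"
  shows "trace_norm Y \<le> c"
  using trace_norm_attained[of Y] assms by metis

lemma trace_norm_psd: "psd P \<Longrightarrow> trace_norm P = Re (trace P)"
  using trace_norm_ge[of "mat 1" P]
  by (intro antisym trace_norm_leI) (auto intro: order_trans[OF complex_Re_le_cmod psd_trace_bound])

lemma trace_norm_zero [simp]: "trace_norm 0 = 0"
  by (simp add: trace_norm_psd trace_def)

lemma trace_norm_add: "trace_norm (X + Y) \<le> trace_norm X + trace_norm Y"
  by (rule trace_norm_leI) (simp add: matrix_add_ldistrib trace_add add_mono trace_norm_ge)

lemma trace_norm_sum: "trace_norm (sum f S) \<le> (\<Sum>s\<in>S. trace_norm (f s))"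
proof (induction S rule: infinite_finite_induct)
  case (insert x F)
  then show ?case using trace_norm_add[of "f x" "sum f F"] by simp
qed simp_all

lemma trace_norm_scaleR:
  assumes "r \<ge> 0"
  shows "trace_norm (r *\<^sub>R X) \<le> r * trace_norm X"
  using assms by (intro trace_norm_leI)
    (simp add: matrix_mult_scaleR_right trace_scaleR mult_left_mono trace_norm_ge)

lemma trace_norm_diff_psd:
  assumes "psd P" "psd Q"
  shows "trace_norm (P - Q) \<le> Re (trace P) + Re (trace Q)"
proof (rule trace_norm_leI)
  fix H :: "'a op" assume H: "contraction H"
  have "Re (trace (H ** (P - Q))) \<le> norm (trace (H ** P)) + norm (trace (H ** Q))"
    unfolding matrix_mult_diff_right trace_sub
    by (rule order_trans[OF complex_Re_le_cmod norm_triangle_ineq4])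
  then show "Re (trace (H ** (P - Q))) \<le> Re (trace P) + Re (trace Q)"
    using psd_trace_bound[OF assms(1) H] psd_trace_bound[OF assms(2) H] by linarith
qed

lemma trace_norm_conj:
  assumes "contraction K"
  shows "trace_norm (K ** Y ** dagger K) \<le> trace_norm Y"
proof (rule trace_norm_leI)
  fix H :: "'b op" assume H: "contraction H"
  have "trace (H ** (K ** Y ** dagger K)) = trace ((dagger K ** H ** K) ** Y)"
    using trace_mul_sym[of "H ** K ** Y" "dagger K"] by (simp add: matrix_mul_assoc)
  then show "Re (trace (H ** (K ** Y ** dagger K))) \<le> trace_norm Y"
    by (simp add: trace_norm_ge contraction_mult contraction_dagger assms H)
qed

lemma contraction_entry: "contraction H \<Longrightarrow> norm (H $ i $ j) \<le> 1"
proof -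
  assume H: "contraction H"
  have "H $ i $ j = (H *v axis j 1) $ i"
    by (simp add: matrix_vector_axis)
  also have "norm \<dots> \<le> norm (H *v axis j 1)" by (rule Finite_Cartesian_Product.norm_nth_le)
  also have "\<dots> \<le> norm (axis j 1 :: complex^'a)" using H unfolding contraction_def by blast
  finally show ?thesis by simp
qed

text \<open>A crude bound, sufficient to show that the supremum in the diamond norm is
  finite.\<close>

lemma trace_norm_le_entries: "trace_norm Y \<le> (\<Sum>i\<in>UNIV. \<Sum>j\<in>UNIV. norm (Y $ i $ j))"
proof (rule trace_norm_leI)
  fix H :: "'a op" assume H: "contraction H"
  have "Re (trace (H ** Y)) \<le> norm (\<Sum>j\<in>UNIV. \<Sum>i\<in>UNIV. H $ j $ i * Y $ i $ j)"
    unfolding trace_def matrix_matrix_mult_def vec_lambda_beta by (rule complex_Re_le_cmod)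
  also have "\<dots> \<le> (\<Sum>j\<in>UNIV. \<Sum>i\<in>UNIV. norm (H $ j $ i * Y $ i $ j))"
    by (intro sum_norm_le) auto
  also have "\<dots> \<le> (\<Sum>j\<in>UNIV. \<Sum>i\<in>UNIV. norm (Y $ i $ j))"
    using contraction_entry[OF H]
    by (intro sum_mono) (simp add: norm_mult mult_left_le_one_le)
  also have "\<dots> = (\<Sum>i\<in>UNIV. \<Sum>j\<in>UNIV. norm (Y $ i $ j))" by (rule sum.swap)
  finally show "Re (trace (H ** Y)) \<le> (\<Sum>i\<in>UNIV. \<Sum>j\<in>UNIV. norm (Y $ i $ j))" .
qed

text \<open>Under the trace, the rank-one contraction |j><i| picks out the entry with indices i and
  j.\<close>

lemma psd_entry_bound:
  assumes "psd A"
  shows "norm (A $ i $ j) \<le> Re (trace A)"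
proof -
  let ?K = "outer (axis j 1) (axis i 1) :: 'a op"
  have "contraction ?K"
    unfolding contraction_def
  proof
    fix v :: "complex^'a"
    have "norm (cinner (axis i 1) v) \<le> norm v"
      using cinner_Cauchy_Schwarz[of "axis i 1" v] by simp
    then show "norm (?K *v v) \<le> norm v" by (simp add: outer_mult_vec norm_cscale)
  qed
  moreover have "trace (?K ** A) = A $ i $ j"
    unfolding trace_mul_sym[of ?K] trace_outer by (simp add: cinner_axis matrix_vector_axis)
  ultimately show ?thesis using psd_trace_bound[OF assms, of ?K] by simp
qed

lemma outer_in_density_ops: "norm v = 1 \<Longrightarrow> outer v v \<in> density_ops"
  using trace_outer[of "mat 1" v v] by (simp add: density_ops_def psd_outer cinner_self)

section \<open>Tensor products\<close>

lemma sum_UNIV_prod: "(\<Sum>p\<in>UNIV. f p) = (\<Sum>x\<in>UNIV. \<Sum>y\<in>UNIV. f (x, y))"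
  by (simp add: sum.cartesian_product)

definition kron ::
  "complex^'x::finite^'u::finite \<Rightarrow> complex^'y::finite^'v::finite \<Rightarrow> complex^('x \<times> 'y)^('u \<times> 'v)"
  where "kron A B = (\<chi> p q. A $ fst p $ fst q * B $ snd p $ snd q)"

lemma kron_mult: "kron A B ** kron C D = kron (A ** C) (B ** D)"
  by (simp add: kron_def vec_eq_iff matrix_matrix_mult_def sum_UNIV_prod sum_product mult_ac)

lemma dagger_kron: "dagger (kron A B) = kron (dagger A) (dagger B)"
  by (simp add: kron_def dagger_def vec_eq_iff)

lemma kron_mat_1: "kron (mat 1) (mat 1) = mat 1"
  by (simp add: kron_def mat_def vec_eq_iff prod_eq_iff)

lemma trace_kron: "trace (kron A B) = trace A * trace B"
  by (simp add: trace_def kron_def sum_UNIV_prod sum_product)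

lemma kron_diff_right: "kron A (B - C) = kron A B - kron A C"
  by (simp add: kron_def vec_eq_iff algebra_simps)

lemma kron_sum_right: "kron A (sum f S) = (\<Sum>s\<in>S. kron A (f s))"
  by (simp add: kron_def vec_eq_iff sum_distrib_left)

lemma kron_sum_left: "kron (sum f S) A = (\<Sum>s\<in>S. kron (f s) A)"
  by (simp add: kron_def vec_eq_iff sum_distrib_right)

lemma kron_sum_sum:
  "(\<Sum>p\<in>UNIV. kron (f (fst p)) (g (snd p))) = kron (\<Sum>s\<in>UNIV. f s) (\<Sum>t\<in>UNIV. g t)"
  unfolding sum_UNIV_prod fst_conv snd_conv kron_sum_left kron_sum_right by (rule sum.swap)

lemma kron_scaleR_right: "kron A (r *\<^sub>R B) = r *\<^sub>R kron A B"
  and kron_scaleR_left: "kron (r *\<^sub>R B) A = r *\<^sub>R kron B A"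
  by (simp_all add: kron_def vec_eq_iff)

lemma kron_cscale_right: "kron A (cscale c B) = cscale c (kron A B)"
  and kron_cscale_left: "kron (cscale c A) B = cscale c (kron A B)"
  by (simp_all add: kron_def vec_eq_iff cscale_def)

lemma matrix_unit_pair: "matrix_unit p q =
    kron (matrix_unit (fst p) (fst q)) (matrix_unit (snd p) (snd q))"
  by (auto simp add: kron_def matrix_unit_def vec_eq_iff prod_eq_iff)

lemma matrix_unit_outer: "matrix_unit i j = outer (axis i 1) (axis j 1)"
  by (auto simp: matrix_unit_def outer_def axis_def vec_eq_iff)

lemma trace_matrix_unit: "trace (matrix_unit i j) = (if i = j then 1 else 0)"
proof -
  have "trace (matrix_unit i j) = (\<Sum>k\<in>UNIV. if k = i then (if i = j then 1 else 0) else 0)"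
    unfolding trace_def matrix_unit_def by (intro sum.cong) auto
  then show ?thesis by simp
qed

section \<open>Linear maps on operators\<close>

lemma cscale_of_real: "cscale (of_real r) A = r *\<^sub>R A"
  unfolding cscale_def vec_eq_iff vector_scaleR_component by (simp add: scaleR_conv_of_real)

lemma clinear_map_add: "clinear_map L \<Longrightarrow> L (A + B) = L A + L B"
  and clinear_map_cscale: "clinear_map L \<Longrightarrow> L (cscale c A) = cscale c (L A)"
  by (simp_all add: clinear_map_def)

lemma clinear_map_scaleR: "clinear_map L \<Longrightarrow> L (r *\<^sub>R A) = r *\<^sub>R L A"
  by (metis clinear_map_cscale cscale_of_real)

lemma clinear_map_zero: "clinear_map L \<Longrightarrow> L 0 = 0"
  using clinear_map_scaleR[of L 0 0] by simp

lemma clinear_map_sum: "clinear_map L \<Longrightarrow> L (sum f S) = (\<Sum>s\<in>S. L (f s))"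
  by (induction S rule: infinite_finite_induct) (simp_all add: clinear_map_zero clinear_map_add)

lemma clinear_map_diff: "clinear_map L \<Longrightarrow> L (A - B) = L A - L B"
  using clinear_map_add[of L A "(-1) *\<^sub>R B"] clinear_map_scaleR[of L "-1" B] by simp

lemma operator_matrix_units: "A = (\<Sum>i\<in>UNIV. \<Sum>j\<in>UNIV. cscale (A $ i $ j) (matrix_unit i j))"
proof -
  have "(\<Sum>i\<in>UNIV. \<Sum>j\<in>UNIV. cscale (A $ i $ j) (matrix_unit i j)) $ k $ l = A $ k $ l" for k l
  proof -
    have "(\<Sum>i\<in>UNIV. \<Sum>j\<in>UNIV. cscale (A $ i $ j) (matrix_unit i j)) $ k $ l =
        (\<Sum>i\<in>UNIV. \<Sum>j\<in>UNIV. if j = l then if i = k then A $ k $ l else 0 else 0)"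
      unfolding cscale_def matrix_unit_def sum_component vec_lambda_beta by (intro sum.cong) auto
    then show ?thesis by simp
  qed
  then show ?thesis by (simp add: vec_eq_iff)
qed

lemma clinear_map_expand:
  assumes "clinear_map L"
  shows "L A = (\<Sum>i\<in>UNIV. \<Sum>j\<in>UNIV. cscale (A $ i $ j) (L (matrix_unit i j)))"
  by (subst operator_matrix_units[of A])
    (simp only: clinear_map_sum[OF assms] clinear_map_cscale[OF assms])

lemma clinear_map_eqI:
  assumes "clinear_map L" "clinear_map M" "\<And>i j. L (matrix_unit i j) = M (matrix_unit i j)"
  shows "L = M"
proof
  fix A
  show "L A = M A"
    using clinear_map_expand[OF assms(1), of A] clinear_map_expand[OF assms(2), of A]
    by (simp add: assms(3))
qed

text \<open>Matrix units of a composite system are products of matrix units, so product operators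
  span. Identities between maps on composite systems are checked in this way throughout.\<close>

lemma clinear_map_eqI_kron:
  fixes L M :: "('x::finite \<times> 'y::finite) op \<Rightarrow> 'z::finite op"
  assumes "clinear_map L" "clinear_map M" "\<And>A B. L (kron A B) = M (kron A B)"
  shows "L = M"
  using assms(3) by (intro clinear_map_eqI assms(1,2)) (simp add: matrix_unit_pair)

lemma cscale_add: "cscale c (A + B) = cscale c A + cscale c B"
  and cscale_diff: "cscale c (A - B) = cscale c A - cscale c B"
  and cscale_scaleR: "cscale c (r *\<^sub>R A) = r *\<^sub>R cscale c A"
  by (simp_all add: cscale_def vec_eq_iff algebra_simps)

lemma cscale_sum: "cscale c (sum f S) = (\<Sum>s\<in>S. cscale c (f s))"
  by (simp add: cscale_def vec_eq_iff sum_distrib_left)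

lemma cscale_cscale: "cscale c (cscale d A) = cscale (c * d) A"
  by (simp add: cscale_def vec_eq_iff mult.assoc)

lemma trace_cscale: "trace (cscale c A) = c * trace A"
  by (simp add: trace_def cscale_def sum_distrib_left)

lemma clinear_map_id [simp]: "clinear_map id"
  by (simp add: clinear_map_def)

lemma clinear_map_comp [intro]: "clinear_map L \<Longrightarrow> clinear_map M \<Longrightarrow> clinear_map (L \<circ> M)"
  by (simp add: clinear_map_def)

lemma clinear_map_minus [intro]:
  "clinear_map L \<Longrightarrow> clinear_map M \<Longrightarrow> clinear_map (\<lambda>\<rho>. L \<rho> - M \<rho>)"
  by (simp add: clinear_map_def cscale_diff)

lemma clinear_map_plus [intro]:
  "clinear_map L \<Longrightarrow> clinear_map M \<Longrightarrow> clinear_map (\<lambda>\<rho>. L \<rho> + M \<rho>)"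
  by (simp add: clinear_map_def cscale_add algebra_simps)

lemma clinear_map_scaleR_fun [intro]: "clinear_map L \<Longrightarrow> clinear_map (\<lambda>\<rho>. r *\<^sub>R L \<rho>)"
  by (simp add: clinear_map_def cscale_scaleR scaleR_add_right)

lemma clinear_map_conj_channel [simp, intro]: "clinear_map (conj_channel U)"
  by (simp add: clinear_map_def conj_channel_def cscale_def vec_eq_iff matrix_matrix_mult_def
      sum.distrib sum_distrib_left sum_distrib_right algebra_simps)

lemma clinear_map_trace_channel [simp, intro]: "clinear_map trace_channel"
  by (simp add: clinear_map_def trace_channel_def trace_add trace_cscale vec_eq_iff)
    (simp add: cscale_def)

lemma clinear_map_tensor_map [simp, intro]: "clinear_map (L \<otimes>\<^sub>L M)"
  by (simp add: clinear_map_def tensor_map_def cscale_def vec_eq_iff sum.distrib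
      sum_distrib_left algebra_simps)

text \<open>The definition prescribes the map on matrix units only; linearity of both factors
  extends the product rule to all operators.\<close>

lemma tensor_map_kron:
  assumes "clinear_map L" "clinear_map M"
  shows "(L \<otimes>\<^sub>L M) (kron A B) = kron (L A) (M B)"
proof -
  have "(L \<otimes>\<^sub>L M) (kron A B) $ p $ q = kron (L A) (M B) $ p $ q" for p q
  proof -
    have "kron (L A) (M B) $ p $ q =
        (\<Sum>i\<in>UNIV. \<Sum>j\<in>UNIV. A $ i $ j * L (matrix_unit i j) $ fst p $ fst q) *
        (\<Sum>k\<in>UNIV. \<Sum>l\<in>UNIV. B $ k $ l * M (matrix_unit k l) $ snd p $ snd q)"
      by (subst clinear_map_expand[OF assms(1)], subst clinear_map_expand[OF assms(2)])
        (simp add: kron_def cscale_def)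
    also have "\<dots> = (\<Sum>i\<in>UNIV. \<Sum>j\<in>UNIV. \<Sum>k\<in>UNIV. \<Sum>l\<in>UNIV.
        A $ i $ j * L (matrix_unit i j) $ fst p $ fst q *
        (B $ k $ l * M (matrix_unit k l) $ snd p $ snd q))"
      by (simp only: sum_distrib_right) (simp only: sum_distrib_left)
    also have "\<dots> = (L \<otimes>\<^sub>L M) (kron A B) $ p $ q"
      by (simp add: tensor_map_def kron_def mult_ac)
    finally show ?thesis by simp
  qed
  then show ?thesis by (simp add: vec_eq_iff)
qed

lemma tensor_map_comp:
  assumes "clinear_map L" "clinear_map M" "clinear_map L'" "clinear_map M'"
  shows "(L \<otimes>\<^sub>L M) \<circ> (L' \<otimes>\<^sub>L M') = (L \<circ> L') \<otimes>\<^sub>L (M \<circ> M')"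
  using assms
  by (intro clinear_map_eqI_kron clinear_map_comp clinear_map_tensor_map)
    (simp add: tensor_map_kron clinear_map_comp)

lemma tensor_map_id: "id \<otimes>\<^sub>L id = id"
  by (intro clinear_map_eqI_kron) (simp_all add: tensor_map_kron)

lemma conj_channel_kron: "conj_channel (kron U V) (kron A B) = kron (conj_channel U A) (conj_channel V B)"
  by (simp add: conj_channel_def kron_mult dagger_kron)

lemma tensor_map_conj_channel: "conj_channel U \<otimes>\<^sub>L conj_channel V = conj_channel (kron U V)"
  by (intro clinear_map_eqI_kron) (simp_all add: tensor_map_kron conj_channel_kron)

lemma conj_channel_comp: "conj_channel U \<circ> conj_channel V = conj_channel (U ** V)"
  by (simp add: fun_eq_iff conj_channel_def dagger_mult matrix_mul_assoc)

lemma conj_channel_mat_1 [simp]: "conj_channel (mat 1) = id"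
proof -
  have "dagger (mat 1 :: 'a op) = mat 1"
    by (auto simp: dagger_def mat_def vec_eq_iff)
  then show ?thesis by (simp add: fun_eq_iff conj_channel_def)
qed

section \<open>Basis permutations\<close>

lemma basis_op_comp: "basis_op f ** basis_op g = basis_op (f \<circ> g)"
proof -
  have "(\<Sum>k\<in>UNIV. (if i = f k then 1 else 0) * (if k = g j then 1 else 0)) =
      (if i = f (g j) then 1 else (0::complex))" for i j
  proof -
    have "(\<Sum>k\<in>UNIV. (if i = f k then 1 else 0) * (if k = g j then 1 else 0)) =
      (\<Sum>k\<in>UNIV. if k = g j then (if i = f (g j) then 1 else (0::complex)) else 0)"
      by (intro sum.cong) auto
    then show ?thesis by simp
  qed
  then show ?thesis by (simp add: basis_op_def vec_eq_iff matrix_matrix_mult_def)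
qed

lemma basis_op_id: "basis_op (\<lambda>x. x) = mat 1"
  by (simp add: basis_op_def mat_def)

lemma dagger_basis_op_mult:
  assumes "inj f"
  shows "dagger (basis_op f) ** basis_op f = mat 1"
proof -
  have "(\<Sum>k\<in>UNIV. cnj (if k = f i then 1 else 0) * (if k = f j then 1 else 0)) =
      (if i = j then 1 else (0::complex))" for i j
  proof -
    have "(\<Sum>k\<in>UNIV. cnj (if k = f i then 1 else 0) * (if k = f j then 1 else 0)) =
      (\<Sum>k\<in>UNIV. if k = f i then (if i = j then 1 else (0::complex)) else 0)"
      using assms by (intro sum.cong) (auto dest: injD)
    then show ?thesis by simp
  qed
  then show ?thesis by (simp add: basis_op_def vec_eq_iff matrix_matrix_mult_def dagger_def mat_def)
qed

lemma dagger_basis_op: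
  assumes "\<And>x. g (f x) = x" "\<And>y. f (g y) = y"
  shows "dagger (basis_op f) = basis_op g"
proof -
  have "j = f i \<longleftrightarrow> i = g j" for i j using assms by metis
  then show ?thesis by (simp add: dagger_def basis_op_def vec_eq_iff)
qed

text \<open>Conjugation by a permutation pulls indices back along its inverse g. All regroupings of
  systems thereby become statements about entries.\<close>

lemma conj_channel_basis_op:
  assumes "\<And>x. g (f x) = x" "\<And>y. f (g y) = y"
  shows "conj_channel (basis_op f) A = (\<chi> i j. A $ g i $ g j)"
proof -
  have fg: "i = f k \<longleftrightarrow> k = g i" for i k using assms by metis
  have 1: "(basis_op f ** A) $ i $ k = A $ g i $ k" for i k
  proof -
    have "(basis_op f ** A) $ i $ k = (\<Sum>l\<in>UNIV. if l = g i then A $ g i $ k else 0)"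
      unfolding matrix_matrix_mult_def basis_op_def fg vec_lambda_beta by (intro sum.cong) auto
    then show ?thesis by simp
  qed
  have "conj_channel (basis_op f) A $ i $ j = A $ g i $ g j" for i j
  proof -
    have "conj_channel (basis_op f) A $ i $ j =
        (\<Sum>k\<in>UNIV. (basis_op f ** A) $ i $ k * cnj (if j = f k then 1 else 0))"
      by (simp add: conj_channel_def matrix_matrix_mult_def dagger_def basis_op_def)
    also have "\<dots> = (\<Sum>k\<in>UNIV. if k = g j then A $ g i $ g j else 0)"
      by (intro sum.cong) (auto simp: 1 fg)
    finally show ?thesis by simp
  qed
  then show ?thesis by (simp add: vec_eq_iff)
qed

lemma conj_channel_basis_op_matrix_unit:
  "conj_channel (basis_op f) (matrix_unit i j) = matrix_unit (f i) (f j)"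
proof -
  have "basis_op f *v axis i 1 = axis (f i) 1" for i
    by (simp add: vec_eq_iff matrix_vector_axis) (simp add: basis_op_def axis_def)
  then show ?thesis by (simp add: conj_channel_def matrix_unit_outer outer_conj)
qed

lemma swap_channel_entry: "swap_channel A $ (y, x) $ (y', x') = A $ (x, y) $ (x', y')"
  unfolding swap_channel_def
  by (subst conj_channel_basis_op[where g = "\<lambda>(y, x). (x, y)"]) auto

lemma assoc_left_entry:
  "assoc_left A $ ((x, y), z) $ ((x', y'), z') = A $ (x, y, z) $ (x', y', z')"
  unfolding assoc_left_def
  by (subst conj_channel_basis_op[where g = "\<lambda>((x, y), z). (x, y, z)"]) auto

lemma assoc_right_entry:
  "assoc_right A $ (x, y, z) $ (x', y', z') = A $ ((x, y), z) $ ((x', y'), z')"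
  unfolding assoc_right_def
  by (subst conj_channel_basis_op[where g = "\<lambda>(x, y, z). ((x, y), z)"]) auto

lemma middle_swap_entry:
  "middle_swap A $ ((x, u), (y, v)) $ ((x', u'), (y', v')) =
   A $ ((x, y), (u, v)) $ ((x', y'), (u', v'))"
  unfolding middle_swap_def
  by (subst conj_channel_basis_op[where g = "\<lambda>((x, u), (y, v)). ((x, y), (u, v))"]) auto

lemma swap_channel_kron: "swap_channel (kron A B) = kron B A"
  by (simp add: vec_eq_iff swap_channel_entry kron_def)

lemma assoc_left_kron: "assoc_left (kron A (kron B C)) = kron (kron A B) C"
  by (simp add: vec_eq_iff assoc_left_entry kron_def mult.assoc)

lemma assoc_right_kron: "assoc_right (kron (kron A B) C) = kron A (kron B C)"
  by (simp add: vec_eq_iff assoc_right_entry kron_def mult.assoc)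

lemma middle_swap_kron:
  "middle_swap (kron (kron A B) (kron C D)) = kron (kron A C) (kron B D)"
  by (simp add: vec_eq_iff middle_swap_entry kron_def mult_ac)

lemma swap_swap: "swap_channel (swap_channel A) = A"
  by (simp add: vec_eq_iff swap_channel_entry)

lemma assoc_left_right: "assoc_left (assoc_right A) = A"
  by (simp add: vec_eq_iff assoc_left_entry assoc_right_entry)

lemma assoc_right_left: "assoc_right (assoc_left A) = A"
  by (simp add: vec_eq_iff assoc_left_entry assoc_right_entry)

lemma middle_swap_twice: "middle_swap (middle_swap A) = A"
  by (simp add: vec_eq_iff middle_swap_entry)

lemma clinear_map_permutations [simp, intro]:
  "clinear_map swap_channel" "clinear_map assoc_left" "clinear_map assoc_right"
  "clinear_map middle_swap"
  by (simp_all add: swap_channel_def assoc_left_def assoc_right_def middle_swap_def)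

section \<open>Channels and Kraus operators\<close>

definition kraus_map :: "('k::finite \<Rightarrow> complex^'x::finite^'y::finite) \<Rightarrow> 'x op \<Rightarrow> 'y op" where
  "kraus_map K \<rho> = (\<Sum>k\<in>UNIV. conj_channel (K k) \<rho>)"

lemma clinear_map_kraus_map [simp, intro]: "clinear_map (kraus_map K)"
  by (simp add: clinear_map_def kraus_map_def sum.distrib cscale_sum
      clinear_map_add[OF clinear_map_conj_channel] clinear_map_cscale[OF clinear_map_conj_channel])

text \<open>The bracket is the dual map (Heisenberg picture) applied to H. For H = 1 it expresses
  trace preservation; for a contraction H it is the test operator in the bound on the trace norm of
  an output.\<close>

lemma trace_kraus_map: "trace (H ** kraus_map K \<rho>) = trace ((\<Sum>k\<in>UNIV. dagger (K k) ** H ** K k) ** \<rho>)"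
proof -
  have "trace (H ** (K k ** \<rho> ** dagger (K k))) = trace (dagger (K k) ** H ** K k ** \<rho>)" for k
    using trace_mul_sym[of "H ** K k ** \<rho>" "dagger (K k)"] by (simp add: matrix_mul_assoc)
  then show ?thesis
    by (simp add: kraus_map_def conj_channel_def matrix_mult_sum_right matrix_mult_sum_left
        trace_sum)
qed

lemma kraus_map_channel:
  fixes K :: "'k::finite \<Rightarrow> complex^'x::finite^'y::finite"
  assumes "(\<Sum>k\<in>UNIV. dagger (K k) ** K k) = mat 1"
  shows "kraus_map K \<in> channels"
proof -
  have "completely_positive (kraus_map K)"
    unfolding completely_positive_def block_psd_def
  proof (intro allI impI)
    fix n and M :: "nat \<Rightarrow> nat \<Rightarrow> 'x op" and v :: "nat \<Rightarrow> complex^'y"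
    assume M: "\<forall>v. (\<Sum>i<n. \<Sum>j<n. cinner (v i) (M i j *v v j)) \<in> \<real>\<^sub>\<ge>\<^sub>0"
    have "(\<Sum>i<n. \<Sum>j<n. cinner (v i) (kraus_map K (M i j) *v v j)) =
        (\<Sum>i<n. \<Sum>j<n. \<Sum>k\<in>UNIV.
           cinner (dagger (K k) *v v i) (M i j *v (dagger (K k) *v v j)))"
      by (simp add: kraus_map_def conj_channel_def matrix_sum_vec cinner_sum_right
          matrix_vector_mul_assoc[symmetric] cinner_matrix_right[of _ "K _"])
    also have "\<dots> = (\<Sum>k\<in>UNIV. \<Sum>i<n. \<Sum>j<n.
           cinner (dagger (K k) *v v i) (M i j *v (dagger (K k) *v v j)))"
      by (subst sum.swap[where A = UNIV], rule sum.cong[OF refl], rule sum.swap)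
    also have "\<dots> \<in> \<real>\<^sub>\<ge>\<^sub>0"
      using M[rule_format, of "\<lambda>i. dagger (K _) *v v i"]
      by (simp add: complex_nonneg_Reals_iff sum_nonneg)
    finally show "(\<Sum>i<n. \<Sum>j<n. cinner (v i) (kraus_map K (M i j) *v v j)) \<in> \<real>\<^sub>\<ge>\<^sub>0" .
  qed
  moreover have "trace (kraus_map K A) = trace A" for A
    using trace_kraus_map[of "mat 1" K A] assms by simp
  ultimately show ?thesis by (simp add: channels_def)
qed

section \<open>Choi operators and Kraus representations\<close>

definition choi :: "('x::finite op \<Rightarrow> 'y::finite op) \<Rightarrow> ('x \<times> 'y) op" where
  "choi L = (\<chi> p q. L (matrix_unit (fst p) (fst q)) $ snd p $ snd q)"

text \<open>The block matrix of all matrix units is the unnormalised maximally entangled state,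
  hence positive, and complete positivity with an ancilla of dimension \<open>CARD('x)\<close>
  applies to it. The bijection e translates the numbered blocks of the definition into basis
  labels.\<close>

lemma psd_choi:
  fixes L :: "'x::finite op \<Rightarrow> 'y::finite op"
  assumes "completely_positive L"
  shows "psd (choi L)"
  unfolding psd_def
proof
  fix v :: "complex^('x \<times> 'y)"
  obtain e where e: "bij_betw e {0..<CARD('x)} (UNIV :: 'x set)"
    using ex_bij_betw_nat_finite[of "UNIV :: 'x set"] by auto
  have reindex: "(\<Sum>i<CARD('x). f (e i)) = (\<Sum>x\<in>UNIV. f x)" for f :: "'x \<Rightarrow> complex"
    using sum.reindex_bij_betw[OF e, of f] by (simp add: atLeast0LessThan)
  have "block_psd CARD('x) (\<lambda>i j. matrix_unit (e i) (e j))"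
    unfolding block_psd_def
  proof
    fix w :: "nat \<Rightarrow> complex^'x"
    define s where "s = (\<Sum>i<CARD('x). w i $ e i)"
    have "(\<Sum>i<CARD('x). \<Sum>j<CARD('x). cinner (w i) (matrix_unit (e i) (e j) *v w j)) =
        (\<Sum>i<CARD('x). \<Sum>j<CARD('x). cnj (w i $ e i) * w j $ e j)"
      by (simp add: matrix_unit_outer outer_mult_vec cinner_scale_right cinner_axis mult.commute)
    also have "\<dots> = cnj s * s" by (simp add: s_def sum_product)
    also have "\<dots> = s * cnj s" by (rule mult.commute)
    also have "\<dots> = of_real ((norm s)\<^sup>2)" by (rule complex_norm_square[symmetric])
    also have "\<dots> \<in> \<real>\<^sub>\<ge>\<^sub>0" by simp
    finally show "(\<Sum>i<CARD('x). \<Sum>j<CARD('x).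
      cinner (w i) (matrix_unit (e i) (e j) *v w j)) \<in> \<real>\<^sub>\<ge>\<^sub>0" .
  qed
  then have "block_psd CARD('x) (\<lambda>i j. L (matrix_unit (e i) (e j)))"
    using assms by (simp add: completely_positive_def)
  then have "(\<Sum>i<CARD('x). \<Sum>j<CARD('x).
      cinner (\<chi> a. v $ (e i, a)) (L (matrix_unit (e i) (e j)) *v (\<chi> a. v $ (e j, a)))) \<in> \<real>\<^sub>\<ge>\<^sub>0"
    unfolding block_psd_def by (rule spec[of _ "\<lambda>i. \<chi> a. v $ (e i, a)"])
  also have "(\<Sum>i<CARD('x). \<Sum>j<CARD('x).
      cinner (\<chi> a. v $ (e i, a)) (L (matrix_unit (e i) (e j)) *v (\<chi> a. v $ (e j, a)))) =
      (\<Sum>x\<in>UNIV. \<Sum>y\<in>UNIV.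
      cinner (\<chi> a. v $ (x, a)) (L (matrix_unit x y) *v (\<chi> a. v $ (y, a))))"
    by (simp only: reindex[of "\<lambda>y. cinner (\<chi> a. v $ (e _, a)) (L (matrix_unit (e _) y) *v (\<chi> a. v $ (y, a)))"]
        reindex[of "\<lambda>x. \<Sum>y\<in>UNIV. cinner (\<chi> a. v $ (x, a)) (L (matrix_unit x y) *v (\<chi> a. v $ (y, a)))"])
  also have "\<dots> = (\<Sum>x\<in>UNIV. \<Sum>y\<in>UNIV. \<Sum>a\<in>UNIV. \<Sum>b\<in>UNIV.
      cnj (v $ (x, a)) * (L (matrix_unit x y) $ a $ b * v $ (y, b)))"
    by (simp add: cinner_def matrix_vector_mult_def sum_distrib_left)
  also have "\<dots> = (\<Sum>x\<in>UNIV. \<Sum>a\<in>UNIV. \<Sum>y\<in>UNIV. \<Sum>b\<in>UNIV.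
      cnj (v $ (x, a)) * (L (matrix_unit x y) $ a $ b * v $ (y, b)))"
    by (intro sum.cong refl sum.swap)
  also have "\<dots> = cinner v (choi L *v v)"
    by (simp add: cinner_def matrix_vector_mult_def sum_distrib_left sum_UNIV_prod choi_def)
  finally show "cinner v (choi L *v v) \<in> \<real>\<^sub>\<ge>\<^sub>0" .
qed

text \<open>The columns of the square root of the Choi operator, reshaped into matrices, are Kraus
  operators; their normalisation is trace preservation tested on matrix units. Complete positivity,
  a condition on all ancillas, is thus replaced by a finite sum.\<close>

lemma channelE_kraus:
  fixes L :: "'x::finite op \<Rightarrow> 'y::finite op"
  assumes "L \<in> channels"
  obtains K :: "'x \<times> 'y \<Rightarrow> complex^'x^'y"
  where "L = kraus_map K" "(\<Sum>k\<in>UNIV. dagger (K k) ** K k) = mat 1"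
proof -
  have L: "clinear_map L" "completely_positive L" "\<And>A. trace (L A) = trace A"
    using assms by (auto simp: channels_def)
  define R where "R = psd_sqrt (choi L)"
  have R: "psd R" "R ** R = choi L"
    using psd_sqrt[OF psd_choi[OF L(2)]] by (auto simp: R_def)
  define K where "K = (\<lambda>k. \<chi> a x. R $ (x, a) $ k)"
  have conj_unit: "conj_channel M (matrix_unit x y) $ a $ b = M $ a $ x * cnj (M $ b $ y)"
    for M :: "complex^'x^'y" and x y a b
  proof -
    have "M *v axis x 1 = (\<chi> a. M $ a $ x)" for x
      by (simp add: vec_eq_iff matrix_vector_axis)
    then show ?thesis
      by (simp add: conj_channel_def matrix_unit_outer outer_conj) (simp add: outer_def)
  qed
  have "L (matrix_unit x y) $ a $ b = kraus_map K (matrix_unit x y) $ a $ b" for x y a b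
  proof -
    have "L (matrix_unit x y) $ a $ b = (R ** dagger R) $ (x, a) $ (y, b)"
      using R(2) psd_hermitian[OF R(1)] by (simp add: choi_def)
    also have "\<dots> = (\<Sum>k\<in>UNIV. K k $ a $ x * cnj (K k $ b $ y))"
      by (simp add: matrix_matrix_mult_def dagger_def K_def)
    finally show ?thesis by (simp add: kraus_map_def conj_unit)
  qed
  then have eq: "L = kraus_map K"
    by (intro clinear_map_eqI L(1)) (simp_all add: vec_eq_iff)
  define N where "N = (\<Sum>k\<in>UNIV. dagger (K k) ** K k)"
  have "N $ y $ x = (if y = x then 1 else 0)" for x y
  proof -
    have "trace (N ** matrix_unit x y) = trace (L (matrix_unit x y))"
      using trace_kraus_map[of "mat 1" K "matrix_unit x y"] by (simp add: eq N_def)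
    also have "\<dots> = (if y = x then 1 else 0)" by (auto simp: L(3) trace_matrix_unit)
    finally show ?thesis
      by (simp add: matrix_unit_outer trace_outer cinner_axis matrix_vector_axis)
  qed
  then have "N = mat 1" by (simp add: vec_eq_iff mat_def)
  then show ?thesis using that eq by (simp add: N_def)
qed

section \<open>Closure properties and examples of channels\<close>

lemma channel_clinear: "L \<in> channels \<Longrightarrow> clinear_map L"
  by (simp add: channels_def)

lemma channel_trace: "L \<in> channels \<Longrightarrow> trace (L A) = trace A"
  by (simp add: channels_def)

lemma channel_comp: "L \<in> channels \<Longrightarrow> M \<in> channels \<Longrightarrow> L \<circ> M \<in> channels"
  by (auto simp: channels_def completely_positive_def)

text \<open>Complete positivity of a product is hard to see from block matrices, but products of
  Kraus operators are Kraus operators of the product.\<close>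

lemma channel_tensor:
  fixes L :: "'x::finite op \<Rightarrow> 'u::finite op" and M :: "'y::finite op \<Rightarrow> 'v::finite op"
  assumes "L \<in> channels" "M \<in> channels"
  shows "L \<otimes>\<^sub>L M \<in> channels"
proof -
  obtain K :: "'x \<times> 'u \<Rightarrow> complex^'x^'u"
    where K: "L = kraus_map K" "(\<Sum>k\<in>UNIV. dagger (K k) ** K k) = mat 1"
    using channelE_kraus[OF assms(1)] by blast
  obtain N :: "'y \<times> 'v \<Rightarrow> complex^'y^'v"
    where N: "M = kraus_map N" "(\<Sum>k\<in>UNIV. dagger (N k) ** N k) = mat 1"
    using channelE_kraus[OF assms(2)] by blast
  let ?K = "\<lambda>p. kron (K (fst p)) (N (snd p))"
  have "L \<otimes>\<^sub>L M = kraus_map ?K"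
    by (intro clinear_map_eqI_kron)
      (simp_all add: K(1) N(1) tensor_map_kron,
       simp only: kraus_map_def conj_channel_kron
         kron_sum_sum[of "\<lambda>k. conj_channel (K k) _" "\<lambda>k. conj_channel (N k) _"])
  moreover have "(\<Sum>p\<in>UNIV. dagger (?K p) ** ?K p) = mat 1"
    by (simp only: dagger_kron kron_mult kron_sum_sum[of "\<lambda>k. dagger (K k) ** K k"
        "\<lambda>k. dagger (N k) ** N k"] K(2) N(2) kron_mat_1)
  ultimately show ?thesis using kraus_map_channel[of ?K] by simp
qed

lemma isometry_channel: "dagger W ** W = mat 1 \<Longrightarrow> conj_channel W \<in> channels"
  using kraus_map_channel[of "\<lambda>_::unit. W"] by (simp add: kraus_map_def[abs_def] fun_eq_iff)

lemma basis_op_channel: "inj f \<Longrightarrow> conj_channel (basis_op f) \<in> channels"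
  by (intro isometry_channel dagger_basis_op_mult)

lemma id_channel: "id \<in> channels"
  by (simp add: channels_def completely_positive_def)

lemma permutation_channels:
  "swap_channel \<in> channels" "assoc_left \<in> channels" "assoc_right \<in> channels"
  "middle_swap \<in> channels"
  unfolding swap_channel_def assoc_left_def assoc_right_def middle_swap_def
  by (auto intro!: basis_op_channel injI)

lemma trace_channel_channel: "(trace_channel :: 'x::finite op \<Rightarrow> unit op) \<in> channels"
proof -
  \<comment> \<open>These are the row vectors <i|, read as maps into the one-dimensional
    system.\<close>
  let ?K = "\<lambda>i::'x. dagger (basis_op (\<lambda>_::unit. i))"
  have "trace_channel = kraus_map ?K"
    by (auto simp: fun_eq_iff vec_eq_iff trace_channel_def trace_def kraus_map_def conj_channel_def
        matrix_matrix_mult_def dagger_def basis_op_def mult_delta_left mult_delta_right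
        cnj_delta)
  moreover have "(\<Sum>i\<in>UNIV. dagger (?K i) ** ?K i) = mat 1"
    by (auto simp: vec_eq_iff matrix_matrix_mult_def dagger_def basis_op_def mat_def UNIV_unit
        mult_delta_left mult_delta_right cnj_delta)
  ultimately show ?thesis using kraus_map_channel[of ?K] by simp
qed

lemma channels_nonempty: "(channels :: ('x::finite op \<Rightarrow> 'y::finite op) set) \<noteq> {}"
proof -
  have "conj_channel (basis_op (\<lambda>_::unit. undefined :: 'y)) \<circ> trace_channel \<in> channels"
    by (intro channel_comp basis_op_channel trace_channel_channel) (simp add: inj_def)
  then show ?thesis by blast
qed

text \<open>This supplies the mixtures that serve as witnesses for CNOT and SWAP.\<close>

lemma channel_convex:
  assumes "L \<in> channels" "M \<in> channels" "0 \<le> t" "t \<le> 1"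
  shows "(\<lambda>\<rho>. t *\<^sub>R L \<rho> + (1 - t) *\<^sub>R M \<rho>) \<in> channels"
proof -
  have "completely_positive (\<lambda>\<rho>. t *\<^sub>R L \<rho> + (1 - t) *\<^sub>R M \<rho>)"
    unfolding completely_positive_def block_psd_def
  proof (intro allI impI)
    fix n and N :: "nat \<Rightarrow> nat \<Rightarrow> 'a op" and v :: "nat \<Rightarrow> complex^'b"
    assume N: "\<forall>v. (\<Sum>i<n. \<Sum>j<n. cinner (v i) (N i j *v v j)) \<in> \<real>\<^sub>\<ge>\<^sub>0"
    have L: "(\<Sum>i<n. \<Sum>j<n. cinner (v i) (L (N i j) *v v j)) \<in> \<real>\<^sub>\<ge>\<^sub>0"
      and M: "(\<Sum>i<n. \<Sum>j<n. cinner (v i) (M (N i j) *v v j)) \<in> \<real>\<^sub>\<ge>\<^sub>0"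
      using N assms(1,2) unfolding channels_def completely_positive_def block_psd_def by auto
    have "(\<Sum>i<n. \<Sum>j<n. cinner (v i) ((t *\<^sub>R L (N i j) + (1 - t) *\<^sub>R M (N i j)) *v v j)) =
      of_real t * (\<Sum>i<n. \<Sum>j<n. cinner (v i) (L (N i j) *v v j)) +
      of_real (1 - t) * (\<Sum>i<n. \<Sum>j<n. cinner (v i) (M (N i j) *v v j))"
      by (simp only: matrix_vector_mult_add_rdistrib scaleR_matrix_vec cinner_add_right
          cinner_scale_right sum.distrib sum_distrib_left)
    also have "\<dots> \<in> \<real>\<^sub>\<ge>\<^sub>0"
      using L M assms(3,4)
      by (intro nonneg_Reals_add_I nonneg_Reals_mult_I) (auto simp: complex_nonneg_Reals_iff)
    finally show "(\<Sum>i<n. \<Sum>j<n.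
      cinner (v i) ((t *\<^sub>R L (N i j) + (1 - t) *\<^sub>R M (N i j)) *v v j)) \<in> \<real>\<^sub>\<ge>\<^sub>0" .
  qed
  moreover have "trace (t *\<^sub>R L A + (1 - t) *\<^sub>R M A) = trace A" for A
    using assms(1,2) by (simp add: trace_add trace_scaleR channel_trace del: scaleR_left.diff)
      (simp add: algebra_simps)
  ultimately show ?thesis
    using assms(1,2) by (auto simp: channels_def)
qed

lemma channel_psd:
  fixes L :: "'x::finite op \<Rightarrow> 'y::finite op"
  assumes "L \<in> channels" "psd A"
  shows "psd (L A)"
proof -
  obtain K :: "'x \<times> 'y \<Rightarrow> complex^'x^'y" where "L = kraus_map K"
    using channelE_kraus[OF assms(1)] by blast
  then show ?thesis using assms(2) by (simp add: kraus_map_def conj_channel_def psd_sum psd_conj)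
qed

lemma channel_density_ops: "L \<in> channels \<Longrightarrow> \<rho> \<in> density_ops \<Longrightarrow> L \<rho> \<in> density_ops"
  by (simp add: density_ops_def channel_psd channel_trace)

text \<open>The dual of a channel maps contractions to contractions: by normalisation, v goes
  isometrically to the family of the vectors K k v, and Cauchy-Schwarz over this family bounds
  G.\<close>

lemma channel_trace_norm:
  fixes L :: "'x::finite op \<Rightarrow> 'y::finite op"
  assumes "L \<in> channels"
  shows "trace_norm (L Y) \<le> trace_norm Y"
proof (rule trace_norm_leI)
  fix H :: "'y op" assume H: "contraction H"
  obtain K :: "'x \<times> 'y \<Rightarrow> complex^'x^'y"
    where K: "L = kraus_map K" "(\<Sum>k\<in>UNIV. dagger (K k) ** K k) = mat 1"
    using channelE_kraus[OF assms] by blast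
  define G where "G = (\<Sum>k\<in>UNIV. dagger (K k) ** H ** K k)"
  have norm_K: "L2_set (\<lambda>k. norm (K k *v v)) UNIV = norm v" for v
  proof -
    have "cinner v v = (\<Sum>k\<in>UNIV. cinner (K k *v v) (K k *v v))"
      using arg_cong[OF K(2), of "\<lambda>N. cinner v (N *v v)"]
      by (simp add: matrix_sum_vec cinner_sum_right cinner_matrix_left
          matrix_vector_mul_assoc)
    then have "(norm v)\<^sup>2 = (\<Sum>k\<in>UNIV. (norm (K k *v v))\<^sup>2)"
      unfolding cinner_self of_real_sum[symmetric] of_real_eq_iff .
    then show ?thesis by (metis L2_set_def norm_ge_zero real_sqrt_unique)
  qed
  have "contraction G"
    unfolding contraction_def
  proof
    fix v
    let ?w = "G *v v"
    have "(norm ?w)\<^sup>2 = norm (cinner ?w ?w)" by (simp add: cinner_self norm_power)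
    also have "cinner ?w ?w = (\<Sum>k\<in>UNIV. cinner (K k *v ?w) (H *v (K k *v v)))"
      by (subst (2) G_def) (simp add: matrix_sum_vec cinner_sum_right cinner_matrix_left
          matrix_vector_mul_assoc[symmetric])
    also have "norm \<dots> \<le> (\<Sum>k\<in>UNIV. \<bar>norm (K k *v ?w)\<bar> * \<bar>norm (K k *v v)\<bar>)"
    proof (rule sum_norm_le)
      fix k
      have "norm (cinner (K k *v ?w) (H *v (K k *v v))) \<le> norm (K k *v ?w) * norm (H *v (K k *v v))"
        by (rule cinner_Cauchy_Schwarz)
      also have "\<dots> \<le> norm (K k *v ?w) * norm (K k *v v)"
        using H by (simp add: contraction_def mult_left_mono)
      finally show "norm (cinner (K k *v ?w) (H *v (K k *v v))) \<le>
          \<bar>norm (K k *v ?w)\<bar> * \<bar>norm (K k *v v)\<bar>" by simp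
    qed
    also have "\<dots> \<le> L2_set (\<lambda>k. norm (K k *v ?w)) UNIV * L2_set (\<lambda>k. norm (K k *v v)) UNIV"
      by (rule L2_set_mult_ineq)
    finally have "(norm ?w)\<^sup>2 \<le> norm ?w * norm v" by (simp add: norm_K)
    then show "norm ?w \<le> norm v"
      by (cases "norm ?w = 0") (simp_all add: power2_eq_square)
  qed
  then show "Re (trace (H ** L Y)) \<le> trace_norm Y"
    unfolding K(1) trace_kraus_map G_def[symmetric] by (rule trace_norm_ge)
qed

section \<open>The diamond norm\<close>

lemma density_ops_nonempty: "(density_ops :: 'x::finite op set) \<noteq> {}"
  using outer_in_density_ops[of "axis undefined 1 :: complex^'x"] by auto

text \<open>Without an upper bound, \<open>SUP\<close> would carry no information, and no single
  state could bound the diamond norm from below. Entries of states have modulus at most 1, which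
  gives a constant depending on L alone.\<close>

lemma diamond_norm_bdd:
  fixes L :: "'x::finite op \<Rightarrow> 'y::finite op"
  shows "bdd_above ((\<lambda>\<rho>. trace_norm (((id :: 'e::finite op \<Rightarrow> 'e op) \<otimes>\<^sub>L L) \<rho>)) ` density_ops)"
proof (rule bdd_aboveI2)
  fix \<rho> :: "('e \<times> 'x) op"
  assume \<rho>: "\<rho> \<in> density_ops"
  have \<rho>1: "norm (\<rho> $ i $ j) \<le> 1" for i j
    using psd_entry_bound[of \<rho> i j] \<rho> by (simp add: density_ops_def)
  let ?c = "\<lambda>(p :: 'e \<times> 'y) q i j k l. norm (id (matrix_unit i j) $ fst p $ fst q *
      L (matrix_unit k l) $ snd p $ snd q)"
  have "norm ((id \<otimes>\<^sub>L L) \<rho> $ p $ q) \<le> (\<Sum>i\<in>UNIV. \<Sum>j\<in>UNIV. \<Sum>k\<in>UNIV. \<Sum>l\<in>UNIV. ?c p q i j k l)" for p q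
    unfolding tensor_map_def vec_lambda_beta
  proof (intro sum_norm_le)
    fix i j k l
    show "norm (\<rho> $ (i, k) $ (j, l) * (id (matrix_unit i j) $ fst p $ fst q *
        L (matrix_unit k l) $ snd p $ snd q)) \<le> ?c p q i j k l"
      unfolding norm_mult[of "\<rho> $ (i, k) $ (j, l)"]
      using \<rho>1[of "(i, k)" "(j, l)"] by (intro mult_left_le_one_le) auto
  qed
  then have "(\<Sum>p\<in>UNIV. \<Sum>q\<in>UNIV. norm ((id \<otimes>\<^sub>L L) \<rho> $ p $ q)) \<le>
      (\<Sum>p\<in>UNIV. \<Sum>q\<in>UNIV. \<Sum>i\<in>UNIV. \<Sum>j\<in>UNIV. \<Sum>k\<in>UNIV. \<Sum>l\<in>UNIV. ?c p q i j k l)"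
    by (intro sum_mono)
  then show "trace_norm ((id \<otimes>\<^sub>L L) \<rho>) \<le>
      (\<Sum>p\<in>UNIV. \<Sum>q\<in>UNIV. \<Sum>i\<in>UNIV. \<Sum>j\<in>UNIV. \<Sum>k\<in>UNIV. \<Sum>l\<in>UNIV. ?c p q i j k l)"
    using trace_norm_le_entries order_trans by blast
qed

lemma diamond_norm_upper:
  fixes L :: "'x::finite op \<Rightarrow> 'y::finite op" and \<rho> :: "('x \<times> 'x) op"
  shows "\<rho> \<in> density_ops \<Longrightarrow> trace_norm ((id \<otimes>\<^sub>L L) \<rho>) \<le> diamond_norm L"
  unfolding diamond_norm_def by (rule cSUP_upper[OF _ diamond_norm_bdd])

lemma diamond_norm_leI:
  fixes L :: "'x::finite op \<Rightarrow> 'y::finite op"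
  assumes "\<And>\<rho> :: ('x \<times> 'x) op. \<rho> \<in> density_ops \<Longrightarrow> trace_norm ((id \<otimes>\<^sub>L L) \<rho>) \<le> c"
  shows "diamond_norm L \<le> c"
  unfolding diamond_norm_def by (rule cSUP_least[OF density_ops_nonempty assms])

lemma diamond_norm_nonneg: "diamond_norm L \<ge> 0"
proof -
  obtain \<rho> where "\<rho> \<in> (density_ops :: ('a \<times> 'a) op set)" using density_ops_nonempty by blast
  from diamond_norm_upper[OF this, of L] show ?thesis
    using trace_norm_nonneg order_trans by blast
qed

section \<open>Independence of the ancilla\<close>

lemma norm_vec_square: "(norm v)\<^sup>2 = (\<Sum>i\<in>UNIV. (norm (v $ i))\<^sup>2)"
  by (simp add: norm_vec_def L2_set_def sum_nonneg)

lemma contraction_kron_mat_1: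
  fixes W :: "complex^'x::finite^'y::finite"
  assumes "contraction W"
  shows "contraction (kron W (mat 1 :: 'z::finite op))"
  unfolding contraction_def
proof
  fix v :: "complex^('x \<times> 'z)"
  let ?v = "\<lambda>z. \<chi> x. v $ (x, z)"
  have entry: "(kron W (mat 1) *v v) $ (y, z) = (W *v ?v z) $ y" for y z
    by (simp add: matrix_vector_mult_def kron_def sum_UNIV_prod mat_def mult_delta_left
        mult_delta_right)
  have "(norm (kron W (mat 1) *v v))\<^sup>2 = (\<Sum>y\<in>UNIV. \<Sum>z\<in>UNIV. (norm ((W *v ?v z) $ y))\<^sup>2)"
    by (simp add: norm_vec_square[of "kron W (mat 1) *v v"] sum_UNIV_prod entry)
  also have "\<dots> = (\<Sum>z\<in>UNIV. (norm (W *v ?v z))\<^sup>2)"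
    unfolding norm_vec_square by (rule sum.swap)
  also have "\<dots> \<le> (\<Sum>z\<in>UNIV. (norm (?v z))\<^sup>2)"
    using assms by (intro sum_mono power_mono) (auto simp: contraction_def)
  also have "\<dots> = (\<Sum>z\<in>UNIV. \<Sum>x\<in>UNIV. (norm (v $ (x, z)))\<^sup>2)"
    unfolding norm_vec_square by simp
  also have "\<dots> = (norm v)\<^sup>2"
    unfolding norm_vec_square[of v] sum_UNIV_prod by (rule sum.swap)
  finally show "norm (kron W (mat 1) *v v) \<le> norm v" by simp
qed

text \<open>A pure state of \<open>E \<otimes> X\<close> is the image of a pure state of \<open>X \<otimes> X\<close> under a contraction on the
  first factor, by polar decomposition of its coefficient matrix. An ancilla of the dimension of
  the input therefore suffices.\<close>

lemma diamond_norm_pure: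
  fixes L :: "'x::finite op \<Rightarrow> 'y::finite op" and v :: "complex^('e::finite \<times> 'x)"
  assumes L: "clinear_map L" and v: "norm v = 1"
  shows "trace_norm ((id \<otimes>\<^sub>L L) (outer v v)) \<le> diamond_norm L"
proof -
  define M :: "complex^'x^'e" where "M = (\<chi> e x. v $ (e, x))"
  define P where "P = psd_sqrt (dagger M ** M)"
  obtain W where W: "contraction W" "W ** P = M"
    unfolding P_def using polar_decomposition[of M] by blast
  have P: "psd P" "P ** P = dagger M ** M"
    unfolding P_def using psd_sqrt[OF psd_dagger_mult] by auto
  \<comment> \<open>P read as a vector of X \<otimes> X. It is as long as v because P and M have the
    same Hilbert-Schmidt norm.\<close>
  define p :: "complex^('x \<times> 'x)" where "p = (\<chi> q. P $ fst q $ snd q)"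
  have tr: "trace (dagger N ** N) = of_real (\<Sum>x\<in>UNIV. \<Sum>y\<in>UNIV. (norm (N $ y $ x))\<^sup>2)"
    for N :: "complex^'x^'w::finite"
    unfolding trace_def matrix_matrix_mult_def dagger_def vec_lambda_beta of_real_sum
    by (simp only: complex_norm_square mult.commute)
  have "trace (dagger P ** P) = trace (dagger M ** M)"
    by (simp add: P psd_hermitian)
  then have "(\<Sum>x\<in>UNIV. \<Sum>y\<in>UNIV. (norm (P $ y $ x))\<^sup>2) = (\<Sum>x\<in>UNIV. \<Sum>y\<in>UNIV. (norm (M $ y $ x))\<^sup>2)"
    unfolding tr of_real_eq_iff .
  then have "(\<Sum>x\<in>UNIV. \<Sum>y\<in>UNIV. (norm (P $ x $ y))\<^sup>2) = (\<Sum>x\<in>UNIV. \<Sum>y\<in>UNIV. (norm (M $ x $ y))\<^sup>2)"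
    by (subst (1 2) sum.swap)
  then have "(norm p)\<^sup>2 = (norm v)\<^sup>2"
    unfolding norm_vec_square sum_UNIV_prod by (simp add: p_def M_def)
  then have p1: "norm p = 1" using v by (simp add: power2_eq_iff_nonneg[of "norm p" 1, simplified])
  have "(kron W (mat 1) *v p) $ (e, x) = v $ (e, x)" for e x
  proof -
    have "(kron W (mat 1) *v p) $ (e, x) = (W ** P) $ e $ x"
      by (simp add: matrix_vector_mult_def matrix_matrix_mult_def kron_def sum_UNIV_prod mat_def
          p_def mult_delta_left mult_delta_right)
    then show ?thesis by (simp add: W(2) M_def)
  qed
  then have "v = kron W (mat 1) *v p" by (simp add: vec_eq_iff)
  then have "outer v v = conj_channel (kron W (mat 1)) (outer p p)"
    by (simp add: conj_channel_def outer_conj)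
  moreover have "conj_channel (kron W (mat 1)) = conj_channel W \<otimes>\<^sub>L (id :: 'x op \<Rightarrow> 'x op)"
    by (simp flip: tensor_map_conj_channel)
  ultimately have "(id \<otimes>\<^sub>L L) (outer v v) = ((id \<otimes>\<^sub>L L) \<circ> (conj_channel W \<otimes>\<^sub>L id)) (outer p p)"
    by simp
  \<comment> \<open>W acts on the ancilla and L on the system, so they commute; conjugation by W can
    then only decrease the trace norm.\<close>
  also have "\<dots> = ((conj_channel W \<otimes>\<^sub>L id) \<circ> (id \<otimes>\<^sub>L L)) (outer p p)"
    using L by (simp add: tensor_map_comp del: comp_apply)
  also have "\<dots> = conj_channel (kron W (mat 1)) ((id \<otimes>\<^sub>L L) (outer p p))"
    by (simp flip: tensor_map_conj_channel)
  finally have "trace_norm ((id \<otimes>\<^sub>L L) (outer v v)) \<le> trace_norm ((id \<otimes>\<^sub>L L) (outer p p))"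
    using trace_norm_conj[OF contraction_kron_mat_1[OF W(1)]] by (simp add: conj_channel_def)
  also have "\<dots> \<le> diamond_norm L"
    by (intro diamond_norm_upper outer_in_density_ops p1)
  finally show ?thesis .
qed

text \<open>The spectral theorem writes a mixed state as a convex combination of pure ones, and the
  trace norm is convex. The ancilla type is free here, unlike in the definition.\<close>

lemma diamond_norm_ancilla:
  fixes L :: "'x::finite op \<Rightarrow> 'y::finite op" and \<rho> :: "('e::finite \<times> 'x) op"
  assumes L: "clinear_map L" and \<rho>: "\<rho> \<in> density_ops"
  shows "trace_norm ((id \<otimes>\<^sub>L L) \<rho>) \<le> diamond_norm L"
proof -
  have "psd \<rho>" using \<rho> by (simp add: density_ops_def)
  from psd_decomposition[OF this] obtain B f
    where B: "onb B" "\<And>b. b \<in> B \<Longrightarrow> f b \<ge> 0" "\<rho> = (\<Sum>b\<in>B. f b *\<^sub>R outer b b)"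
    "Re (trace \<rho>) = (\<Sum>b\<in>B. f b)"
    by blast
  have "(id \<otimes>\<^sub>L L) \<rho> = (\<Sum>b\<in>B. f b *\<^sub>R (id \<otimes>\<^sub>L L) (outer b b))"
    unfolding B(3)
    by (simp add: clinear_map_sum[OF clinear_map_tensor_map]
        clinear_map_scaleR[OF clinear_map_tensor_map])
  then have "trace_norm ((id \<otimes>\<^sub>L L) \<rho>) \<le> (\<Sum>b\<in>B. trace_norm (f b *\<^sub>R (id \<otimes>\<^sub>L L) (outer b b)))"
    by (simp add: trace_norm_sum)
  also have "\<dots> \<le> (\<Sum>b\<in>B. f b * diamond_norm L)"
  proof (rule sum_mono)
    fix b assume b: "b \<in> B"
    show "trace_norm (f b *\<^sub>R (id \<otimes>\<^sub>L L) (outer b b)) \<le> f b * diamond_norm L"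
      using trace_norm_scaleR[OF B(2)[OF b]] diamond_norm_pure[OF L onb_norm[OF B(1) b]]
        B(2)[OF b] by (meson mult_left_mono order_trans)
  qed
  also have "\<dots> = diamond_norm L"
    using B(4) \<rho> by (simp add: sum_distrib_right[symmetric] density_ops_def)
  finally show ?thesis .
qed

text \<open>The ancilla belongs to the input of J, so once J has acted it need not match the input
  of L; the bound for arbitrary ancillas closes this gap. The channel R contracts the trace
  norm.\<close>

lemma diamond_norm_channel_comp:
  fixes L :: "'x::finite op \<Rightarrow> 'y::finite op"
    and J :: "'u::finite op \<Rightarrow> 'x op" and R :: "'y op \<Rightarrow> 'v::finite op"
  assumes L: "clinear_map L" and J: "J \<in> channels" and R: "R \<in> channels"
  shows "diamond_norm (R \<circ> L \<circ> J) \<le> diamond_norm L"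
proof (rule diamond_norm_leI)
  fix \<rho> :: "('u \<times> 'u) op" assume \<rho>: "\<rho> \<in> density_ops"
  note lin = L channel_clinear[OF J] channel_clinear[OF R]
  have "(id :: 'u op \<Rightarrow> 'u op) \<otimes>\<^sub>L (R \<circ> L \<circ> J) = (id \<otimes>\<^sub>L R) \<circ> (id \<otimes>\<^sub>L L) \<circ> (id \<otimes>\<^sub>L J)"
    using lin by (simp add: tensor_map_comp clinear_map_comp)
  then have "(id \<otimes>\<^sub>L (R \<circ> L \<circ> J)) \<rho> = (id \<otimes>\<^sub>L R) ((id \<otimes>\<^sub>L L) ((id \<otimes>\<^sub>L J) \<rho>))" by simp
  then have "trace_norm ((id \<otimes>\<^sub>L (R \<circ> L \<circ> J)) \<rho>) \<le> trace_norm ((id \<otimes>\<^sub>L L) ((id \<otimes>\<^sub>L J) \<rho>))"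
    using channel_trace_norm[OF channel_tensor[OF id_channel R]] by metis
  also have "\<dots> \<le> diamond_norm L"
    by (rule diamond_norm_ancilla[OF L channel_density_ops[OF channel_tensor[OF id_channel J] \<rho>]])
  finally show "trace_norm ((id \<otimes>\<^sub>L (R \<circ> L \<circ> J)) \<rho>) \<le> diamond_norm L" .
qed

lemma tensor_map_assoc:
  assumes "clinear_map L" "clinear_map M" "clinear_map N"
  shows "L \<otimes>\<^sub>L (M \<otimes>\<^sub>L N) = assoc_right \<circ> ((L \<otimes>\<^sub>L M) \<otimes>\<^sub>L N) \<circ> assoc_left"
  using assms
  by (intro clinear_map_eqI clinear_map_comp)
    (auto simp: matrix_unit_pair tensor_map_kron assoc_left_kron assoc_right_kron)

text \<open>Reassociation absorbs the idle factor into the ancilla.\<close>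

lemma diamond_norm_id_tensor:
  fixes L :: "'x::finite op \<Rightarrow> 'y::finite op"
  assumes L: "clinear_map L"
  shows "diamond_norm ((id :: 'z::finite op \<Rightarrow> 'z op) \<otimes>\<^sub>L L) \<le> diamond_norm L"
proof (rule diamond_norm_leI)
  fix \<rho> :: "(('z \<times> 'x) \<times> ('z \<times> 'x)) op" assume \<rho>: "\<rho> \<in> density_ops"
  let ?\<sigma> = "assoc_left \<rho>"
  have "(id \<otimes>\<^sub>L (id \<otimes>\<^sub>L L)) \<rho> = assoc_right ((id \<otimes>\<^sub>L L) ?\<sigma>)"
    using L by (simp add: tensor_map_assoc tensor_map_id)
  then have "trace_norm ((id \<otimes>\<^sub>L (id \<otimes>\<^sub>L L)) \<rho>) \<le> trace_norm ((id \<otimes>\<^sub>L L) ?\<sigma>)"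
    using channel_trace_norm[OF permutation_channels(3)] by metis
  also have "\<dots> \<le> diamond_norm L"
    by (rule diamond_norm_ancilla[OF L channel_density_ops[OF permutation_channels(2) \<rho>]])
  finally show "trace_norm ((id \<otimes>\<^sub>L (id \<otimes>\<^sub>L L)) \<rho>) \<le> diamond_norm L" .
qed

lemma diamond_norm_tensor_channel:
  fixes L :: "'x::finite op \<Rightarrow> 'y::finite op" and N :: "'u::finite op \<Rightarrow> 'v::finite op"
  assumes L: "clinear_map L" and N: "N \<in> channels"
  shows "diamond_norm (L \<otimes>\<^sub>L N) \<le> diamond_norm L"
proof -
  have "L \<otimes>\<^sub>L N = swap_channel \<circ> (id \<otimes>\<^sub>L L) \<circ> (swap_channel \<circ> (id \<otimes>\<^sub>L N))"
    using L channel_clinear[OF N]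
    by (intro clinear_map_eqI_kron clinear_map_comp)
      (auto simp: tensor_map_kron swap_channel_kron)
  then have "diamond_norm (L \<otimes>\<^sub>L N) \<le> diamond_norm ((id :: 'v op \<Rightarrow> 'v op) \<otimes>\<^sub>L L)"
    by (simp only:) (intro diamond_norm_channel_comp clinear_map_tensor_map channel_comp
        channel_tensor id_channel permutation_channels N)
  then show ?thesis using diamond_norm_id_tensor[OF L] by (rule order_trans)
qed

text \<open>A one-dimensional ancilla; this suffices for lower bounds that need no entanglement with
  a reference.\<close>

lemma trace_norm_le_diamond_norm:
  fixes L :: "'x::finite op \<Rightarrow> 'y::finite op"
  assumes L: "clinear_map L" and \<sigma>: "\<sigma> \<in> density_ops"
  shows "trace_norm (L \<sigma>) \<le> diamond_norm L"
proof -
  let ?I = "conj_channel (basis_op (\<lambda>x :: 'x. ((), x)))"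
    and ?R = "conj_channel (basis_op (snd :: unit \<times> 'y \<Rightarrow> 'y))"
  have I: "?I A = kron (mat 1 :: unit op) A" for A
    by (subst conj_channel_basis_op[where g = snd]) (auto simp: kron_def vec_eq_iff mat_def)
  have R: "?R (kron (mat 1 :: unit op) A) = A" for A
    by (subst conj_channel_basis_op[where g = "\<lambda>x. ((), x)"])
      (auto simp: kron_def vec_eq_iff mat_def)
  have "L \<sigma> = ?R ((id \<otimes>\<^sub>L L) (?I \<sigma>))"
    using L by (simp add: I R tensor_map_kron)
  moreover have "?R \<in> channels" "?I \<in> channels"
    by (auto intro!: basis_op_channel injI)
  ultimately have "trace_norm (L \<sigma>) \<le> trace_norm ((id \<otimes>\<^sub>L L) (?I \<sigma>))"
    by (simp only:) (rule channel_trace_norm)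
  also have "\<dots> \<le> diamond_norm L"
    by (rule diamond_norm_ancilla[OF L channel_density_ops[OF \<open>?I \<in> channels\<close> \<sigma>]])
  finally show ?thesis .
qed

text \<open>Two states are at trace distance at most 2. Every nonzero upper bound for a specific
  gate below comes from writing a defect in this form.\<close>

lemma diamond_norm_channel_diff:
  assumes "F \<in> channels" "G \<in> channels" "c \<ge> 0"
  shows "diamond_norm (\<lambda>\<rho>. c *\<^sub>R (F \<rho> - G \<rho>)) \<le> 2 * c"
proof (rule diamond_norm_leI)
  fix \<rho> :: "('a \<times> 'a) op" assume \<rho>: "\<rho> \<in> density_ops"
  have "(id :: 'a op \<Rightarrow> 'a op) \<otimes>\<^sub>L (\<lambda>\<rho>. c *\<^sub>R (F \<rho> - G \<rho>)) = (\<lambda>\<rho>. c *\<^sub>R ((id \<otimes>\<^sub>L F) \<rho> - (id \<otimes>\<^sub>L G) \<rho>))"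
    using assms(1,2)[THEN channel_clinear]
    by (intro clinear_map_eqI_kron clinear_map_scaleR_fun clinear_map_minus)
      (auto simp: tensor_map_kron clinear_map_scaleR_fun clinear_map_minus kron_scaleR_right
        kron_diff_right)
  then have "trace_norm ((id \<otimes>\<^sub>L (\<lambda>\<rho>. c *\<^sub>R (F \<rho> - G \<rho>))) \<rho>) \<le>
      c * trace_norm ((id \<otimes>\<^sub>L F) \<rho> - (id \<otimes>\<^sub>L G) \<rho>)"
    using trace_norm_scaleR[OF assms(3)] by simp
  also have "\<dots> \<le> c * 2"
  proof (rule mult_left_mono[OF _ assms(3)])
    have "(id \<otimes>\<^sub>L F) \<rho> \<in> density_ops" "(id \<otimes>\<^sub>L G) \<rho> \<in> density_ops"
      by (rule channel_density_ops[OF channel_tensor[OF id_channel assms(1)] \<rho>],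
          rule channel_density_ops[OF channel_tensor[OF id_channel assms(2)] \<rho>])
    then have "psd ((id \<otimes>\<^sub>L F) \<rho>)" "psd ((id \<otimes>\<^sub>L G) \<rho>)"
      "trace ((id \<otimes>\<^sub>L F) \<rho>) = 1" "trace ((id \<otimes>\<^sub>L G) \<rho>) = 1"
      by (auto simp: density_ops_def)
    then show "trace_norm ((id \<otimes>\<^sub>L F) \<rho> - (id \<otimes>\<^sub>L G) \<rho>) \<le> 2"
      using trace_norm_diff_psd[of "(id \<otimes>\<^sub>L F) \<rho>" "(id \<otimes>\<^sub>L G) \<rho>"] by simp
  qed
  finally show "trace_norm ((id \<otimes>\<^sub>L (\<lambda>\<rho>. c *\<^sub>R (F \<rho> - G \<rho>))) \<rho>) \<le> 2 * c" by simp
qed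

lemma diamond_norm_zero: "diamond_norm (\<lambda>_. 0) = 0"
proof (rule antisym)
  have "(id \<otimes>\<^sub>L (\<lambda>_ :: 'a op. 0 :: 'b op)) \<rho> = 0" for \<rho> :: "('a \<times> 'a) op"
    by (simp add: tensor_map_def vec_eq_iff)
  then show "diamond_norm (\<lambda>_ :: 'a op. 0 :: 'b op) \<le> 0" by (intro diamond_norm_leI) simp
qed (rule diamond_norm_nonneg)

section \<open>Adding and discarding systems\<close>

lemma clinear_map_kron: "clinear_map (\<lambda>A. kron A B)" "clinear_map (\<lambda>A. kron B A)"
  by (simp_all add: clinear_map_def kron_cscale_left kron_cscale_right)
    (simp_all add: kron_def vec_eq_iff algebra_simps)

definition append_state :: "'y::finite \<Rightarrow> 'x::finite op \<Rightarrow> ('x \<times> 'y) op" where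
  "append_state k = conj_channel (basis_op (\<lambda>x. (x, k)))"

lemma append_state_channel: "append_state k \<in> channels"
  unfolding append_state_def by (rule basis_op_channel) (simp add: inj_def)

lemma append_state:
  fixes A :: "'x::finite op"
  shows "append_state k A = kron A (matrix_unit k k)"
proof -
  have "append_state k = (\<lambda>A :: 'x op. kron A (matrix_unit k k))"
    unfolding append_state_def
    by (intro clinear_map_eqI clinear_map_kron clinear_map_conj_channel)
      (simp add: conj_channel_basis_op_matrix_unit matrix_unit_pair)
  then show ?thesis by simp
qed

text \<open>The partial trace. Tracing out leaves a one-dimensional factor, which the outer
  conjugation removes.\<close>

definition discard :: "('x::finite \<times> 'y::finite) op \<Rightarrow> 'x op" where
  "discard = conj_channel (basis_op (fst :: 'x \<times> unit \<Rightarrow> 'x)) \<circ> (id \<otimes>\<^sub>L trace_channel)"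

lemma discard_channel: "discard \<in> channels"
  unfolding discard_def
  by (intro channel_comp basis_op_channel channel_tensor id_channel trace_channel_channel)
    (simp add: inj_def)

lemma discard_kron: "discard (kron A B) = cscale (trace B) A"
proof -
  have "conj_channel (basis_op (fst :: 'a \<times> unit \<Rightarrow> 'a)) X = (\<chi> i j. X $ (i, ()) $ (j, ()))" for X
    by (rule conj_channel_basis_op) auto
  then show ?thesis
    by (simp add: discard_def tensor_map_kron)
      (simp add: kron_def trace_channel_def cscale_def vec_eq_iff mult.commute)
qed

lemma trace_channel_comp: "L \<in> channels \<Longrightarrow> trace_channel \<circ> L = trace_channel"
  by (simp add: fun_eq_iff trace_channel_def channel_trace)

lemma trace_matrix_unit_self [simp]: "trace (matrix_unit k k) = 1"
  by (simp add: trace_matrix_unit)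

lemma cscale_1 [simp]: "cscale 1 A = A"
  by (simp add: cscale_def vec_eq_iff)

lemma discard_append_state: "discard \<circ> append_state k = id"
  by (simp add: fun_eq_iff append_state discard_kron)

lemma channel_clinear_simps [simp]:
  "clinear_map discard" "clinear_map (append_state k)"
  using channel_clinear[OF discard_channel] channel_clinear[OF append_state_channel] by auto

lemma clinear_map_eqI_kron_kron:
  assumes "clinear_map F" "clinear_map G"
    "\<And>A B C D. F (kron (kron A B) (kron C D)) = G (kron (kron A B) (kron C D))"
  shows "F = G"
  using assms by (intro clinear_map_eqI) (auto simp: matrix_unit_pair)

lemma append_state_append_state:
  fixes \<rho> :: "('x::finite \<times> 'y::finite) op"
  shows "middle_swap ((append_state k \<otimes>\<^sub>L append_state l) \<rho>) = kron \<rho> (kron (matrix_unit k k) (matrix_unit l l))"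
proof -
  have "middle_swap \<circ> (append_state k \<otimes>\<^sub>L append_state l) =
      (\<lambda>\<rho> :: ('x \<times> 'y) op. kron \<rho> (kron (matrix_unit k k) (matrix_unit l l)))"
    by (intro clinear_map_eqI_kron clinear_map_kron clinear_map_comp)
      (auto simp: tensor_map_kron append_state middle_swap_kron)
  then show ?thesis by (simp add: fun_eq_iff)
qed

lemma discard_discard: "(discard \<otimes>\<^sub>L discard) \<circ> middle_swap = discard"
  by (intro clinear_map_eqI_kron_kron clinear_map_comp)
    (auto simp: middle_swap_kron tensor_map_kron discard_kron trace_kron kron_cscale_left
      kron_cscale_right cscale_cscale mult.commute)

section \<open>Bipartite tensor products\<close>

lemma clinear_map_bipartite_tensor [simp]: "clinear_map (U \<otimes>\<^sub>A\<^sub>B V)"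
  unfolding bipartite_tensor_def by (intro clinear_map_comp) auto

lemma bipartite_tensor_comp:
  assumes "clinear_map U" "clinear_map V"
  shows "(U \<otimes>\<^sub>A\<^sub>B id) \<circ> (id \<otimes>\<^sub>A\<^sub>B V) = U \<otimes>\<^sub>A\<^sub>B V"
proof -
  have "(U \<otimes>\<^sub>A\<^sub>B id) \<circ> (id \<otimes>\<^sub>A\<^sub>B V) = middle_swap \<circ> ((U \<otimes>\<^sub>L id) \<circ> (id \<otimes>\<^sub>L V)) \<circ> middle_swap"
    by (simp add: bipartite_tensor_def fun_eq_iff middle_swap_twice)
  then show ?thesis using assms by (simp add: tensor_map_comp bipartite_tensor_def)
qed

text \<open>On an appended product state V acts independently of U and preserves the trace, so its
  output can be discarded. Only operations local to Alice or to Bob occur.\<close>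

lemma bipartite_tensor_restrict:
  assumes "clinear_map U" "V \<in> channels"
  shows "(discard \<otimes>\<^sub>L discard) \<circ> (U \<otimes>\<^sub>A\<^sub>B V) \<circ> (append_state k \<otimes>\<^sub>L append_state l) = U"
  using assms channel_clinear[OF assms(2)]
  by (simp add: fun_eq_iff bipartite_tensor_def append_state_append_state tensor_map_kron
      fun_cong[OF discard_discard, unfolded comp_apply] discard_kron channel_trace trace_kron)

lemma swap_middle_swap:
  fixes \<rho> :: "(('a::finite \<times> 'b::finite) \<times> ('c::finite \<times> 'd::finite)) op"
  shows "(swap_channel \<otimes>\<^sub>L swap_channel) (middle_swap \<rho>) = middle_swap (swap_channel \<rho>)"
proof -
  have "(swap_channel \<otimes>\<^sub>L swap_channel) \<circ> middle_swap = middle_swap \<circ>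
      (swap_channel :: (('a \<times> 'b) \<times> 'c \<times> 'd) op \<Rightarrow> _)"
    by (intro clinear_map_eqI_kron_kron clinear_map_comp)
      (auto simp: middle_swap_kron tensor_map_kron swap_channel_kron)
  then show ?thesis by (simp add: fun_eq_iff)
qed

lemma tensor_map_swap:
  assumes "clinear_map L" "clinear_map M"
  shows "swap_channel ((L \<otimes>\<^sub>L M) (swap_channel \<rho>)) = (M \<otimes>\<^sub>L L) \<rho>"
proof -
  have "swap_channel \<circ> (L \<otimes>\<^sub>L M) \<circ> swap_channel = M \<otimes>\<^sub>L L"
    using assms by (intro clinear_map_eqI_kron clinear_map_comp)
      (auto simp: tensor_map_kron swap_channel_kron)
  then show ?thesis by (simp add: fun_eq_iff)
qed

lemma bipartite_tensor_swap:
  fixes U :: "('a::finite \<times> 'b::finite) op \<Rightarrow> ('c::finite \<times> 'd::finite) op"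
    and V :: "('e::finite \<times> 'f::finite) op \<Rightarrow> ('g::finite \<times> 'h::finite) op"
  assumes "clinear_map U" "clinear_map V"
  shows "V \<otimes>\<^sub>A\<^sub>B U = (swap_channel \<otimes>\<^sub>L swap_channel) \<circ> (U \<otimes>\<^sub>A\<^sub>B V) \<circ> (swap_channel \<otimes>\<^sub>L swap_channel)"
proof
  fix \<rho> :: "(('e \<times> 'a) \<times> ('f \<times> 'b)) op"
  have "middle_swap ((swap_channel \<otimes>\<^sub>L swap_channel) \<rho>) = swap_channel (middle_swap \<rho>)"
    using swap_middle_swap[of "middle_swap \<rho>"] by (metis middle_swap_twice)
  then show "(V \<otimes>\<^sub>A\<^sub>B U) \<rho> = ((swap_channel \<otimes>\<^sub>L swap_channel) \<circ> (U \<otimes>\<^sub>A\<^sub>B V) \<circ>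
      (swap_channel \<otimes>\<^sub>L swap_channel)) \<rho>"
    by (simp add: bipartite_tensor_def swap_middle_swap tensor_map_swap assms)
qed

section \<open>Signalling\<close>

definition signalling_defect ::
  "(('a::finite \<times> 'b::finite) op \<Rightarrow> ('c::finite \<times> 'd::finite) op) \<Rightarrow> ('b op \<Rightarrow> 'd op)
    \<Rightarrow> ('a \<times> 'b) op \<Rightarrow> (unit \<times> 'd) op" where
  "signalling_defect U C =
     (\<lambda>\<rho>. ((trace_channel \<otimes>\<^sub>L id) \<circ> U) \<rho> - (trace_channel \<otimes>\<^sub>L C) \<rho>)"

lemma clinear_map_signalling_defect [simp]: "clinear_map U \<Longrightarrow> clinear_map (signalling_defect U C)"
  unfolding signalling_defect_def by (intro clinear_map_minus clinear_map_comp) auto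

lemma signalling_le:
  "C \<in> channels \<Longrightarrow> signalling U \<le> diamond_norm (signalling_defect U C)"
  unfolding signalling_def signalling_defect_def
  by (rule cINF_lower) (auto intro!: bdd_belowI2[of _ 0] diamond_norm_nonneg)

lemma signalling_geI:
  fixes U :: "('a::finite \<times> 'b::finite) op \<Rightarrow> ('c::finite \<times> 'd::finite) op"
  assumes "\<And>C :: 'b op \<Rightarrow> 'd op. C \<in> channels \<Longrightarrow> c \<le> diamond_norm (signalling_defect U C)"
  shows "c \<le> signalling U"
  using assms unfolding signalling_def signalling_defect_def
  by (intro cINF_greatest channels_nonempty) auto

lemma signalling_nonneg: "signalling U \<ge> 0"
  by (intro signalling_geI diamond_norm_nonneg)

text \<open>Alice's local channels are absorbed by her trace, so a witness C' for U' gives the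
  witness RB C' JB for U, and its defect is the old one between channels.\<close>

lemma signalling_mono_local:
  fixes U :: "('a::finite \<times> 'b::finite) op \<Rightarrow> ('c::finite \<times> 'd::finite) op"
    and U' :: "('e::finite \<times> 'f::finite) op \<Rightarrow> ('g::finite \<times> 'h::finite) op"
  assumes U': "clinear_map U'" and chan: "RA \<in> channels" "RB \<in> channels" "JA \<in> channels" "JB \<in> channels"
    and U: "U = (RA \<otimes>\<^sub>L RB) \<circ> U' \<circ> (JA \<otimes>\<^sub>L JB)"
  shows "signalling U \<le> signalling U'"
proof (rule signalling_geI)
  fix C' :: "'f op \<Rightarrow> 'h op" assume C': "C' \<in> channels"
  let ?C = "RB \<circ> C' \<circ> JB"
  note lin [simp] = chan[THEN channel_clinear] channel_clinear[OF C']
  have "(trace_channel \<otimes>\<^sub>L id) \<circ> (RA \<otimes>\<^sub>L RB) = (id \<otimes>\<^sub>L RB) \<circ> (trace_channel \<otimes>\<^sub>L id)"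
    by (simp add: tensor_map_comp trace_channel_comp chan)
  moreover have "trace_channel \<otimes>\<^sub>L ?C = (id \<otimes>\<^sub>L RB) \<circ> (trace_channel \<otimes>\<^sub>L C') \<circ> (JA \<otimes>\<^sub>L JB)"
    by (simp add: tensor_map_comp clinear_map_comp trace_channel_comp chan)
  ultimately have "signalling_defect U ?C =
      (id \<otimes>\<^sub>L RB) \<circ> signalling_defect U' C' \<circ> (JA \<otimes>\<^sub>L JB)"
    unfolding signalling_defect_def U
    by (simp add: fun_eq_iff clinear_map_diff[OF clinear_map_tensor_map])
  then have "diamond_norm (signalling_defect U ?C) \<le> diamond_norm (signalling_defect U' C')"
    using chan U' by (simp add: diamond_norm_channel_comp channel_tensor id_channel)
  moreover have "?C \<in> channels" using chan C' by (intro channel_comp)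
  ultimately show "signalling U \<le> diamond_norm (signalling_defect U' C')"
    using signalling_le order_trans by blast
qed

lemma signalling_bipartite_tensor_left:
  assumes "U \<in> channels" "V \<in> channels"
  shows "signalling U \<le> signalling (U \<otimes>\<^sub>A\<^sub>B V)"
  by (rule signalling_mono_local[OF _ discard_channel discard_channel append_state_channel
        append_state_channel bipartite_tensor_restrict[symmetric]])
    (use assms channel_clinear in auto)

text \<open>Exchanging the two copies is local to each party and reversible, so monotonicity applies
  in both directions.\<close>

lemma signalling_bipartite_tensor_commute:
  assumes "clinear_map U" "clinear_map V"
  shows "signalling (U \<otimes>\<^sub>A\<^sub>B V) = signalling (V \<otimes>\<^sub>A\<^sub>B U)"
  by (rule antisym;
      rule signalling_mono_local[OF _ permutation_channels(1) permutation_channels(1)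
        permutation_channels(1) permutation_channels(1) bipartite_tensor_swap])
    (use assms in auto)

text \<open>\<open>C \<otimes> id\<close> is a witness for \<open>U \<otimes> id\<close>: up to relabelling, its defect is the defect of \<open>U\<close>
  tensored with a channel.\<close>

lemma signalling_bipartite_tensor_id:
  fixes U :: "('a::finite \<times> 'b::finite) op \<Rightarrow> ('c::finite \<times> 'd::finite) op"
  assumes U: "U \<in> channels"
  shows "signalling (U \<otimes>\<^sub>A\<^sub>B (id :: ('e::finite \<times> 'f::finite) op \<Rightarrow> ('e \<times> 'f) op)) = signalling U"
proof (rule antisym)
  show "signalling U \<le> signalling (U \<otimes>\<^sub>A\<^sub>B (id :: ('e \<times> 'f) op \<Rightarrow> ('e \<times> 'f) op))"
    by (rule signalling_bipartite_tensor_left[OF U id_channel])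
  have "signalling (U \<otimes>\<^sub>A\<^sub>B (id :: ('e \<times> 'f) op \<Rightarrow> ('e \<times> 'f) op)) \<le>
      diamond_norm (signalling_defect U C)"
    if C: "C \<in> channels" for C :: "'b op \<Rightarrow> 'd op"
  proof -
  note lin [simp] = channel_clinear[OF U] channel_clinear[OF C]
  let ?I = "id :: ('e \<times> 'f) op \<Rightarrow> ('e \<times> 'f) op" and ?J = "id :: 'f op \<Rightarrow> 'f op"
  let ?T = "trace_channel \<otimes>\<^sub>L ?J :: ('e \<times> 'f) op \<Rightarrow> (unit \<times> 'f) op"
  \<comment> \<open>Tracing out both of Alice's factors separately leaves two trivial systems,
    tracing out the pair leaves one; this identifies them.\<close>
  let ?collapse = "conj_channel (basis_op (\<lambda>_ :: unit \<times> unit. ()))"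
  let ?R = "(?collapse \<otimes>\<^sub>L (id :: ('d \<times> 'f) op \<Rightarrow> ('d \<times> 'f) op)) \<circ> middle_swap"
  have collapse: "?collapse X = (\<chi> i j. X $ ((), ()) $ ((), ()))" for X
    by (rule conj_channel_basis_op) auto
  have tr: "?collapse (kron (trace_channel A) (trace_channel B)) = trace_channel (kron A B)"
    for A :: "'x::finite op" and B :: "'y::finite op"
    unfolding collapse unfolding trace_channel_def trace_kron by (simp add: kron_def)
  have split: "trace_channel \<otimes>\<^sub>L (F \<otimes>\<^sub>L G) =
      ?R \<circ> ((trace_channel \<otimes>\<^sub>L F) \<otimes>\<^sub>L (trace_channel \<otimes>\<^sub>L G)) \<circ> middle_swap"
    if "clinear_map F" "clinear_map G"
    for F :: "'x::finite op \<Rightarrow> 'd op" and G :: "'y::finite op \<Rightarrow> 'f op"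
    using that by (intro clinear_map_eqI_kron_kron clinear_map_comp)
      (auto simp: tensor_map_kron middle_swap_kron tr)
  have 1: "(trace_channel \<otimes>\<^sub>L id) \<circ> (U \<otimes>\<^sub>A\<^sub>B ?I) =
      ?R \<circ> (((trace_channel \<otimes>\<^sub>L id) \<circ> U) \<otimes>\<^sub>L (trace_channel \<otimes>\<^sub>L id)) \<circ> middle_swap"
  proof -
    have "(trace_channel \<otimes>\<^sub>L id) \<circ> (U \<otimes>\<^sub>A\<^sub>B ?I) =
        ?R \<circ> (((trace_channel \<otimes>\<^sub>L id) \<otimes>\<^sub>L (trace_channel \<otimes>\<^sub>L id)) \<circ> (U \<otimes>\<^sub>L ?I)) \<circ> middle_swap"
    proof
      fix \<rho> :: "(('a \<times> 'e) \<times> ('b \<times> 'f)) op"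
      show "((trace_channel \<otimes>\<^sub>L id) \<circ> (U \<otimes>\<^sub>A\<^sub>B ?I)) \<rho> =
        (?R \<circ> (((trace_channel \<otimes>\<^sub>L id) \<otimes>\<^sub>L (trace_channel \<otimes>\<^sub>L id)) \<circ> (U \<otimes>\<^sub>L ?I)) \<circ> middle_swap) \<rho>"
        using fun_cong[OF split[OF clinear_map_id clinear_map_id],
            of "middle_swap ((U \<otimes>\<^sub>L ?I) (middle_swap \<rho>))"]
        by (simp add: tensor_map_id bipartite_tensor_def middle_swap_twice)
    qed
    then show ?thesis by (simp add: tensor_map_comp)
  qed
  have sub: "(F \<otimes>\<^sub>L H) \<rho> - (G \<otimes>\<^sub>L H) \<rho> = ((\<lambda>\<rho>. F \<rho> - G \<rho>) \<otimes>\<^sub>L H) \<rho>"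
    for F G :: "('a \<times> 'b) op \<Rightarrow> (unit \<times> 'd) op" and H :: "('e \<times> 'f) op \<Rightarrow> (unit \<times> 'f) op" and \<rho>
    by (simp add: tensor_map_def vec_eq_iff sum_subtractf algebra_simps)
  have "signalling_defect (U \<otimes>\<^sub>A\<^sub>B ?I) (C \<otimes>\<^sub>L ?J) =
      ?R \<circ> (signalling_defect U C \<otimes>\<^sub>L ?T) \<circ> middle_swap"
  proof
    fix \<rho> :: "(('a \<times> 'e) \<times> ('b \<times> 'f)) op"
    have R: "clinear_map ?R" by (intro clinear_map_comp) auto
    have "signalling_defect (U \<otimes>\<^sub>A\<^sub>B ?I) (C \<otimes>\<^sub>L ?J) \<rho> =
        ?R ((((trace_channel \<otimes>\<^sub>L id) \<circ> U) \<otimes>\<^sub>L (trace_channel \<otimes>\<^sub>L id)) (middle_swap \<rho>)) -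
        ?R (((trace_channel \<otimes>\<^sub>L C) \<otimes>\<^sub>L (trace_channel \<otimes>\<^sub>L id)) (middle_swap \<rho>))"
      unfolding signalling_defect_def 1 split[OF lin(2) clinear_map_id] by simp
    then show "signalling_defect (U \<otimes>\<^sub>A\<^sub>B ?I) (C \<otimes>\<^sub>L ?J) \<rho> =
        (?R \<circ> (signalling_defect U C \<otimes>\<^sub>L ?T) \<circ> middle_swap) \<rho>"
      unfolding clinear_map_diff[OF R, symmetric] sub signalling_defect_def by simp
  qed
  then have "diamond_norm (signalling_defect (U \<otimes>\<^sub>A\<^sub>B ?I) (C \<otimes>\<^sub>L ?J)) \<le>
      diamond_norm (signalling_defect U C \<otimes>\<^sub>L
        ?T)"
    by (simp only:) (intro diamond_norm_channel_comp clinear_map_tensor_map channel_comp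
        channel_tensor id_channel permutation_channels basis_op_channel, simp add: inj_def)
  also have "\<dots> \<le> diamond_norm (signalling_defect U C)"
    by (intro diamond_norm_tensor_channel clinear_map_signalling_defect channel_tensor
        trace_channel_channel id_channel lin)
  finally show "signalling (U \<otimes>\<^sub>A\<^sub>B ?I) \<le>
      diamond_norm (signalling_defect U C)"
    using signalling_le[OF channel_tensor[OF C id_channel]] by (rule order_trans[rotated])
  qed
  then show "signalling (U \<otimes>\<^sub>A\<^sub>B (id :: ('e \<times> 'f) op \<Rightarrow> ('e \<times> 'f) op)) \<le> signalling U"
    by (rule signalling_geI)
qed

section \<open>The map \<open>T\<close> of a bipartite unitary\<close>

lemma unitary_op_mult:
  assumes "unitary_op U" "unitary_op V"
  shows "unitary_op (U ** V)"
proof -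
  have "dagger V ** dagger U ** (U ** V) = dagger V ** (dagger U ** U) ** V"
    "U ** V ** (dagger V ** dagger U) = U ** (V ** dagger V) ** dagger U"
    by (simp_all add: matrix_mul_assoc)
  then show ?thesis using assms by (simp add: unitary_op_def dagger_mult)
qed

lemma unitary_op_kron: "unitary_op U \<Longrightarrow> unitary_op V \<Longrightarrow> unitary_op (kron U V)"
  by (simp add: unitary_op_def dagger_kron kron_mult kron_mat_1)

lemma unitary_op_basis_op:
  assumes "\<And>x. g (f x) = x" "\<And>y. f (g y) = y"
  shows "unitary_op (basis_op f)"
proof -
  have "f \<circ> g = (\<lambda>x. x)" "g \<circ> f = (\<lambda>x. x)" using assms by auto
  then show ?thesis
    by (simp add: unitary_op_def dagger_basis_op[of g f, OF assms] basis_op_comp basis_op_id)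
qed

lemma unitary_channelE:
  assumes "U \<in> unitary_channels"
  obtains u where "unitary_op u" "U = conj_channel u"
  using assms by (auto simp: unitary_channels_def)

lemma unitary_channels_subset: "U \<in> unitary_channels \<Longrightarrow> U \<in> channels"
  by (auto simp: unitary_channels_def unitary_op_def intro: isometry_channel)

lemma inv_conj_channel: "unitary_op u \<Longrightarrow> inv (conj_channel u) = conj_channel (dagger u)"
  by (intro inv_unique_comp) (simp_all add: conj_channel_comp unitary_op_def)

section \<open>T as conjugation by an explicit matrix\<close>

lemma kron_basis_op: "kron (basis_op f) (basis_op g) = basis_op (map_prod f g)"
  by (auto simp: kron_def basis_op_def vec_eq_iff)

lemma basis_op_mult_right: "(A ** basis_op f) $ i $ j = A $ i $ f j"
  by (simp add: matrix_matrix_mult_def basis_op_def mult_delta_right)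

lemma basis_op_mult_left:
  assumes "\<And>x. g (f x) = x" "\<And>y. f (g y) = y"
  shows "(basis_op f ** A) $ i $ j = A $ g i $ j"
proof -
  have "i = f k \<longleftrightarrow> k = g i" for k using assms by metis
  then show ?thesis by (simp add: matrix_matrix_mult_def basis_op_def mult_delta_left)
qed

lemma id_tensor_conj_channel: "id \<otimes>\<^sub>L conj_channel U = conj_channel (kron (mat 1) U)"
  by (simp flip: tensor_map_conj_channel)

text \<open>The matrix of (1 \<otimes> u)(swap of the two copies of A)(1 \<otimes> u^dagger). The
  swap exchanges the two A labels \<open>fst p\<close> and \<open>fst q\<close> between the factors,
  and only the sum over Bob's input remains of the matrix product.\<close>

definition tmat ::
  "complex^('a::finite \<times> 'b::finite)^('c::finite \<times> 'd::finite) \<Rightarrow> ('a \<times> 'c \<times> 'd) op" where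
  "tmat u = (\<chi> p q. \<Sum>b\<in>UNIV. u $ snd p $ (fst q, b) * cnj (u $ snd q $ (fst p, b)))"

lemma T_map_conj_channel:
  fixes u :: "complex^('a::finite \<times> 'b::finite)^('c::finite \<times> 'd::finite)"
  assumes "unitary_op u"
  shows "T_map (conj_channel u) = conj_channel (tmat u)"
proof -
  let ?f = "\<lambda>(x :: 'a, a :: 'a, b :: 'b). (a, x, b)"
  have "(swap_channel :: ('a \<times> 'a) op \<Rightarrow> _) \<otimes>\<^sub>L (id :: 'b op \<Rightarrow> 'b op) =
      conj_channel (basis_op (map_prod (\<lambda>(x, y). (y, x)) (\<lambda>b. b)))"
    unfolding swap_channel_def conj_channel_mat_1[symmetric] tensor_map_conj_channel
      basis_op_id[symmetric] kron_basis_op ..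
  then have "assoc_right \<circ> (swap_channel \<otimes>\<^sub>L id) \<circ> assoc_left = conj_channel (basis_op ?f)"
    unfolding assoc_right_def assoc_left_def
    by (simp add: conj_channel_comp basis_op_comp)
      (rule arg_cong[of _ _ "\<lambda>f. conj_channel (basis_op f)"], auto)
  then have "T_map (conj_channel u) =
      conj_channel (kron (mat 1) u ** basis_op ?f ** kron (mat 1) (dagger u))"
    unfolding T_map_def inv_conj_channel[OF assms]
    by (simp add: id_tensor_conj_channel conj_channel_comp matrix_mul_assoc)
  moreover have "kron (mat 1) u ** basis_op ?f ** kron (mat 1) (dagger u) = tmat u"
  proof -
    have "(kron (mat 1) u ** basis_op ?f ** kron (mat 1) (dagger u)) $ (a, c, d) $ (a', c', d') =
        tmat u $ (a, c, d) $ (a', c', d')" for a c d a' c' d'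
    proof -
      have "(kron (mat 1) u ** basis_op ?f ** kron (mat 1) (dagger u)) $ (a, c, d) $ (a', c', d') =
        (\<Sum>x\<in>UNIV. \<Sum>y\<in>UNIV. \<Sum>b\<in>UNIV. (kron (mat 1) u ** basis_op ?f) $ (a, c, d) $ (x, y, b) *
          kron (mat 1) (dagger u) $ (x, y, b) $ (a', c', d'))"
        by (simp add: matrix_matrix_mult_def[of "_ ** _"] sum_UNIV_prod)
      also have "\<dots> = (\<Sum>x\<in>UNIV. \<Sum>y\<in>UNIV. \<Sum>b\<in>UNIV. if y = a then if x = a' then
          u $ (c, d) $ (a', b) * cnj (u $ (c', d') $ (a, b)) else 0 else 0)"
        by (intro sum.cong refl) (auto simp: basis_op_mult_right kron_def mat_def dagger_def)
      also have "\<dots> = (\<Sum>x\<in>UNIV. \<Sum>y\<in>UNIV. if y = a then if x = a' then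
          \<Sum>b\<in>UNIV. u $ (c, d) $ (a', b) * cnj (u $ (c', d') $ (a, b)) else 0 else 0)"
        by (intro sum.cong refl) auto
      also have "\<dots> = tmat u $ (a, c, d) $ (a', c', d')"
        by (simp add: tmat_def)
      finally show ?thesis .
    qed
    then show ?thesis by (simp add: vec_eq_iff)
  qed
  ultimately show ?thesis by simp
qed

lemma T_map_channel:
  assumes "U \<in> unitary_channels"
  shows "T_map U \<in> channels"
proof -
  obtain u where u: "unitary_op u" "U = conj_channel u" using assms by (rule unitary_channelE)
  have "U \<in> channels" "inv U \<in> channels"
    unfolding u(2) inv_conj_channel[OF u(1)]
    using u(1) by (auto simp: unitary_op_def intro!: isometry_channel)
  then show ?thesis
    unfolding T_map_def
    by (intro channel_comp channel_tensor id_channel permutation_channels)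
qed

lemma clinear_map_T_map: "U \<in> unitary_channels \<Longrightarrow> clinear_map (T_map U)"
  by (rule channel_clinear[OF T_map_channel])

section \<open>Product gates and the factorisation of T\<close>

definition bkron ::
  "complex^('a::finite \<times> 'b::finite)^('c::finite \<times> 'd::finite) \<Rightarrow>
   complex^('e::finite \<times> 'f::finite)^('g::finite \<times> 'h::finite) \<Rightarrow>
   complex^(('a \<times> 'e) \<times> ('b \<times> 'f))^(('c \<times> 'g) \<times> ('d \<times> 'h))" where
  "bkron u v = basis_op (\<lambda>((x, y), (u, v)). ((x, u), (y, v))) ** kron u v **
     basis_op (\<lambda>((x, y), (u, v)). ((x, u), (y, v)))"

lemma bkron_entry:
  "bkron u v $ ((c, g), (d, h)) $ ((a, e), (b, f)) = u $ (c, d) $ (a, b) * v $ (g, h) $ (e, f)"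
proof -
  let ?m = "\<lambda>((x, y), (u, v)). ((x, u), (y, v))"
  have "bkron u v $ ((c, g), (d, h)) $ ((a, e), (b, f)) =
      (basis_op ?m ** kron u v) $ ((c, g), (d, h)) $ ((a, b), (e, f))"
    by (simp add: bkron_def basis_op_mult_right)
  also have "\<dots> = kron u v $ ((c, d), (g, h)) $ ((a, b), (e, f))"
    by (subst basis_op_mult_left[where g = ?m]) auto
  finally show ?thesis by (simp add: kron_def)
qed

lemma bipartite_tensor_conj_channel:
  "conj_channel u \<otimes>\<^sub>A\<^sub>B conj_channel v = conj_channel (bkron u v)"
  unfolding bipartite_tensor_def middle_swap_def tensor_map_conj_channel conj_channel_comp bkron_def ..

lemma unitary_op_bkron: "unitary_op u \<Longrightarrow> unitary_op v \<Longrightarrow> unitary_op (bkron u v)"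
  unfolding bkron_def
  by (intro unitary_op_mult unitary_op_kron)
    (auto intro!: unitary_op_basis_op[where g = "\<lambda>((x, y), (u, v)). ((x, u), (y, v))"])

lemma bipartite_tensor_unitary:
  "U \<in> unitary_channels \<Longrightarrow> V \<in> unitary_channels \<Longrightarrow> U \<otimes>\<^sub>A\<^sub>B V \<in> unitary_channels"
  unfolding unitary_channels_def using bipartite_tensor_conj_channel unitary_op_bkron by blast

lemma id_unitary: "id \<in> unitary_channels"
proof -
  have "unitary_op (mat 1 :: 'a op)"
    using unitary_op_basis_op[of "\<lambda>x :: 'a. x" "\<lambda>x. x"] by (simp add: basis_op_id)
  then show ?thesis
    unfolding unitary_channels_def by (intro CollectI exI[of _ "mat 1 :: 'a op"]) simp
qed

definition tmerge ::
  "(('a::finite \<times> 'c::finite \<times> 'd::finite) \<times> ('e::finite \<times> 'g::finite \<times> 'h::finite)) op \<Rightarrow>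
   (('a \<times> 'e) \<times> ('c \<times> 'g) \<times> ('d \<times> 'h)) op" where
  "tmerge = conj_channel (basis_op (\<lambda>((a, c, d), (e, g, h)). ((a, e), (c, g), (d, h))))"

definition tsplit ::
  "(('a::finite \<times> 'e::finite) \<times> ('c::finite \<times> 'g::finite) \<times> ('d::finite \<times> 'h::finite)) op \<Rightarrow>
   (('a \<times> 'c \<times> 'd) \<times> ('e \<times> 'g \<times> 'h)) op" where
  "tsplit = conj_channel (basis_op (\<lambda>((a, e), (c, g), (d, h)). ((a, c, d), (e, g, h))))"

lemma tmerge_entry:
  "tmerge A $ ((a, e), (c, g), (d, h)) $ ((a', e'), (c', g'), (d', h')) =
   A $ ((a, c, d), (e, g, h)) $ ((a', c', d'), (e', g', h'))"
  unfolding tmerge_def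
  by (subst conj_channel_basis_op[where g = "\<lambda>((a, e), (c, g), (d, h)). ((a, c, d), (e, g, h))"]) auto

lemma tsplit_entry:
  "tsplit A $ ((a, c, d), (e, g, h)) $ ((a', c', d'), (e', g', h')) =
   A $ ((a, e), (c, g), (d, h)) $ ((a', e'), (c', g'), (d', h'))"
  unfolding tsplit_def
  by (subst conj_channel_basis_op[where g = "\<lambda>((a, c, d), (e, g, h)). ((a, e), (c, g), (d, h))"]) auto

lemma tmerge_tsplit: "tmerge (tsplit A) = A"
  by (simp add: vec_eq_iff tmerge_entry tsplit_entry)

lemma tsplit_tmerge: "tsplit (tmerge A) = A"
  by (simp add: vec_eq_iff tmerge_entry tsplit_entry)

lemma tmerge_kron:
  "tmerge (kron (kron A (kron C D)) (kron E (kron G H))) = kron (kron A E) (kron (kron C G) (kron D H))"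
  by (simp add: vec_eq_iff tmerge_entry kron_def mult_ac)

lemma tsplit_kron:
  "tsplit (kron (kron A E) (kron (kron C G) (kron D H))) = kron (kron A (kron C D)) (kron E (kron G H))"
  by (simp add: vec_eq_iff tsplit_entry kron_def mult_ac)

lemma tmerge_tsplit_channels: "tmerge \<in> channels" "tsplit \<in> channels"
  unfolding tmerge_def tsplit_def by (auto intro!: basis_op_channel injI)

lemma clinear_map_tmerge_tsplit [simp]: "clinear_map tmerge" "clinear_map tsplit"
  by (simp_all add: tmerge_def tsplit_def)

text \<open>The entries of \<open>bkron\<close> are products and the sum in \<open>tmat\<close> runs
  over pairs of inputs of Bob, so it splits into a product of two sums; what remains is
  relabelling.\<close>

lemma T_map_bipartite_tensor:
  assumes "U \<in> unitary_channels" "V \<in> unitary_channels"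
  shows "T_map (U \<otimes>\<^sub>A\<^sub>B V) = tmerge \<circ> (T_map U \<otimes>\<^sub>L T_map V) \<circ> tsplit"
proof -
  obtain u where u: "unitary_op u" "U = conj_channel u" using assms(1) by (rule unitary_channelE)
  obtain v where v: "unitary_op v" "V = conj_channel v" using assms(2) by (rule unitary_channelE)
  let ?m = "\<lambda>((a, c, d), (e, g, h)). ((a, e), (c, g), (d, h))"
  let ?s = "\<lambda>((a, e), (c, g), (d, h)). ((a, c, d), (e, g, h))"
  have "tmat (bkron u v) = basis_op ?m ** kron (tmat u) (tmat v) ** basis_op ?s"
  proof -
    have "tmat (bkron u v) $ ((a, e), (c, g), (d, h)) $ ((a', e'), (c', g'), (d', h')) =
      tmat u $ (a, c, d) $ (a', c', d') * tmat v $ (e, g, h) $ (e', g', h')"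
      for a e c g d h a' e' c' g' d' h'
      by (simp add: tmat_def bkron_entry sum_UNIV_prod sum_product mult_ac)
    moreover have "(basis_op ?m ** kron (tmat u) (tmat v) ** basis_op ?s) $
        ((a, e), (c, g), (d, h)) $ ((a', e'), (c', g'), (d', h')) =
      tmat u $ (a, c, d) $ (a', c', d') * tmat v $ (e, g, h) $ (e', g', h')"
      for a e c g d h a' e' c' g' d' h'
    proof -
      have "(basis_op ?m ** kron (tmat u) (tmat v)) $ ((a, e), (c, g), (d, h)) $ q =
          kron (tmat u) (tmat v) $ ((a, c, d), (e, g, h)) $ q" for q
        by (subst basis_op_mult_left[where g = ?s]) auto
      then show ?thesis by (simp add: basis_op_mult_right) (simp add: kron_def)
    qed
    ultimately show ?thesis by (simp add: vec_eq_iff)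
  qed
  then show ?thesis
    using u(1) v(1)
    by (simp add: u(2) v(2) bipartite_tensor_conj_channel T_map_conj_channel unitary_op_bkron
        tensor_map_conj_channel tmerge_def tsplit_def conj_channel_comp)
qed

lemma T_map_id: "T_map id = assoc_right \<circ> (swap_channel \<otimes>\<^sub>L id) \<circ> assoc_left"
  by (simp add: T_map_def tensor_map_id)

section \<open>Causal influence\<close>

text \<open>Triples are nested to the right, whereas a witness acts jointly on the first two factors
  A and A'; reassociation reconciles the two.\<close>

definition on_first_two ::
  "(('a::finite \<times> 'c::finite) op \<Rightarrow> ('e::finite \<times> 'g::finite) op) \<Rightarrow> ('d::finite op \<Rightarrow> 'h::finite op)
   \<Rightarrow> ('a \<times> 'c \<times> 'd) op \<Rightarrow> ('e \<times> 'g \<times> 'h) op" where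
  "on_first_two L M = assoc_right \<circ> (L \<otimes>\<^sub>L M) \<circ> assoc_left"

lemma on_first_two_channel: "L \<in> channels \<Longrightarrow> M \<in> channels \<Longrightarrow> on_first_two L M \<in> channels"
  unfolding on_first_two_def by (intro channel_comp channel_tensor permutation_channels)

lemma clinear_map_on_first_two [simp]: "clinear_map (on_first_two L M)"
  unfolding on_first_two_def by (intro clinear_map_comp) auto

lemma on_first_two_comp:
  assumes "clinear_map L" "clinear_map M" "clinear_map L'" "clinear_map M'"
  shows "on_first_two L M \<circ> on_first_two L' M' = on_first_two (L \<circ> L') (M \<circ> M')"
proof -
  have "on_first_two L M \<circ> on_first_two L' M' =
      assoc_right \<circ> ((L \<otimes>\<^sub>L M) \<circ> (L' \<otimes>\<^sub>L M')) \<circ> assoc_left"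
    by (simp add: on_first_two_def fun_eq_iff assoc_left_right)
  then show ?thesis using assms by (simp add: tensor_map_comp on_first_two_def)
qed

lemma on_first_two_kron:
  "clinear_map L \<Longrightarrow> clinear_map M \<Longrightarrow>
   on_first_two L M (assoc_right (kron A B)) = assoc_right (kron (L A) (M B))"
  by (simp add: on_first_two_def assoc_left_right tensor_map_kron)

definition causal_defect ::
  "(('a::finite \<times> 'b::finite) op \<Rightarrow> ('c::finite \<times> 'd::finite) op) \<Rightarrow>
   (('a \<times> 'c) op \<Rightarrow> ('a \<times> 'c) op) \<Rightarrow> ('a \<times> 'c \<times> 'd) op \<Rightarrow> ('a \<times> 'c \<times> 'd) op" where
  "causal_defect U C = (\<lambda>\<rho>. T_map U \<rho> - on_first_two C id \<rho>)"

lemma clinear_map_causal_defect: "U \<in> unitary_channels \<Longrightarrow> clinear_map (causal_defect U C)"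
  unfolding causal_defect_def by (intro clinear_map_minus clinear_map_T_map) auto

lemma causal_influence_le:
  "C \<in> channels \<Longrightarrow> causal_influence U \<le> diamond_norm (causal_defect U C)"
  unfolding causal_influence_def causal_defect_def on_first_two_def
  by (rule cINF_lower) (auto intro!: bdd_belowI2[of _ 0] diamond_norm_nonneg)

lemma causal_influence_geI:
  fixes U :: "('a::finite \<times> 'b::finite) op \<Rightarrow> ('c::finite \<times> 'd::finite) op"
  assumes "\<And>C :: ('a \<times> 'c) op \<Rightarrow> ('a \<times> 'c) op. C \<in> channels \<Longrightarrow> c \<le> diamond_norm (causal_defect U C)"
  shows "c \<le> causal_influence U"
  using assms unfolding causal_influence_def causal_defect_def on_first_two_def
  by (intro cINF_greatest channels_nonempty) auto

lemma causal_influence_nonneg: "causal_influence U \<ge> 0"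
  by (intro causal_influence_geI diamond_norm_nonneg)

text \<open>A witness must act as the identity on B'. The processing carries C' \<otimes> id to (R
  C' J) \<otimes> (RD JD), hence the condition that RD undoes JD. As T also contains the inverse
  gate, the relation is required of T rather than of U.\<close>

lemma causal_influence_mono_local:
  fixes U :: "('a::finite \<times> 'b::finite) op \<Rightarrow> ('c::finite \<times> 'd::finite) op"
    and U' :: "('e::finite \<times> 'f::finite) op \<Rightarrow> ('g::finite \<times> 'h::finite) op"
  assumes U': "U' \<in> unitary_channels"
    and chan: "R \<in> channels" "RD \<in> channels" "J \<in> channels" "JD \<in> channels"
    and inv: "RD \<circ> JD = id"
    and T: "T_map U = on_first_two R RD \<circ> T_map U' \<circ> on_first_two J JD"
  shows "causal_influence U \<le> causal_influence U'"
proof (rule causal_influence_geI)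
  fix C' :: "('e \<times> 'g) op \<Rightarrow> ('e \<times> 'g) op" assume C': "C' \<in> channels"
  let ?C = "R \<circ> C' \<circ> J"
  note lin [simp] = chan[THEN channel_clinear] channel_clinear[OF C']
  have "on_first_two ?C id = on_first_two R RD \<circ> on_first_two C' id \<circ> on_first_two J JD"
    by (simp add: on_first_two_comp clinear_map_comp inv)
  then have "causal_defect U ?C = on_first_two R RD \<circ> causal_defect U' C' \<circ> on_first_two J JD"
    unfolding causal_defect_def T
    by (simp add: fun_eq_iff clinear_map_diff[OF clinear_map_on_first_two])
  then have "diamond_norm (causal_defect U ?C) \<le> diamond_norm (causal_defect U' C')"
    using chan U'
    by (simp add: diamond_norm_channel_comp on_first_two_channel clinear_map_causal_defect)
  moreover have "?C \<in> channels" using chan C' by (intro channel_comp)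
  ultimately show "causal_influence U \<le> diamond_norm (causal_defect U' C')"
    using causal_influence_le order_trans by blast
qed

lemma discard_tmerge:
  "on_first_two (discard \<otimes>\<^sub>L discard) discard \<circ> tmerge = discard"
  unfolding on_first_two_def
  by (intro clinear_map_eqI clinear_map_comp)
    (auto simp: matrix_unit_pair tmerge_kron assoc_left_kron tensor_map_kron discard_kron
      assoc_right_kron trace_kron kron_cscale_left kron_cscale_right cscale_cscale
      clinear_map_cscale[OF clinear_map_permutations(3)] mult_ac)

lemma tsplit_append_state:
  "tsplit \<circ> on_first_two (append_state k \<otimes>\<^sub>L append_state l) (append_state m) =
   (\<lambda>\<rho>. kron \<rho> (kron (matrix_unit k k) (kron (matrix_unit l l) (matrix_unit m m))))"
  unfolding on_first_two_def
  by (intro clinear_map_eqI clinear_map_comp clinear_map_kron)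
    (auto simp: matrix_unit_pair assoc_left_kron
      tensor_map_kron append_state assoc_right_kron tsplit_kron)

text \<open>T(V) acts on a fixed appended state and its output has trace 1 when discarded. Any basis
  state serves, and the one appended to B' is itself removed by \<open>discard\<close>, as the
  cancellation condition demands.\<close>

lemma causal_influence_bipartite_tensor_left:
  fixes U :: "('a::finite \<times> 'b::finite) op \<Rightarrow> ('c::finite \<times> 'd::finite) op"
    and V :: "('e::finite \<times> 'f::finite) op \<Rightarrow> ('g::finite \<times> 'h::finite) op"
  assumes U: "U \<in> unitary_channels" and V: "V \<in> unitary_channels"
  shows "causal_influence U \<le> causal_influence (U \<otimes>\<^sub>A\<^sub>B V)"
proof (rule causal_influence_mono_local[where R = "discard \<otimes>\<^sub>L discard" and RD = discard
      and J = "append_state undefined \<otimes>\<^sub>L append_state undefined" and JD = "append_state undefined"])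
  note lin [simp] = clinear_map_T_map[OF U] clinear_map_T_map[OF V]
  show "T_map U = on_first_two (discard \<otimes>\<^sub>L discard) discard \<circ> T_map (U \<otimes>\<^sub>A\<^sub>B V) \<circ>
      on_first_two (append_state undefined \<otimes>\<^sub>L append_state undefined) (append_state undefined)"
    by (simp add: fun_eq_iff T_map_bipartite_tensor[OF U V] tensor_map_kron discard_kron
        fun_cong[OF discard_tmerge, unfolded comp_apply]
        fun_cong[OF tsplit_append_state, unfolded comp_apply]
        channel_trace[OF T_map_channel[OF V]] trace_kron)
qed (use U V in \<open>auto intro!: bipartite_tensor_unitary channel_tensor discard_channel
      append_state_channel discard_append_state\<close>)

lemma swap_tmerge:
  "on_first_two (swap_channel \<otimes>\<^sub>L swap_channel) swap_channel \<circ> tmerge = tmerge \<circ> swap_channel"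
  unfolding on_first_two_def
  by (intro clinear_map_eqI clinear_map_comp)
    (auto simp: matrix_unit_pair tmerge_kron assoc_left_kron tensor_map_kron swap_channel_kron
      assoc_right_kron)

lemma tsplit_swap:
  "tsplit \<circ> on_first_two (swap_channel \<otimes>\<^sub>L swap_channel) swap_channel = swap_channel \<circ> tsplit"
  unfolding on_first_two_def
  by (intro clinear_map_eqI clinear_map_comp)
    (auto simp: matrix_unit_pair tsplit_kron assoc_left_kron tensor_map_kron swap_channel_kron
      assoc_right_kron)

lemma causal_influence_bipartite_tensor_commute_le:
  assumes U: "U \<in> unitary_channels" and V: "V \<in> unitary_channels"
  shows "causal_influence (V \<otimes>\<^sub>A\<^sub>B U) \<le> causal_influence (U \<otimes>\<^sub>A\<^sub>B V)"
proof (rule causal_influence_mono_local[where R = "swap_channel \<otimes>\<^sub>L swap_channel"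
      and RD = swap_channel and J = "swap_channel \<otimes>\<^sub>L swap_channel" and JD = swap_channel])
  show "T_map (V \<otimes>\<^sub>A\<^sub>B U) = on_first_two (swap_channel \<otimes>\<^sub>L swap_channel) swap_channel \<circ>
      T_map (U \<otimes>\<^sub>A\<^sub>B V) \<circ> on_first_two (swap_channel \<otimes>\<^sub>L swap_channel) swap_channel"
    by (simp add: fun_eq_iff T_map_bipartite_tensor[OF U V] T_map_bipartite_tensor[OF V U]
        fun_cong[OF swap_tmerge, unfolded comp_apply] fun_cong[OF tsplit_swap, unfolded comp_apply]
        tensor_map_swap clinear_map_T_map U V)
qed (use U V in \<open>auto intro!: bipartite_tensor_unitary channel_tensor permutation_channels
      simp: fun_eq_iff swap_swap\<close>)

lemma causal_influence_bipartite_tensor_commute: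
  assumes "U \<in> unitary_channels" "V \<in> unitary_channels"
  shows "causal_influence (U \<otimes>\<^sub>A\<^sub>B V) = causal_influence (V \<otimes>\<^sub>A\<^sub>B U)"
  using assms by (intro antisym causal_influence_bipartite_tensor_commute_le)

lemma bipartite_tensor_middle_swap:
  "clinear_map L \<Longrightarrow> clinear_map M \<Longrightarrow>
   (L \<otimes>\<^sub>A\<^sub>B M) (middle_swap (kron A B)) = middle_swap (kron (L A) (M B))"
  by (simp add: bipartite_tensor_def middle_swap_twice tensor_map_kron)

lemma tmerge_assoc_right:
  "tmerge (kron (assoc_right (kron X D)) (assoc_right (kron X' D'))) =
   assoc_right (kron (middle_swap (kron X X')) (kron D D'))"
  by (simp add: vec_eq_iff tmerge_entry assoc_right_entry middle_swap_entry kron_def)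

lemma tsplit_assoc_right:
  "tsplit (assoc_right (kron (middle_swap (kron X X')) (kron D D'))) =
   kron (assoc_right (kron X D)) (assoc_right (kron X' D'))"
  by (simp add: tsplit_tmerge flip: tmerge_assoc_right)

text \<open>L and M each act on a pair of factors as a whole, so the test operators must leave these
  pairs unsplit. The map ?Q brings such operators into the required nesting, and its right inverse
  ?P shows that they reach every operator.\<close>

lemma on_first_two_tensor:
  fixes L :: "('a::finite \<times> 'c::finite) op \<Rightarrow> ('a \<times> 'c) op"
    and M :: "('e::finite \<times> 'g::finite) op \<Rightarrow> ('e \<times> 'g) op"
  assumes L: "clinear_map L" and M: "clinear_map M"
  shows "on_first_two (L \<otimes>\<^sub>A\<^sub>B M) (id :: ('d::finite \<times> 'h::finite) op \<Rightarrow> ('d \<times> 'h) op) =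
    tmerge \<circ> (on_first_two L id \<otimes>\<^sub>L on_first_two M id) \<circ> tsplit"
proof -
  let ?Q = "tmerge \<circ> (assoc_right \<otimes>\<^sub>L assoc_right) ::
      ((('a \<times> 'c) \<times> 'd) \<times> (('e \<times> 'g) \<times> 'h)) op \<Rightarrow> _"
  let ?P = "(assoc_left \<otimes>\<^sub>L assoc_left) \<circ> tsplit"
  let ?F = "on_first_two (L \<otimes>\<^sub>A\<^sub>B M) (id :: ('d \<times> 'h) op \<Rightarrow> ('d \<times> 'h) op)"
  let ?G = "tmerge \<circ> (on_first_two L id \<otimes>\<^sub>L on_first_two M id) \<circ> tsplit"
  have "?F \<circ> ?Q = ?G \<circ> ?Q"
    using L M
    by (intro clinear_map_eqI_kron_kron clinear_map_comp)
      (auto simp: tensor_map_kron tmerge_assoc_right tsplit_assoc_right on_first_two_kron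
        bipartite_tensor_middle_swap)
  moreover have "?Q (?P \<rho>) = \<rho>" for \<rho>
  proof -
    have "(assoc_right \<otimes>\<^sub>L assoc_right) \<circ> (assoc_left \<otimes>\<^sub>L assoc_left) =
        (id :: (('a \<times> 'c \<times> 'd) \<times> ('e \<times> 'g \<times> 'h)) op \<Rightarrow> _)"
      by (intro clinear_map_eqI_kron clinear_map_comp)
        (auto simp: tensor_map_kron assoc_right_left)
    then show ?thesis by (simp add: fun_eq_iff tmerge_tsplit)
  qed
  ultimately have "?F \<rho> = ?G \<rho>" for \<rho>
    by (metis comp_apply)
  then show ?thesis by (rule ext)
qed

text \<open>\<open>T id\<close> acts as the identity on Bob's system, so \<open>C \<otimes> T id\<close> is a witness for \<open>U \<otimes> id\<close>.\<close>

lemma causal_influence_bipartite_tensor_id: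
  fixes U :: "('a::finite \<times> 'b::finite) op \<Rightarrow> ('c::finite \<times> 'd::finite) op"
  assumes U: "U \<in> unitary_channels"
  shows "causal_influence (U \<otimes>\<^sub>A\<^sub>B (id :: ('e::finite \<times> 'f::finite) op \<Rightarrow> ('e \<times> 'f) op)) =
    causal_influence U"
proof (rule antisym)
  let ?I = "id :: ('e \<times> 'f) op \<Rightarrow> ('e \<times> 'f) op"
  have "causal_influence (U \<otimes>\<^sub>A\<^sub>B ?I) \<le> diamond_norm (causal_defect U C)"
    if C: "C \<in> channels" for C :: "('a \<times> 'c) op \<Rightarrow> ('a \<times> 'c) op"
  proof -
    let ?S = "swap_channel :: ('e \<times> 'e) op \<Rightarrow> ('e \<times> 'e) op"
    have T: "T_map ?I = on_first_two ?S id"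
      by (simp add: T_map_id on_first_two_def)
    have sub: "(F \<otimes>\<^sub>L H) \<rho> - (G \<otimes>\<^sub>L H) \<rho> = ((\<lambda>\<rho>. F \<rho> - G \<rho>) \<otimes>\<^sub>L H) \<rho>"
      for F G :: "('a \<times> 'c \<times> 'd) op \<Rightarrow> ('a \<times> 'c \<times> 'd) op"
        and H :: "('e \<times> 'e \<times> 'f) op \<Rightarrow> ('e \<times> 'e \<times> 'f) op" and \<rho>
      by (simp add: tensor_map_def vec_eq_iff sum_subtractf algebra_simps)
    have "causal_defect (U \<otimes>\<^sub>A\<^sub>B ?I) (C \<otimes>\<^sub>A\<^sub>B ?S) =
        tmerge \<circ> (causal_defect U C \<otimes>\<^sub>L T_map ?I) \<circ> tsplit"
      unfolding causal_defect_def T_map_bipartite_tensor[OF U id_unitary]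
        on_first_two_tensor[OF channel_clinear[OF C] clinear_map_permutations(1)] T
      by (simp add: fun_eq_iff sub flip: clinear_map_diff[OF clinear_map_tmerge_tsplit(1)])
    then have "diamond_norm (causal_defect (U \<otimes>\<^sub>A\<^sub>B ?I) (C \<otimes>\<^sub>A\<^sub>B ?S)) \<le>
        diamond_norm (causal_defect U C \<otimes>\<^sub>L T_map ?I)"
      by (simp only:) (intro diamond_norm_channel_comp clinear_map_tensor_map tmerge_tsplit_channels)
    also have "\<dots> \<le> diamond_norm (causal_defect U C)"
      by (intro diamond_norm_tensor_channel clinear_map_causal_defect U T_map_channel id_unitary)
    finally have "diamond_norm (causal_defect (U \<otimes>\<^sub>A\<^sub>B ?I) (C \<otimes>\<^sub>A\<^sub>B ?S)) \<le>
        diamond_norm (causal_defect U C)" .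
    moreover have "C \<otimes>\<^sub>A\<^sub>B ?S \<in> channels"
      unfolding bipartite_tensor_def by (intro channel_comp channel_tensor permutation_channels C)
    ultimately show ?thesis using causal_influence_le order_trans by blast
  qed
  then show "causal_influence (U \<otimes>\<^sub>A\<^sub>B ?I) \<le> causal_influence U"
    by (rule causal_influence_geI)
  show "causal_influence U \<le> causal_influence (U \<otimes>\<^sub>A\<^sub>B ?I)"
    by (rule causal_influence_bipartite_tensor_left[OF U id_unitary])
qed

theorem bipartite_tensor_monotonicity:
  fixes U V :: "('a::finite \<times> 'b::finite) op \<Rightarrow> ('a \<times> 'b) op"
  assumes U: "U \<in> unitary_channels" and V: "V \<in> unitary_channels"
  shows "signalling ((U \<otimes>\<^sub>A\<^sub>B id) \<circ> (id \<otimes>\<^sub>A\<^sub>B V)) = signalling (U \<otimes>\<^sub>A\<^sub>B V)"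
    and "max (signalling U) (signalling V) \<le> signalling (U \<otimes>\<^sub>A\<^sub>B V)"
    and "signalling (U \<otimes>\<^sub>A\<^sub>B (id :: ('a \<times> 'b) op \<Rightarrow> _)) = signalling U"
    and "signalling ((id :: ('a \<times> 'b) op \<Rightarrow> _) \<otimes>\<^sub>A\<^sub>B V) = signalling V"
    and "causal_influence ((U \<otimes>\<^sub>A\<^sub>B id) \<circ> (id \<otimes>\<^sub>A\<^sub>B V)) = causal_influence (U \<otimes>\<^sub>A\<^sub>B V)"
    and "max (causal_influence U) (causal_influence V) \<le> causal_influence (U \<otimes>\<^sub>A\<^sub>B V)"
    and "causal_influence (U \<otimes>\<^sub>A\<^sub>B (id :: ('a \<times> 'b) op \<Rightarrow> _)) = causal_influence U"
    and "causal_influence ((id :: ('a \<times> 'b) op \<Rightarrow> _) \<otimes>\<^sub>A\<^sub>B V) = causal_influence V"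
proof -
  note chan = unitary_channels_subset[OF U] unitary_channels_subset[OF V]
  note lin = chan[THEN channel_clinear]
  show "signalling ((U \<otimes>\<^sub>A\<^sub>B id) \<circ> (id \<otimes>\<^sub>A\<^sub>B V)) = signalling (U \<otimes>\<^sub>A\<^sub>B V)"
    "causal_influence ((U \<otimes>\<^sub>A\<^sub>B id) \<circ> (id \<otimes>\<^sub>A\<^sub>B V)) = causal_influence (U \<otimes>\<^sub>A\<^sub>B V)"
    using lin by (simp_all add: bipartite_tensor_comp)
  show "max (signalling U) (signalling V) \<le> signalling (U \<otimes>\<^sub>A\<^sub>B V)"
    using signalling_bipartite_tensor_left[OF chan]
      signalling_bipartite_tensor_left[OF chan(2,1)]
      signalling_bipartite_tensor_commute[OF lin] by simp
  show "max (causal_influence U) (causal_influence V) \<le> causal_influence (U \<otimes>\<^sub>A\<^sub>B V)"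
    using causal_influence_bipartite_tensor_left[OF U V]
      causal_influence_bipartite_tensor_left[OF V U]
      causal_influence_bipartite_tensor_commute[OF U V] by simp
  show "signalling (U \<otimes>\<^sub>A\<^sub>B (id :: ('a \<times> 'b) op \<Rightarrow> _)) = signalling U"
    by (rule signalling_bipartite_tensor_id[OF chan(1)])
  show "signalling ((id :: ('a \<times> 'b) op \<Rightarrow> _) \<otimes>\<^sub>A\<^sub>B V) = signalling V"
    using signalling_bipartite_tensor_commute[OF clinear_map_id lin(2)]
      signalling_bipartite_tensor_id[OF chan(2)] by metis
  show "causal_influence (U \<otimes>\<^sub>A\<^sub>B (id :: ('a \<times> 'b) op \<Rightarrow> _)) = causal_influence U"
    by (rule causal_influence_bipartite_tensor_id[OF U])
  show "causal_influence ((id :: ('a \<times> 'b) op \<Rightarrow> _) \<otimes>\<^sub>A\<^sub>B V) = causal_influence V"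
    using causal_influence_bipartite_tensor_commute[OF id_unitary V]
      causal_influence_bipartite_tensor_id[OF V] by metis
qed

section \<open>Lower bounds from test operators\<close>

lemma dagger_mat_1: "dagger (mat 1 :: 'x::finite op) = mat 1"
  by (auto simp: dagger_def mat_def vec_eq_iff)

text \<open>For an orthogonal projection Q this is a Hermitian unitary, with value 1 on the range of
  Q and -1 on its complement.\<close>

lemma contraction_reflection:
  assumes "dagger Q = Q" "Q ** Q = Q"
  shows "contraction (2 *\<^sub>R Q - mat 1)"
proof (rule contraction_isometry)
  have "dagger (2 *\<^sub>R Q - mat 1) = 2 *\<^sub>R Q - mat 1"
    using assms(1) dagger_mat_1 by (simp add: dagger_def vec_eq_iff scaleR_2)
  then show "dagger (2 *\<^sub>R Q - mat 1) ** (2 *\<^sub>R Q - mat 1) = mat 1"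
    by (simp add: matrix_mult_diff_left matrix_mult_diff_right matrix_mult_scaleR_left
        matrix_mult_scaleR_right assms(2))
      (simp add: vec_eq_iff, simp add: scaleR_conv_of_real)
qed

text \<open>With Q' = Q a rank-one projection and X of trace 1, the value is 2 - 2 tr(Q X): the
  lower bound is governed by the overlap of the guess X with the true state.\<close>

lemma trace_reflection:
  "Re (trace ((2 *\<^sub>R Q - mat 1) ** (Q' - X))) =
   2 * Re (trace (Q ** Q')) - 2 * Re (trace (Q ** X)) - Re (trace Q') + Re (trace X)"
  by (simp add: matrix_mult_diff_left matrix_mult_diff_right matrix_mult_scaleR_left
      trace_sub trace_scaleR)

lemma psd_kron:
  assumes "psd A" "psd B"
  shows "psd (kron A B)"
proof -
  let ?R = "kron (psd_sqrt A) (psd_sqrt B)"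
  have "dagger ?R ** ?R = kron A B"
    by (simp add: dagger_kron kron_mult psd_sqrt assms psd_hermitian)
  then show ?thesis using psd_dagger_mult by metis
qed

lemma kron_density_ops: "\<rho> \<in> density_ops \<Longrightarrow> \<sigma> \<in> density_ops \<Longrightarrow> kron \<rho> \<sigma> \<in> density_ops"
  by (simp add: density_ops_def psd_kron trace_kron)

lemma matrix_unit_density_ops: "matrix_unit k k \<in> density_ops"
  unfolding matrix_unit_outer by (rule outer_in_density_ops) simp

lemma trace_channel_density_ops: "\<rho> \<in> density_ops \<Longrightarrow> trace_channel \<rho> = mat 1"
  by (simp add: density_ops_def trace_channel_def mat_def vec_eq_iff)

text \<open>If Alice can steer Bob's output, for one fixed input of his, into any of \<open>card S\<close> mutually
  orthogonal pure states, then a fixed guess for it overlaps them by \<open>1 / card S\<close> on average.\<close>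

lemma signalling_ge_orthogonal_outputs:
  fixes U :: "('a::finite \<times> 'b::finite) op \<Rightarrow> ('c::finite \<times> 'd::finite) op" and S :: "'s set"
  assumes U: "clinear_map U" and S: "finite S" "S \<noteq> {}"
    and \<alpha>: "\<And>s. s \<in> S \<Longrightarrow> \<alpha> s \<in> density_ops" and \<beta>: "\<beta> \<in> density_ops"
    and out: "\<And>s. s \<in> S \<Longrightarrow> (trace_channel \<otimes>\<^sub>L id) (U (kron (\<alpha> s) \<beta>)) = kron (mat 1) (Q s)"
    and Q: "\<And>s. s \<in> S \<Longrightarrow> dagger (Q s) = Q s" "\<And>s. s \<in> S \<Longrightarrow> Q s ** Q s = Q s"
      "\<And>s. s \<in> S \<Longrightarrow> trace (Q s) = 1" "(\<Sum>s\<in>S. Q s) = mat 1"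
  shows "2 - 2 / card S \<le> signalling U"
proof (rule signalling_geI)
  fix C :: "'b op \<Rightarrow> 'd op" assume C: "C \<in> channels"
  let ?d = "diamond_norm (signalling_defect U C)"
  have \<tau>: "trace (C \<beta>) = 1" using C \<beta> by (simp add: channel_trace density_ops_def)
  have "2 - 2 * Re (trace (Q s ** C \<beta>)) \<le> ?d" if s: "s \<in> S" for s
  proof -
    let ?P = "kron (mat 1 :: unit op) (Q s)"
    have P: "dagger ?P = ?P" "?P ** ?P = ?P" "trace ?P = 1"
      using Q(1-3)[OF s] by (simp_all add: dagger_kron kron_mult dagger_mat_1 trace_kron trace_I)
    have "signalling_defect U C (kron (\<alpha> s) \<beta>) = ?P - kron (mat 1) (C \<beta>)"
      by (simp add: signalling_defect_def out[OF s] tensor_map_kron channel_clinear[OF C]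
          trace_channel_density_ops[OF \<alpha>[OF s]])
    then have "Re (trace ((2 *\<^sub>R ?P - mat 1) ** (?P - kron (mat 1) (C \<beta>)))) \<le>
        trace_norm (signalling_defect U C (kron (\<alpha> s) \<beta>))"
      using trace_norm_ge[OF contraction_reflection[OF P(1,2)]] by simp
    moreover have "trace (?P ** kron (mat 1) (C \<beta>)) = trace (Q s ** C \<beta>)"
      by (simp add: kron_mult trace_kron trace_I)
    ultimately have "2 - 2 * Re (trace (Q s ** C \<beta>)) \<le>
        trace_norm (signalling_defect U C (kron (\<alpha> s) \<beta>))"
      by (simp add: trace_reflection P(2,3) trace_kron trace_I \<tau> Q(3)[OF s])
    also have "\<dots> \<le> ?d"
      by (intro trace_norm_le_diamond_norm clinear_map_signalling_defect U kron_density_ops \<alpha> s \<beta>)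
    finally show ?thesis .
  qed
  then have "(\<Sum>s\<in>S. 2 - 2 * Re (trace (Q s ** C \<beta>))) \<le> (\<Sum>s\<in>S. ?d)"
    by (rule sum_mono)
  \<comment> \<open>The projections resolve the identity, so the overlaps of any guess with them add
    up to its trace.\<close>
  moreover have "(\<Sum>s\<in>S. Re (trace (Q s ** C \<beta>))) = 1"
    using \<tau> by (simp flip: Re_sum trace_sum matrix_mult_sum_left add: Q(4))
  then have "(\<Sum>s\<in>S. 2 - 2 * Re (trace (Q s ** C \<beta>))) = 2 * real (card S) - 2"
    by (simp add: sum_subtractf flip: sum_distrib_left)
  ultimately have "2 * real (card S) - 2 \<le> card S * ?d" by simp
  then show "2 - 2 / card S \<le> ?d"
    using S by (simp add: field_simps card_gt_0_iff)
qed

section \<open>Qubits\<close>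

text \<open>The case rules for this type name its elements 1 and 2; identifying 2 with 0 turns them
  into bits.\<close>

lemma two_eq_zero: "(2 :: 2) = 0"
  using exhaust_2[of 0] by auto

lemma add_self_2 [simp]: "x + x = (0 :: 2)"
  using two_eq_zero by (metis mult_2 mult_zero_left)

lemma add_add_2 [simp]: "x + y + y = (x :: 2)"
  by (simp add: add.assoc)

lemma all_2: "(\<forall>x :: 2. P x) \<longleftrightarrow> P 0 \<and> P 1"
  using forall_2[of P] by (auto simp: two_eq_zero)

lemma sum_2_0: "sum f (UNIV :: 2 set) = f 0 + f 1"
  using sum_2[of f] by (simp add: two_eq_zero add.commute)

text \<open>The character (-1)^(s i) of the two-element group, that is, row s of the unnormalised
  Hadamard matrix.\<close>

definition sgn2 :: "2 \<Rightarrow> 2 \<Rightarrow> complex" where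
  "sgn2 s i = (if s = 0 \<or> i = 0 then 1 else - 1)"

text \<open>The projection onto |+> for s = 0 and onto |-> for s = 1.\<close>

definition hadamard_state :: "2 \<Rightarrow> 2 op" where
  "hadamard_state s = (\<chi> i j. sgn2 s i * sgn2 s j / 2)"

definition Z_op :: "2 op" where "Z_op = (\<chi> i j. if i = j then sgn2 1 i else 0)"

definition X_op :: "2 op" where "X_op = basis_op (\<lambda>i. i + 1)"

lemma hadamard_state_hermitian: "dagger (hadamard_state s) = hadamard_state s"
  by (simp add: hadamard_state_def dagger_def vec_eq_iff sgn2_def)

lemma hadamard_state_idempotent: "hadamard_state s ** hadamard_state s = hadamard_state s"
  by (simp add: hadamard_state_def matrix_matrix_mult_def vec_eq_iff sgn2_def sum_2_0)

lemma trace_hadamard_state: "trace (hadamard_state s) = 1"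
  by (simp add: hadamard_state_def trace_def sgn2_def sum_2_0)

lemma sum_hadamard_state: "(\<Sum>s\<in>UNIV. hadamard_state s) = mat 1"
  by (simp add: hadamard_state_def vec_eq_iff sgn2_def sum_2_0 all_2 mat_def)

lemma hadamard_state_density_ops: "hadamard_state s \<in> density_ops"
  unfolding density_ops_def
  using psd_dagger_mult[of "hadamard_state s"]
  by (simp add: hadamard_state_hermitian hadamard_state_idempotent trace_hadamard_state)

lemma cnot_channel_entry: "cnot_channel A $ (a, b) $ (a', b') = A $ (a + b, b) $ (a' + b', b')"
  unfolding cnot_channel_def CNOT_def
  by (subst conj_channel_basis_op[where g = "\<lambda>(a, b). (a + b, b)"]) auto

text \<open>Characters are multiplicative, so shifting the target by the control bit b only produces
  the phase \<open>sgn2 s b\<close>, which passes to the control.\<close>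

lemma cnot_phase_kickback:
  "cnot_channel (kron (hadamard_state s) (hadamard_state 0)) =
   kron (hadamard_state s) (hadamard_state s)"
proof -
  have "sgn2 s (a + b) = sgn2 s a * sgn2 s b" for a b
    using spec[of _ a] spec[of _ b] by (simp add: sgn2_def split: if_splits)
      (metis add_0 add_self_2 exhaust_2 two_eq_zero add.commute)
  then show ?thesis
    by (simp add: vec_eq_iff cnot_channel_entry kron_def hadamard_state_def sgn2_def[of 0])
qed

lemma cnot_unitary: "cnot_channel \<in> unitary_channels"
  unfolding cnot_channel_def CNOT_def unitary_channels_def
  by (auto intro!: unitary_op_basis_op[where g = "\<lambda>(a, b). (a + b, b)"])

lemma swap_unitary: "(swap_channel :: ('x::finite \<times> 'y::finite) op \<Rightarrow> _) \<in> unitary_channels"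
  unfolding swap_channel_def unitary_channels_def
  by (auto intro!: unitary_op_basis_op[where g = "\<lambda>(a, b). (b, a)"])

lemma signalling_cnot_ge: "1 \<le> signalling cnot_channel"
proof -
  have "2 - 2 / card (UNIV :: 2 set) \<le> signalling cnot_channel"
    by (rule signalling_ge_orthogonal_outputs[where \<alpha> = hadamard_state and \<beta> = "hadamard_state 0"
          and Q = hadamard_state])
      (simp_all add: channel_clinear unitary_channels_subset cnot_unitary
        hadamard_state_density_ops cnot_phase_kickback tensor_map_kron
        trace_channel_density_ops hadamard_state_hermitian hadamard_state_idempotent
        trace_hadamard_state sum_hadamard_state)
  then show ?thesis by simp
qed

lemma signalling_cnot_cnot_ge: "3 / 2 \<le> signalling (cnot_channel \<otimes>\<^sub>A\<^sub>B cnot_channel)"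
proof -
  let ?Q = "\<lambda>p. kron (hadamard_state (fst p)) (hadamard_state (snd p))"
  have lin: "clinear_map cnot_channel"
    by (intro channel_clinear unitary_channels_subset cnot_unitary)
  have "2 - 2 / card (UNIV :: (2 \<times> 2) set) \<le> signalling (cnot_channel \<otimes>\<^sub>A\<^sub>B cnot_channel)"
    by (rule signalling_ge_orthogonal_outputs[where \<alpha> = ?Q and \<beta> = "?Q (0, 0)" and Q = ?Q])
      (simp_all add: kron_density_ops hadamard_state_density_ops bipartite_tensor_def
        middle_swap_kron lin tensor_map_kron cnot_phase_kickback
        trace_channel_density_ops dagger_kron kron_mult hadamard_state_hermitian
        hadamard_state_idempotent trace_kron trace_hadamard_state kron_sum_sum sum_hadamard_state
        kron_mat_1, intro clinear_map_comp, auto)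
  then show ?thesis by (simp add: card_prod)
qed

section \<open>Pauli conjugations and the upper bound for CNOT\<close>

lemma X_channel: "conj_channel X_op \<in> channels"
  unfolding X_op_def by (rule basis_op_channel) (simp add: inj_def)

lemma Z_isometry: "dagger Z_op ** Z_op = mat 1"
  by (simp add: Z_op_def dagger_def vec_eq_iff matrix_matrix_mult_def sum_2_0 all_2 mat_def sgn2_def)

lemma Z_channel: "conj_channel Z_op \<in> channels"
  by (rule isometry_channel[OF Z_isometry])

lemma X_channel_entry: "conj_channel X_op A $ i $ j = A $ (i + 1) $ (j + 1)"
  unfolding X_op_def by (subst conj_channel_basis_op[where g = "\<lambda>i. i + 1"]) auto

lemma Z_channel_entry: "conj_channel Z_op A $ i $ j = sgn2 1 i * sgn2 1 j * A $ i $ j"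
proof -
  have "\<forall>i j. conj_channel Z_op A $ i $ j = sgn2 1 i * sgn2 1 j * A $ i $ j"
    by (simp add: conj_channel_def Z_op_def dagger_def matrix_matrix_mult_def sum_2_0 all_2 sgn2_def)
  then show ?thesis by simp
qed

lemma tensor_map_combination:
  "(L \<otimes>\<^sub>L (\<lambda>\<rho>. r *\<^sub>R M \<rho> + t *\<^sub>R N \<rho>)) \<rho> = r *\<^sub>R (L \<otimes>\<^sub>L M) \<rho> + t *\<^sub>R (L \<otimes>\<^sub>L N) \<rho>"
  unfolding tensor_map_def vec_eq_iff vec_lambda_beta vector_add_component vector_scaleR_component
  by (simp only: scaleR_conv_of_real sum_distrib_left sum.distrib[symmetric]) (simp add: algebra_simps)

lemma trace_tensor_id_entry:
  fixes \<rho> :: "('a::finite \<times> 'b::finite) op"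
  shows "(trace_channel \<otimes>\<^sub>L id) \<rho> $ p $ q = (\<Sum>a\<in>UNIV. \<rho> $ (a, snd p) $ (a, snd q))"
proof -
  have "trace_channel \<otimes>\<^sub>L id = (\<lambda>\<rho> :: ('a \<times> 'b) op. \<chi> p q. \<Sum>a\<in>UNIV. \<rho> $ (a, snd p) $ (a, snd q))"
  proof (rule clinear_map_eqI_kron)
    show "clinear_map (\<lambda>\<rho> :: ('a \<times> 'b) op. \<chi> p q. \<Sum>a\<in>UNIV. \<rho> $ (a, snd p) $ (a, snd q))"
      by (simp add: clinear_map_def cscale_def vec_eq_iff sum.distrib sum_distrib_left)
  qed (simp_all add: tensor_map_kron, simp add: kron_def trace_channel_def trace_def vec_eq_iff
      sum_distrib_right)
  then show ?thesis by simp
qed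

text \<open>The optimal guess for Bob's channel is the dephasing channel, the average of the two
  channels that Alice can select.\<close>

lemma signalling_cnot_le: "signalling cnot_channel \<le> 1"
proof -
  let ?Z = "conj_channel Z_op"
  let ?C = "\<lambda>\<rho>. (1/2) *\<^sub>R id \<rho> + (1 - 1/2) *\<^sub>R ?Z \<rho>"
  let ?F = "(trace_channel \<otimes>\<^sub>L id) \<circ> cnot_channel"
    and ?G = "(trace_channel \<otimes>\<^sub>L ?Z) \<circ> cnot_channel"
  have C: "?C \<in> channels" by (rule channel_convex[OF id_channel Z_channel]) auto
  have Z: "(trace_channel \<otimes>\<^sub>L ?Z) \<rho> $ p $ q = sgn2 1 (snd p) * sgn2 1 (snd q) *
      (\<Sum>a\<in>UNIV. \<rho> $ (a, snd p) $ (a, snd q))" for \<rho> :: "('a::finite \<times> 2) op" and p q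
  proof -
    have "trace_channel \<otimes>\<^sub>L ?Z = (\<lambda>\<rho> :: ('a \<times> 2) op. \<chi> p q. sgn2 1 (snd p) * sgn2 1 (snd q) *
        (\<Sum>a\<in>UNIV. \<rho> $ (a, snd p) $ (a, snd q)))"
    proof (rule clinear_map_eqI_kron)
      show "clinear_map (\<lambda>\<rho> :: ('a \<times> 2) op. \<chi> p q. sgn2 1 (snd p) * sgn2 1 (snd q) *
          (\<Sum>a\<in>UNIV. \<rho> $ (a, snd p) $ (a, snd q)))"
        by (simp add: clinear_map_def cscale_def vec_eq_iff sum.distrib sum_distrib_left algebra_simps)
    qed (simp_all add: tensor_map_kron, simp add: kron_def trace_channel_def trace_def vec_eq_iff
        Z_channel_entry sum_distrib_right sum_distrib_left mult_ac)
    then show ?thesis by simp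
  qed
  have "(trace_channel \<otimes>\<^sub>L ?C) = (\<lambda>\<rho> :: (2 \<times> 2) op. (1/2) *\<^sub>R (trace_channel \<otimes>\<^sub>L id) \<rho> +
      (1 - 1/2) *\<^sub>R (trace_channel \<otimes>\<^sub>L ?Z) \<rho>)"
    by (simp add: fun_eq_iff tensor_map_combination id_def)
  \<comment> \<open>?G is ?F followed by Z on Bob's qubit, so (?F + ?G)/2 is the dephased output.
    CNOT leaves the diagonal of Bob's reduced state unchanged, hence this average is exactly the
    witness term, and half a difference of channels remains.\<close>
  then have "signalling_defect cnot_channel ?C = (\<lambda>\<rho>. (1/2) *\<^sub>R (?F \<rho> - ?G \<rho>))"
    by (simp add: signalling_defect_def fun_eq_iff vec_eq_iff trace_tensor_id_entry Z
        cnot_channel_entry all_2 sum_2_0 sgn2_def)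
      (simp add: scaleR_conv_of_real algebra_simps)
  moreover have "diamond_norm (\<lambda>\<rho>. (1/2) *\<^sub>R (?F \<rho> - ?G \<rho>)) \<le> 2 * (1/2)"
    by (intro diamond_norm_channel_diff channel_comp channel_tensor trace_channel_channel
        id_channel Z_channel unitary_channels_subset cnot_unitary) auto
  ultimately show ?thesis using signalling_le[OF C, of cnot_channel] by simp
qed

section \<open>The SWAP gate\<close>

text \<open>The projection onto (|00> + |11>)/sqrt 2.\<close>

definition max_entangled :: "(2 \<times> 2) op" where
  "max_entangled = (\<chi> p q. if fst p = snd p \<and> fst q = snd q then 1 / 2 else 0)"

lemma max_entangled_hermitian: "dagger max_entangled = max_entangled"
  by (simp add: max_entangled_def dagger_def vec_eq_iff)

lemma max_entangled_idempotent: "max_entangled ** max_entangled = max_entangled"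
  by (simp add: max_entangled_def matrix_matrix_mult_def vec_eq_iff sum_UNIV_prod sum_2_0 all_2)

lemma trace_max_entangled: "trace max_entangled = 1"
  by (simp add: max_entangled_def trace_def sum_UNIV_prod sum_2_0)

lemma max_entangled_density_ops: "max_entangled \<in> density_ops"
  unfolding density_ops_def
  using psd_dagger_mult[of max_entangled]
  by (simp add: max_entangled_hermitian max_entangled_idempotent trace_max_entangled)

lemma discard_entry:
  fixes A :: "('x::finite \<times> 'y::finite) op"
  shows "discard A $ i $ j = (\<Sum>k\<in>UNIV. A $ (i, k) $ (j, k))"
proof -
  have "discard = (\<lambda>A :: ('x \<times> 'y) op. \<chi> i j. \<Sum>k\<in>UNIV. A $ (i, k) $ (j, k))"
  proof (rule clinear_map_eqI_kron)
    show "clinear_map (\<lambda>A :: ('x \<times> 'y) op. \<chi> i j. \<Sum>k\<in>UNIV. A $ (i, k) $ (j, k))"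
      by (simp add: clinear_map_def cscale_def vec_eq_iff sum.distrib sum_distrib_left)
  qed (simp_all add: discard_kron, simp add: kron_def cscale_def trace_def vec_eq_iff
      sum_distrib_right sum_distrib_left mult.commute)
  from fun_cong[OF this, of A] show ?thesis by simp
qed

lemma discard_max_entangled: "discard max_entangled = (1/2) *\<^sub>R mat 1"
  by (simp add: vec_eq_iff discard_entry max_entangled_def sum_2_0 all_2 mat_def)
    (simp add: scaleR_conv_of_real)

text \<open>SWAP hands Bob the partner of the reference qubit, still maximally entangled with it. A
  guess sees only Bob's fixed input and leaves the reference maximally mixed; the resulting product
  state has overlap 1/4 with the entangled one, whence 2 - 2/4.\<close>

lemma signalling_swap_ge: "3 / 2 \<le> signalling qubit_swap"
proof (rule signalling_geI)
  fix C :: "2 op \<Rightarrow> 2 op" assume C: "C \<in> channels"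
  note lin [simp] = channel_clinear[OF C]
  let ?D = "signalling_defect qubit_swap C" and ?B = "matrix_unit 0 0 :: 2 op"
  let ?unit = "conj_channel (basis_op (snd :: unit \<times> 2 \<Rightarrow> 2))"
  let ?I = "id :: 2 op \<Rightarrow> 2 op"
  have unit: "?unit (kron A X) = cscale (trace A) X" for A X
    by (subst conj_channel_basis_op[where g = "\<lambda>x. ((), x)"])
      (auto simp: kron_def vec_eq_iff cscale_def trace_def UNIV_unit)
  have tr1: "trace (trace_channel A) = trace A" for A :: "2 op"
    by (rule channel_trace[OF trace_channel_channel])
  have unit_channel: "?I \<otimes>\<^sub>L ?unit \<in> channels"
    by (intro channel_tensor id_channel basis_op_channel) (auto intro!: injI)
  let ?\<rho> = "assoc_right (kron max_entangled ?B)"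
  have D: "clinear_map ?D" by simp
  have Dk: "?D (kron A B) = kron (trace_channel B) A - kron (trace_channel A) (C B)" for A B
    by (simp add: signalling_defect_def swap_channel_kron tensor_map_kron)
  \<comment> \<open>Both sides are linear in the joint state of reference and Alice, so the value at
    the entangled state follows from that at product operators.\<close>
  have "(?I \<otimes>\<^sub>L ?unit) \<circ> (?I \<otimes>\<^sub>L ?D) \<circ> assoc_right \<circ> (\<lambda>X. kron X ?B) =
      (\<lambda>X. id X - ((\<lambda>Y. kron Y (C ?B)) \<circ> discard) X)"
  proof (intro clinear_map_eqI_kron clinear_map_comp clinear_map_minus)
    fix A E :: "2 op"
    show "((?I \<otimes>\<^sub>L ?unit) \<circ> (?I \<otimes>\<^sub>L ?D) \<circ> assoc_right \<circ> (\<lambda>X. kron X ?B)) (kron E A) =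
      id (kron E A) - ((\<lambda>Y. kron Y (C ?B)) \<circ> discard) (kron E A)"
      by (simp add: assoc_right_kron tensor_map_kron Dk kron_diff_right
          clinear_map_diff[OF clinear_map_tensor_map] unit tr1 discard_kron kron_cscale_left
          kron_cscale_right)
  qed (auto simp: clinear_map_kron clinear_map_id[unfolded id_def])
  then have Y: "(?I \<otimes>\<^sub>L ?unit) ((?I \<otimes>\<^sub>L ?D) ?\<rho>) =
      max_entangled - (1/2) *\<^sub>R kron (mat 1) (C ?B)"
    by (simp add: fun_eq_iff discard_max_entangled kron_scaleR_left)
  have \<tau>: "trace (C ?B) = 1" using C by (simp add: channel_trace)
  have overlap: "trace (max_entangled ** kron (mat 1) (C ?B)) = 1 / 2"
  proof -
    have "trace (max_entangled ** kron (mat 1) (C ?B)) = trace (C ?B) / 2"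
      by (simp add: trace_def matrix_matrix_mult_def max_entangled_def kron_def mat_def
          sum_UNIV_prod sum_2_0)
    then show ?thesis using \<tau> by simp
  qed
  have "Re (trace ((2 *\<^sub>R max_entangled - mat 1) ** (max_entangled - (1/2) *\<^sub>R kron (mat 1) (C ?B)))) = 3 / 2"
    by (simp add: trace_reflection max_entangled_idempotent trace_max_entangled
        matrix_mult_scaleR_right trace_scaleR overlap trace_kron trace_I \<tau>)
  then have "3 / 2 \<le> trace_norm ((?I \<otimes>\<^sub>L ?unit) ((?I \<otimes>\<^sub>L ?D) ?\<rho>))"
    unfolding Y
    using trace_norm_ge[OF contraction_reflection[OF max_entangled_hermitian
          max_entangled_idempotent]] by metis
  also have "\<dots> \<le> trace_norm ((?I \<otimes>\<^sub>L ?D) ?\<rho>)"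
    by (rule channel_trace_norm[OF unit_channel])
  also have "\<dots> \<le> diamond_norm ?D"
    by (rule diamond_norm_ancilla[OF D channel_density_ops[OF permutation_channels(3)
          kron_density_ops[OF max_entangled_density_ops matrix_unit_density_ops]]])
  finally show "3 / 2 \<le> diamond_norm ?D" .
qed

text \<open>The completely depolarizing channel is \<open>1/4 id + 3/4 N\<close> with \<open>N\<close> the average of the
  conjugations by the three Pauli operators, so its distance from \<open>id\<close> is \<open>3/4\<close> of that of \<open>N\<close>.\<close>

lemma signalling_swap_le: "signalling qubit_swap \<le> 3 / 2"
proof -
  let ?X = "conj_channel X_op" and ?Z = "conj_channel Z_op"
  \<comment> \<open>The nested weights 1/3 and (2/3)(1/2) give each Pauli conjugation weight 1/3;
    the product of X and Z is the third Pauli operator up to a phase.\<close>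
  define N where "N = (\<lambda>\<rho>. (1/3) *\<^sub>R ?X \<rho> + (1 - 1/3) *\<^sub>R
      ((\<lambda>\<rho>. (1/2) *\<^sub>R ?Z \<rho> + (1 - 1/2) *\<^sub>R (?X \<circ> ?Z) \<rho>) \<rho>))"
  have N: "N \<in> channels"
    unfolding N_def by (intro channel_convex channel_comp X_channel Z_channel) auto
  let ?C = "\<lambda>\<rho>. (1/4) *\<^sub>R id \<rho> + (1 - 1/4) *\<^sub>R N \<rho>"
  have C: "?C \<in> channels" by (intro channel_convex id_channel N) auto
  let ?F = "(trace_channel \<otimes>\<^sub>L id) \<circ> qubit_swap" and ?G = "(trace_channel \<otimes>\<^sub>L N) \<circ> qubit_swap"
  have depol: "?C A = cscale (trace A / 2) (mat 1)" for A
    by (simp add: vec_eq_iff all_2 N_def X_channel_entry Z_channel_entry sgn2_def cscale_def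
        mat_def trace_def sum_2_0)
      (simp add: scaleR_conv_of_real field_simps)
  \<comment> \<open>The depolarizing output depends on the total trace alone, so it does not matter
    whose qubit is fed in. Inserting the swap exhibits the witness term as a mixture of ?F, with
    weight 1/4, and ?G.\<close>
  have "(trace_channel \<otimes>\<^sub>L ?C) \<circ> qubit_swap = trace_channel \<otimes>\<^sub>L ?C"
  proof (intro clinear_map_eqI_kron clinear_map_comp)
    fix A B :: "2 op"
    show "((trace_channel \<otimes>\<^sub>L ?C) \<circ> qubit_swap) (kron A B) = (trace_channel \<otimes>\<^sub>L ?C) (kron A B)"
      using channel_clinear[OF C] unfolding depol
      by (simp add: swap_channel_kron tensor_map_kron)
        (simp add: kron_def trace_channel_def cscale_def vec_eq_iff)
  qed auto
  then have "(trace_channel \<otimes>\<^sub>L ?C) \<rho> = (1/4) *\<^sub>R ?F \<rho> + (1 - 1/4) *\<^sub>R ?G \<rho>" for \<rho>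
    using tensor_map_combination[of trace_channel "1/4" id "1 - 1/4" N "qubit_swap \<rho>"]
    by (simp only: fun_eq_iff comp_apply)
  then have "signalling_defect qubit_swap ?C = (\<lambda>\<rho>. (3/4) *\<^sub>R (?F \<rho> - ?G \<rho>))"
    by (simp only: signalling_defect_def) (simp add: fun_eq_iff algebra_simps
        flip: scaleR_left.diff scaleR_left.add)
  moreover have "diamond_norm (\<lambda>\<rho>. (3/4) *\<^sub>R (?F \<rho> - ?G \<rho>)) \<le> 2 * (3/4)"
    by (intro diamond_norm_channel_diff channel_comp channel_tensor trace_channel_channel
        id_channel N permutation_channels) auto
  ultimately show ?thesis using signalling_le[OF C, of qubit_swap] by simp
qed

text \<open>The inverse gate carries B' back to Alice's input, where it is exchanged with the other
  copy of A; A' goes to Bob's input and returns untouched.\<close>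

lemma T_map_swap:
  "T_map (swap_channel :: ('a::finite \<times> 'b::finite) op \<Rightarrow> _) (kron A (kron C D)) = kron D (kron C A)"
proof -
  let ?u = "basis_op (\<lambda>(x :: 'a, y :: 'b). (y, x))"
  have "unitary_op ?u" by (rule unitary_op_basis_op[where g = "\<lambda>(y, x). (x, y)"]) auto
  moreover have "tmat ?u = basis_op (\<lambda>(a, c, d). (d, c, a))"
  proof -
    have "tmat ?u $ (a, c, d) $ (a', c', d') =
        basis_op (\<lambda>(a, c, d). (d, c, a)) $ (a, c, d) $ (a', c', d')" for a c d a' c' d'
    proof -
      have "tmat ?u $ (a, c, d) $ (a', c', d') =
          (\<Sum>b\<in>UNIV. if b = c then if a = d' \<and> c = c' \<and> d = a' then 1 else 0 else 0)"
        unfolding tmat_def basis_op_def vec_lambda_beta by (intro sum.cong) auto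
      then show ?thesis by (simp add: basis_op_def)
    qed
    then show ?thesis by (simp add: vec_eq_iff)
  qed
  ultimately have "T_map (swap_channel :: ('a \<times> 'b) op \<Rightarrow> _) =
      conj_channel (basis_op (\<lambda>(a, c, d). (d, c, a)))"
    unfolding swap_channel_def by (simp add: T_map_conj_channel)
  then have "T_map (swap_channel :: ('a \<times> 'b) op \<Rightarrow> _) X $ (d, c, a) $ (d', c', a') = X $ (a, c, d) $ (a', c', d')"
    for X a c d a' c' d'
    by (simp only:) (subst conj_channel_basis_op[where g = "\<lambda>(d, c, a). (a, c, d)"], auto)
  then show ?thesis by (simp add: vec_eq_iff kron_def mult_ac)
qed

lemma causal_influence_swap: "causal_influence qubit_swap = 2"
proof (rule antisym)
  \<comment> \<open>Any channel would serve as witness here, since two channels are never further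
    apart than 2.\<close>
  have "causal_defect qubit_swap id =
      (\<lambda>\<rho>. 1 *\<^sub>R (T_map qubit_swap \<rho> - on_first_two id id \<rho>))"
    by (simp add: causal_defect_def)
  moreover have "diamond_norm (\<lambda>\<rho>. 1 *\<^sub>R (T_map qubit_swap \<rho> - on_first_two id id \<rho>)) \<le> 2 * 1"
    by (rule diamond_norm_channel_diff)
      (auto intro!: T_map_channel swap_unitary on_first_two_channel id_channel)
  ultimately show "causal_influence qubit_swap \<le> 2"
    using causal_influence_le[OF id_channel, of qubit_swap] by simp
  show "2 \<le> causal_influence qubit_swap"
  proof (rule causal_influence_geI)
    fix C :: "(2 \<times> 2) op \<Rightarrow> (2 \<times> 2) op" assume C: "C \<in> channels"
    let ?E = "matrix_unit :: 2 \<Rightarrow> 2 \<Rightarrow> 2 op"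
    \<comment> \<open>The copy of A holds 0 and B' holds 1. T moves the 0 into B', whereas any C
      \<otimes> id leaves the 1 there; ?R keeps only B'.\<close>
    let ?\<sigma> = "kron (?E 0 0) (kron (?E 0 0) (?E 1 1))"
    let ?R = "discard \<circ> swap_channel \<circ> (assoc_left :: (2 \<times> 2 \<times> 2) op \<Rightarrow> _)"
    have R: "?R \<in> channels" by (intro channel_comp discard_channel permutation_channels)
    have "on_first_two C id ?\<sigma> = assoc_right (kron (C (kron (?E 0 0) (?E 0 0))) (?E 1 1))"
      by (simp add: on_first_two_def assoc_left_kron tensor_map_kron channel_clinear[OF C])
    then have "?R (causal_defect qubit_swap C ?\<sigma>) = ?E 0 0 - ?E 1 1"
      unfolding causal_defect_def clinear_map_diff[OF channel_clinear[OF R]]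
      by (simp add: T_map_swap assoc_left_kron assoc_left_right swap_channel_kron discard_kron
          trace_kron channel_trace[OF C])
    then have "trace_norm (?E 0 0 - ?E 1 1) \<le> trace_norm (causal_defect qubit_swap C ?\<sigma>)"
      using channel_trace_norm[OF R] by metis
    also have "\<dots> \<le> diamond_norm (causal_defect qubit_swap C)"
      by (intro trace_norm_le_diamond_norm clinear_map_causal_defect swap_unitary
          kron_density_ops matrix_unit_density_ops)
    finally have "trace_norm (?E 0 0 - ?E 1 1) \<le> diamond_norm (causal_defect qubit_swap C)" .
    moreover have "Re (trace (Z_op ** (?E 0 0 - ?E 1 1))) = 2"
      by (simp add: trace_def matrix_matrix_mult_def Z_op_def matrix_unit_def sgn2_def sum_2_0)
    ultimately show "2 \<le> diamond_norm (causal_defect qubit_swap C)"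
      using trace_norm_ge[OF contraction_isometry[OF Z_isometry], of "?E 0 0 - ?E 1 1"] by simp
  qed
qed

lemma signalling_id: "signalling (id :: ('a::finite \<times> 'b::finite) op \<Rightarrow> _) = 0"
proof (rule antisym[OF _ signalling_nonneg])
  have "signalling_defect (id :: ('a \<times> 'b) op \<Rightarrow> _) id = (\<lambda>_. 0)"
    by (simp add: signalling_defect_def)
  then show "signalling (id :: ('a \<times> 'b) op \<Rightarrow> _) \<le> 0"
    using signalling_le[OF id_channel, of "id :: ('a \<times> 'b) op \<Rightarrow> _"]
    by (simp add: diamond_norm_zero)
qed

text \<open>For the identity gate A' equals A, and T is the swap of the two copies next to the
  identity on B'; this swap is itself an admissible witness.\<close>

lemma causal_influence_id: "causal_influence (id :: ('a::finite \<times> 'b::finite) op \<Rightarrow> _) = 0"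
proof (rule antisym[OF _ causal_influence_nonneg])
  have "causal_defect (id :: ('a \<times> 'b) op \<Rightarrow> _) swap_channel = (\<lambda>_. 0)"
    by (simp add: causal_defect_def T_map_id on_first_two_def)
  then show "causal_influence (id :: ('a \<times> 'b) op \<Rightarrow> _) \<le> 0"
    using causal_influence_le[OF permutation_channels(1), of "id :: ('a \<times> 'b) op \<Rightarrow> _"]
    by (simp add: diamond_norm_zero)
qed

theorem mainTheorem13:
  shows
    "(let I = (id :: ('a::finite \<times> 'b::finite) op \<Rightarrow> ('a \<times> 'b) op) in
      \<forall>U \<in> (unitary_channels :: (('a \<times> 'b) op \<Rightarrow> ('a \<times> 'b) op) set).
      \<forall>V \<in> (unitary_channels :: (('a \<times> 'b) op \<Rightarrow> ('a \<times> 'b) op) set).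
        signalling ((U \<otimes>\<^sub>A\<^sub>B I) \<circ> (I \<otimes>\<^sub>A\<^sub>B V))
          = signalling (U \<otimes>\<^sub>A\<^sub>B V) \<and>
        signalling (U \<otimes>\<^sub>A\<^sub>B V) \<ge> max (signalling U) (signalling V) \<and>
        max (signalling U) (signalling V)
          = max (signalling (U \<otimes>\<^sub>A\<^sub>B I))
                (signalling (I \<otimes>\<^sub>A\<^sub>B V)) \<and>
        causal_influence ((U \<otimes>\<^sub>A\<^sub>B I) \<circ> (I \<otimes>\<^sub>A\<^sub>B V))
          = causal_influence (U \<otimes>\<^sub>A\<^sub>B V) \<and>
        causal_influence (U \<otimes>\<^sub>A\<^sub>B V) \<ge> max (causal_influence U) (causal_influence V) \<and>
        max (causal_influence U) (causal_influence V)
          = max (causal_influence (U \<otimes>\<^sub>A\<^sub>B I))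
                (causal_influence (I \<otimes>\<^sub>A\<^sub>B V)))
     \<and> (let I\<^sub>2 = (id :: (2 \<times> 2) op \<Rightarrow> (2 \<times> 2) op) in
       max (signalling (cnot_channel \<otimes>\<^sub>A\<^sub>B I\<^sub>2))
           (signalling (I\<^sub>2 \<otimes>\<^sub>A\<^sub>B cnot_channel)) = 1
     \<and> signalling ((cnot_channel \<otimes>\<^sub>A\<^sub>B I\<^sub>2)
                   \<circ> (I\<^sub>2 \<otimes>\<^sub>A\<^sub>B cnot_channel)) \<ge> 3 / 2
     \<and> signalling (cnot_channel \<otimes>\<^sub>A\<^sub>B cnot_channel)
         > max (signalling cnot_channel) (signalling cnot_channel))
     \<and> qubit_swap \<circ> qubit_swap = id
     \<and> signalling (qubit_swap \<circ> qubit_swap) = 0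
     \<and> signalling qubit_swap = 3 / 2
     \<and> causal_influence (qubit_swap \<circ> qubit_swap) = 0
     \<and> causal_influence qubit_swap = 2
     \<and> (\<exists>U \<in> (unitary_channels :: ((2 \<times> 2) op \<Rightarrow> (2 \<times> 2) op) set).
         \<exists>V \<in> (unitary_channels :: ((2 \<times> 2) op \<Rightarrow> (2 \<times> 2) op) set).
           signalling (U \<circ> V) < min (signalling U) (signalling V) \<and>
           causal_influence (U \<circ> V) < min (causal_influence U) (causal_influence V))"
proof (intro conjI)
  let ?I = "id :: ('a \<times> 'b) op \<Rightarrow> ('a \<times> 'b) op" and ?I2 = "id :: (2 \<times> 2) op \<Rightarrow> (2 \<times> 2) op"
  note cnot = bipartite_tensor_monotonicity[OF cnot_unitary cnot_unitary]
  have cnot1: "signalling cnot_channel = 1"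
    using signalling_cnot_le signalling_cnot_ge by (rule antisym)
  have swap: "qubit_swap \<circ> qubit_swap = ?I2"
    by (simp add: fun_eq_iff swap_swap)
  have sig_swap: "signalling qubit_swap = 3 / 2"
    using signalling_swap_le signalling_swap_ge by (rule antisym)
  show "let I = ?I in
      \<forall>U \<in> (unitary_channels :: (('a \<times> 'b) op \<Rightarrow> ('a \<times> 'b) op) set).
      \<forall>V \<in> (unitary_channels :: (('a \<times> 'b) op \<Rightarrow> ('a \<times> 'b) op) set).
        signalling ((U \<otimes>\<^sub>A\<^sub>B I) \<circ> (I \<otimes>\<^sub>A\<^sub>B V))
          = signalling (U \<otimes>\<^sub>A\<^sub>B V) \<and>
        signalling (U \<otimes>\<^sub>A\<^sub>B V) \<ge> max (signalling U) (signalling V) \<and>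
        max (signalling U) (signalling V)
          = max (signalling (U \<otimes>\<^sub>A\<^sub>B I))
                (signalling (I \<otimes>\<^sub>A\<^sub>B V)) \<and>
        causal_influence ((U \<otimes>\<^sub>A\<^sub>B I) \<circ> (I \<otimes>\<^sub>A\<^sub>B V))
          = causal_influence (U \<otimes>\<^sub>A\<^sub>B V) \<and>
        causal_influence (U \<otimes>\<^sub>A\<^sub>B V) \<ge> max (causal_influence U) (causal_influence V) \<and>
        max (causal_influence U) (causal_influence V)
          = max (causal_influence (U \<otimes>\<^sub>A\<^sub>B I))
                (causal_influence (I \<otimes>\<^sub>A\<^sub>B V))"
    unfolding Let_def
    by (intro ballI conjI) (simp_all only: bipartite_tensor_monotonicity)
  show "let I\<^sub>2 = ?I2 in
       max (signalling (cnot_channel \<otimes>\<^sub>A\<^sub>B I\<^sub>2))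
           (signalling (I\<^sub>2 \<otimes>\<^sub>A\<^sub>B cnot_channel)) = 1
     \<and> signalling ((cnot_channel \<otimes>\<^sub>A\<^sub>B I\<^sub>2)
                   \<circ> (I\<^sub>2 \<otimes>\<^sub>A\<^sub>B cnot_channel)) \<ge> 3 / 2
     \<and> signalling (cnot_channel \<otimes>\<^sub>A\<^sub>B cnot_channel)
         > max (signalling cnot_channel) (signalling cnot_channel)"
    using signalling_cnot_cnot_ge by (simp add: Let_def cnot cnot1)
  show "qubit_swap \<circ> qubit_swap = ?I2" by (rule swap)
  show "signalling (qubit_swap \<circ> qubit_swap) = 0" "causal_influence (qubit_swap \<circ> qubit_swap) = 0"
    by (simp_all only: swap signalling_id causal_influence_id)
  show "signalling qubit_swap = 3 / 2" "causal_influence qubit_swap = 2"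
    by (fact sig_swap causal_influence_swap)+
  show "\<exists>U \<in> (unitary_channels :: ((2 \<times> 2) op \<Rightarrow> (2 \<times> 2) op) set).
         \<exists>V \<in> (unitary_channels :: ((2 \<times> 2) op \<Rightarrow> (2 \<times> 2) op) set).
           signalling (U \<circ> V) < min (signalling U) (signalling V) \<and>
           causal_influence (U \<circ> V) < min (causal_influence U) (causal_influence V)"
    by (intro bexI[of _ qubit_swap] swap_unitary)
      (simp add: swap signalling_id causal_influence_id sig_swap causal_influence_swap)
qed

end
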